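(* Let $k$ be a field and let $G$ be a Cohen-Macaulay bipartite graph with bipartition $V=\{x_1,\dots,x_n\}\cup\{y_1,\dots,y_n\}$, $n\ge 1$, whose vertices are labeled so that (i) $\{x_i,y_i\}\in E$ for $i=1,\dots,n$; (ii) whenever $\{x_i,y_j\}\in E$, then $i\le j$; and (iii) whenever $\{x_i,y_j\}$ and $\{x_j,y_l\}$ are edges of $G$ with $i<j<l$, then $\{x_i,y_l\}\in E$. Thus $y_n$ is the unique vertex adjacent to $x_n$; suppose that $N(y_n)=\{x_{i_1},\dots,x_{i_s},x_n\}$. Then $$\beta_i(I(G)^{\vee})=\beta_i(I(G')^{\vee})+\beta_i(I(G'')^{\vee})+\beta_{i-1}(I(G'')^{\vee})\quad\text{for all } i\ge 0,$$ where $G'=G\setminus\{x_n,y_n\}$ and $G''=G\setminus\{x_{i_1},y_{i_1},\dots,x_{i_s},y_{i_s},x_n,y_n\}$, both of which are Cohen-Macaulay bipartite graphs.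
   Context: Graphs are finite and simple, with vertex set $V$ and edge set $E$; the vertices are identified with the variables of the polynomial ring $R=k[x_1,\dots,x_n,y_1,\dots,y_n]$. The edge ideal $I(G)$ is the ideal generated by the products $uv$ with $\{u,v\}\in E$. $G$ is Cohen-Macaulay if $R/I(G)$ is a Cohen-Macaulay ring. By a theorem of Herzog and Hibi, a bipartite graph (without isolated vertices) is Cohen-Macaulay if and only if the two parts have the same size and a labeling as in (i)-(iii) exists. $N(z)$ is the set of neighbors of the vertex $z$ ($s=0$ is allowed above). For a set $S$ of vertices, $G\setminus S$ is the graph obtained by deleting the vertices in $S$ and all edges meeting $S$. A vertex cover of $G$ is a set $W\subseteq V$ meeting every edge; it is minimal if no proper subset is a vertex cover. The cover ideal $I(G)^{\vee}$ is the ideal generated by the monomials $\prod_{w\in W}w$ over all minimal vertex covers $W$ of $G$ (if $G$ has no edges, the only minimal vertex cover is $\emptyset$ and $I(G)^\vee$ is the unit ideal). $\beta_i(L)=\dim_k\operatorname{Tor}^R_i(k,L)$ is the $i$-th total Betti number, with $\beta_{-1}=0$; the cover ideals of subgraphs of $G$ may be regarded as ideals of $R$. *)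

theory Defs
  imports "HOL-Algebra.QuotRing" "HOL-Algebra.Ring_Divisibility" "HOL-Algebra.Free_Abelian_Groups"
    "HOL-Algebra.Module" "HOL-Library.Extended_Nat"
begin

section \<open>Graphs\<close>

record 'v graph =
  verts :: "'v set"
  edges :: "'v set set"

definition simple_graph :: "'v graph \<Rightarrow> bool" where
  "simple_graph G \<longleftrightarrow> finite (verts G) \<and> (\<forall>e\<in>edges G. e \<subseteq> verts G \<and> card e = 2)"

definition bipartition :: "'v graph \<Rightarrow> 'v set \<Rightarrow> 'v set \<Rightarrow> bool" where
  "bipartition G A B \<longleftrightarrow> A \<union> B = verts G \<and> A \<inter> B = {} \<and>
     (\<forall>e\<in>edges G. \<exists>a\<in>A. \<exists>b\<in>B. e = {a, b})"

definition bipartite :: "'v graph \<Rightarrow> bool" where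
  "bipartite G \<longleftrightarrow> (\<exists>A B. bipartition G A B)"

definition neighbors :: "'v graph \<Rightarrow> 'v \<Rightarrow> 'v set" where
  "neighbors G z = {v \<in> verts G. {z, v} \<in> edges G}"

definition delete_verts :: "'v graph \<Rightarrow> 'v set \<Rightarrow> 'v graph" where
  "delete_verts G S = \<lparr>verts = verts G - S, edges = {e \<in> edges G. e \<inter> S = {}}\<rparr>"

definition vertex_cover :: "'v graph \<Rightarrow> 'v set \<Rightarrow> bool" where
  "vertex_cover G W \<longleftrightarrow> W \<subseteq> verts G \<and> (\<forall>e\<in>edges G. e \<inter> W \<noteq> {})"

definition minimal_vertex_cover :: "'v graph \<Rightarrow> 'v set \<Rightarrow> bool" where
  "minimal_vertex_cover G W \<longleftrightarrow> vertex_cover G W \<and> (\<forall>W'. W' \<subset> W \<longrightarrow> \<not> vertex_cover G W')"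

section \<open>The polynomial ring in the variables \<open>V\<close>\<close>

text \<open>A monomial is a finitely supported exponent vector, and a polynomial is a finitely
  supported family of coefficients indexed by monomials. Multiplication on the type
  \<^typ>\<open>('v \<Rightarrow>\<^sub>0 nat) \<Rightarrow>\<^sub>0 'k\<close> is convolution, that is, multiplication of polynomials.\<close>

type_synonym ('v, 'k) mpoly = "('v \<Rightarrow>\<^sub>0 nat) \<Rightarrow>\<^sub>0 'k"

definition poly_ring :: "'k::field itself \<Rightarrow> 'v set \<Rightarrow> ('v, 'k) mpoly ring" where
  "poly_ring K V =
     \<lparr>carrier = {p. \<forall>t\<in>Poly_Mapping.keys p. Poly_Mapping.keys t \<subseteq> V},
      monoid.mult = (*), one = 1, ring.zero = 0, add = (+)\<rparr>"

definition const :: "'k::field \<Rightarrow> ('v, 'k) mpoly" where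
  "const c = Poly_Mapping.single 0 c"

definition var :: "'v \<Rightarrow> ('v, 'k::field) mpoly" where
  "var v = Poly_Mapping.single (Poly_Mapping.single v 1) 1"

definition edge_ideal :: "'k::field itself \<Rightarrow> 'v graph \<Rightarrow> ('v, 'k) mpoly set" where
  "edge_ideal K G = Idl\<^bsub>poly_ring K (verts G)\<^esub> {var u * var v | u v. {u, v} \<in> edges G}"

text \<open>The parameter \<open>V\<close> (with \<^prop>\<open>verts G \<subseteq> V\<close>) allows the cover ideal of a subgraph to be
  regarded as an ideal of the polynomial ring of the larger graph.\<close>

definition cover_ideal :: "'k::field itself \<Rightarrow> 'v set \<Rightarrow> 'v graph \<Rightarrow> ('v, 'k) mpoly set" where
  "cover_ideal K V G =
     Idl\<^bsub>poly_ring K V\<^esub> {(\<Prod>w\<in>W. var w) | W. minimal_vertex_cover G W}"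

section \<open>Cohen-Macaulay rings\<close>

text \<open>The class of the fraction \<open>r/s\<close> in the localization of \<open>R\<close> at the multiplicative set \<open>S\<close>.\<close>

definition fraction :: "('a, 'm) ring_scheme \<Rightarrow> 'a set \<Rightarrow> 'a \<Rightarrow> 'a \<Rightarrow> ('a \<times> 'a) set" where
  "fraction R S r s = {(r', s') \<in> carrier R \<times> S.
     \<exists>t\<in>S. t \<otimes>\<^bsub>R\<^esub> (r \<otimes>\<^bsub>R\<^esub> s' \<ominus>\<^bsub>R\<^esub> r' \<otimes>\<^bsub>R\<^esub> s) = \<zero>\<^bsub>R\<^esub>}"

text \<open>Each union below is a union of copies of one and the same class, since the operations on
  fractions do not depend on the representatives.\<close>

definition localization :: "('a, 'm) ring_scheme \<Rightarrow> 'a set \<Rightarrow> ('a \<times> 'a) set ring" where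
  "localization R S =
     \<lparr>carrier = {fraction R S r s | r s. r \<in> carrier R \<and> s \<in> S},
      monoid.mult = (\<lambda>X Y. \<Union>(r, s)\<in>X. \<Union>(r', s')\<in>Y. fraction R S (r \<otimes>\<^bsub>R\<^esub> r') (s \<otimes>\<^bsub>R\<^esub> s')),
      one = fraction R S \<one>\<^bsub>R\<^esub> \<one>\<^bsub>R\<^esub>,
      ring.zero = fraction R S \<zero>\<^bsub>R\<^esub> \<one>\<^bsub>R\<^esub>,
      add = (\<lambda>X Y. \<Union>(r, s)\<in>X. \<Union>(r', s')\<in>Y.
               fraction R S (r \<otimes>\<^bsub>R\<^esub> s' \<oplus>\<^bsub>R\<^esub> r' \<otimes>\<^bsub>R\<^esub> s) (s \<otimes>\<^bsub>R\<^esub> s'))\<rparr>"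

definition regular_sequence :: "('a, 'm) ring_scheme \<Rightarrow> 'a list \<Rightarrow> bool" where
  "regular_sequence R as \<longleftrightarrow> set as \<subseteq> carrier R \<and>
     (\<forall>i<length as. \<forall>b\<in>carrier R.
        as ! i \<otimes>\<^bsub>R\<^esub> b \<in> Idl\<^bsub>R\<^esub> (set (take i as)) \<longrightarrow> b \<in> Idl\<^bsub>R\<^esub> (set (take i as))) \<and>
     Idl\<^bsub>R\<^esub> (set as) \<noteq> carrier R"

text \<open>The depth of a Noetherian local ring; its maximal ideal is the set of nonunits.\<close>

definition local_depth :: "('a, 'm) ring_scheme \<Rightarrow> enat" where
  "local_depth R = Sup {enat (length as) | as. set as \<subseteq> carrier R - Units R \<and> regular_sequence R as}"

definition krull_dim :: "('a, 'm) ring_scheme \<Rightarrow> enat" where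
  "krull_dim R = Sup {enat (length Ps - 1) | Ps. Ps \<noteq> [] \<and>
     (\<forall>P\<in>set Ps. primeideal P R) \<and> sorted_wrt (\<subset>) Ps}"

definition cohen_macaulay :: "('a, 'm) ring_scheme \<Rightarrow> bool" where
  "cohen_macaulay R \<longleftrightarrow> cring R \<and> noetherian_ring R \<and>
     (\<forall>M. maximalideal M R \<longrightarrow>
        local_depth (localization R (carrier R - M)) = krull_dim (localization R (carrier R - M)))"

definition cohen_macaulay_graph :: "'k::field itself \<Rightarrow> 'v graph \<Rightarrow> bool" where
  "cohen_macaulay_graph K G \<longleftrightarrow> cohen_macaulay (poly_ring K (verts G) Quot edge_ideal K G)"

section \<open>Modules, tensor products and Tor\<close>

text \<open>The record type of modules extends that of rings; its fields \<^const>\<open>monoid.mult\<close> and \<^const>\<open>one\<close> have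
  no meaning for modules and are left \<^const>\<open>undefined\<close>.\<close>

definition module_hom ::
    "('a, 'm) ring_scheme \<Rightarrow> ('a, 'b, 'p) module_scheme \<Rightarrow> ('a, 'c, 'q) module_scheme \<Rightarrow> ('b \<Rightarrow> 'c) set" where
  "module_hom R M N = {f \<in> carrier M \<rightarrow> carrier N.
     (\<forall>u\<in>carrier M. \<forall>v\<in>carrier M. f (u \<oplus>\<^bsub>M\<^esub> v) = f u \<oplus>\<^bsub>N\<^esub> f v) \<and>
     (\<forall>r\<in>carrier R. \<forall>v\<in>carrier M. f (r \<odot>\<^bsub>M\<^esub> v) = r \<odot>\<^bsub>N\<^esub> f v)}"

definition ideal_module :: "('a, 'm) ring_scheme \<Rightarrow> 'a set \<Rightarrow> ('a, 'a) module" where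
  "ideal_module R I =
     \<lparr>carrier = I, monoid.mult = undefined, one = undefined,
      ring.zero = \<zero>\<^bsub>R\<^esub>, add = add R, smult = monoid.mult R\<rparr>"

text \<open>The free module of rank \<open>n\<close>; vectors are functions on \<^typ>\<open>nat\<close> that vanish from \<open>n\<close> on.\<close>

definition free_module :: "('a, 'm) ring_scheme \<Rightarrow> nat \<Rightarrow> ('a, nat \<Rightarrow> 'a) module" where
  "free_module R n =
     \<lparr>carrier = {v. (\<forall>i<n. v i \<in> carrier R) \<and> (\<forall>i\<ge>n. v i = \<zero>\<^bsub>R\<^esub>)},
      monoid.mult = undefined, one = undefined, ring.zero = (\<lambda>i. \<zero>\<^bsub>R\<^esub>),
      add = (\<lambda>u v i. u i \<oplus>\<^bsub>R\<^esub> v i), smult = (\<lambda>r v i. r \<otimes>\<^bsub>R\<^esub> v i)\<rparr>"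

text \<open>The quotient \<open>Z/B\<close> of submodules \<open>B \<subseteq> Z\<close> of \<open>C\<close>. The union in the scalar multiplication is a
  union of copies of a single coset.\<close>

definition subquotient ::
    "('a, 'b, 'p) module_scheme \<Rightarrow> 'b set \<Rightarrow> 'b set \<Rightarrow> ('a, 'b set) module" where
  "subquotient C Z B =
     \<lparr>carrier = {B +>\<^bsub>C\<^esub> z | z. z \<in> Z}, monoid.mult = undefined, one = undefined,
      ring.zero = B, add = set_add C,
      smult = (\<lambda>r X. \<Union>x\<in>X. B +>\<^bsub>C\<^esub> (r \<odot>\<^bsub>C\<^esub> x))\<rparr>"

text \<open>The free abelian group on \<open>M \<times> N\<close>, with \<open>r\<close> acting by \<open>(m, n) \<mapsto> (r m, n)\<close>. It becomes a module
  only after dividing out the subgroup generated by the tensor relations.\<close>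

definition pre_tensor ::
    "('a, 'b, 'p) module_scheme \<Rightarrow> ('a, 'c, 'q) module_scheme \<Rightarrow> ('a, ('b \<times> 'c) \<Rightarrow>\<^sub>0 int) module" where
  "pre_tensor M N =
     \<lparr>carrier = {c. Poly_Mapping.keys c \<subseteq> carrier M \<times> carrier N},
      monoid.mult = undefined, one = undefined, ring.zero = 0, add = (+),
      smult = (\<lambda>r. frag_extend (\<lambda>(m, n). frag_of (r \<odot>\<^bsub>M\<^esub> m, n)))\<rparr>"

definition tensor_relations ::
    "('a, 'm) ring_scheme \<Rightarrow> ('a, 'b, 'p) module_scheme \<Rightarrow> ('a, 'c, 'q) module_scheme
      \<Rightarrow> (('b \<times> 'c) \<Rightarrow>\<^sub>0 int) set" where
  "tensor_relations R M N = generate (free_Abelian_group (carrier M \<times> carrier N))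
     ({frag_of (m \<oplus>\<^bsub>M\<^esub> m', n) - frag_of (m, n) - frag_of (m', n) | m m' n.
         m \<in> carrier M \<and> m' \<in> carrier M \<and> n \<in> carrier N} \<union>
      {frag_of (m, n \<oplus>\<^bsub>N\<^esub> n') - frag_of (m, n) - frag_of (m, n') | m n n'.
         m \<in> carrier M \<and> n \<in> carrier N \<and> n' \<in> carrier N} \<union>
      {frag_of (r \<odot>\<^bsub>M\<^esub> m, n) - frag_of (m, r \<odot>\<^bsub>N\<^esub> n) | r m n.
         r \<in> carrier R \<and> m \<in> carrier M \<and> n \<in> carrier N})"

definition tensor ::
    "('a, 'm) ring_scheme \<Rightarrow> ('a, 'b, 'p) module_scheme \<Rightarrow> ('a, 'c, 'q) module_scheme
      \<Rightarrow> ('a, (('b \<times> 'c) \<Rightarrow>\<^sub>0 int) set) module" where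
  "tensor R M N = subquotient (pre_tensor M N) (carrier (pre_tensor M N)) (tensor_relations R M N)"

text \<open>The map \<open>id \<otimes> f\<close> on the tensor product with \<open>M\<close>, where \<open>f\<close> is a homomorphism into \<open>N'\<close>.\<close>

definition tensor_map ::
    "('a, 'm) ring_scheme \<Rightarrow> ('a, 'b, 'p) module_scheme \<Rightarrow> ('a, 'd, 'q) module_scheme
      \<Rightarrow> ('c \<Rightarrow> 'd) \<Rightarrow> (('b \<times> 'c) \<Rightarrow>\<^sub>0 int) set \<Rightarrow> (('b \<times> 'd) \<Rightarrow>\<^sub>0 int) set" where
  "tensor_map R M N' f X =
     (\<Union>c\<in>X. tensor_relations R M N' +>\<^bsub>pre_tensor M N'\<^esub> frag_extend (\<lambda>(m, n). frag_of (m, f n)) c)"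

text \<open>A resolution \<open>\<dots> \<rightarrow> R\<^bsup>rk 1\<^esup> \<rightarrow> R\<^bsup>rk 0\<^esup> \<rightarrow> L \<rightarrow> 0\<close> by free modules of finite rank, with differentials
  \<open>d j\<close> from \<open>R\<^bsup>rk (j+1)\<^esup>\<close> to \<open>R\<^bsup>rk j\<^esup>\<close> and augmentation \<open>e\<close>. Over a Noetherian ring every finitely
  generated module has one.\<close>

definition free_resolution ::
    "('a, 'm) ring_scheme \<Rightarrow> ('a, 'b, 'p) module_scheme
      \<Rightarrow> (nat \<Rightarrow> nat) \<Rightarrow> (nat \<Rightarrow> (nat \<Rightarrow> 'a) \<Rightarrow> (nat \<Rightarrow> 'a)) \<Rightarrow> ((nat \<Rightarrow> 'a) \<Rightarrow> 'b) \<Rightarrow> bool" where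
  "free_resolution R L rk d e \<longleftrightarrow>
     (let F = (\<lambda>j. free_module R (rk j)) in
       e \<in> module_hom R (F 0) L \<and>
       (\<forall>j. d j \<in> module_hom R (F (Suc j)) (F j)) \<and>
       e ` carrier (F 0) = carrier L \<and>
       d 0 ` carrier (F 1) = a_kernel (F 0) L e \<and>
       (\<forall>j. d (Suc j) ` carrier (F (Suc (Suc j))) = a_kernel (F (Suc j)) (F j) (d j)))"

text \<open>\<open>Tor\<^sub>i(M, L)\<close> for a finitely generated module \<open>L\<close> over a Noetherian ring \<open>R\<close>: the homology in
  degree \<open>i\<close> of \<open>M \<otimes> F\<close>, where \<open>F\<close> is a chosen resolution of \<open>L\<close>. As usual it is independent of the
  choice up to isomorphism.\<close>

definition Tor ::
    "('a, 'm) ring_scheme \<Rightarrow> ('a, 'b, 'p) module_scheme \<Rightarrow> ('a, 'c, 'q) module_scheme \<Rightarrow> nat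
      \<Rightarrow> ('a, (('b \<times> (nat \<Rightarrow> 'a)) \<Rightarrow>\<^sub>0 int) set set) module" where
  "Tor R M L i =
     (let (rk, d, e) = (SOME (rk, d, e). free_resolution R L rk d e);
          C = (\<lambda>j. tensor R M (free_module R (rk j)));
          D = (\<lambda>j. tensor_map R M (free_module R (rk j)) (d j))
      in subquotient (C i)
           (case i of 0 \<Rightarrow> carrier (C 0) | Suc j \<Rightarrow> a_kernel (C (Suc j)) (C j) (D j))
           (D i ` carrier (C (Suc i))))"

section \<open>Betti numbers\<close>

text \<open>The field \<open>k\<close> as a module over the polynomial ring: every variable acts as zero.\<close>

definition residue_module :: "'k::field itself \<Rightarrow> (('v, 'k) mpoly, 'k) module" where
  "residue_module K =
     \<lparr>carrier = UNIV, monoid.mult = undefined, one = undefined, ring.zero = 0, add = (+),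
      smult = (\<lambda>p c. Poly_Mapping.lookup p 0 * c)\<rparr>"

text \<open>The dimension of a finite-dimensional \<open>k\<close>-vector space \<open>T\<close>, where \<open>k\<close> acts on the module \<open>T\<close>
  through the constant polynomials: the number of elements of a basis \<open>b\<close>.\<close>

definition vdim :: "(('v, 'k::field) mpoly, 'b, 'p) module_scheme \<Rightarrow> nat" where
  "vdim T = (THE n. \<exists>b \<in> {..<n} \<rightarrow> carrier T. \<forall>v\<in>carrier T.
     \<exists>!c. c \<in> {..<n} \<rightarrow>\<^sub>E (UNIV :: 'k set) \<and>
          v = (\<Oplus>\<^bsub>T\<^esub>i\<in>{..<n}. const (c i) \<odot>\<^bsub>T\<^esub> b i))"

definition betti :: "'k::field itself \<Rightarrow> 'v set \<Rightarrow> ('v, 'k) mpoly set \<Rightarrow> nat \<Rightarrow> nat" where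
  "betti K V I i = vdim (Tor (poly_ring K V) (residue_module K) (ideal_module (poly_ring K V) I) i)"

end

theory Submission
  imports Defs "HOL-Library.Function_Algebras"
begin

text \<open>
  Cohen-Macaulayness descends along the deletion of a closed neighborhood \<open>N[z]\<close>: inverting \<open>z\<close> in
  \<open>R/I(G)\<close> kills the neighbors of \<open>z\<close>, and setting \<open>z = 1\<close> afterwards divides by the regular element
  \<open>z - 1\<close>, which is compatible with depth because all maximal regular sequences in a maximal ideal
  of a Noetherian ring can be exchanged for one another. Taking \<open>z = x\<^sub>n\<close> gives \<open>G'\<close>. Taking
  \<open>z = y\<^sub>n\<close> leaves \<open>G''\<close> together with the vertices \<open>y\<^sub>j\<close>, \<open>j \<in> J\<close>, which are isolated by
  transitivity and are deleted in turn.

  For the Betti numbers, write \<open>L'\<close> and \<open>L''\<close> for the cover ideals of \<open>G'\<close> and \<open>G''\<close>. A cover of \<open>G\<close>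
  contains \<open>y\<^sub>n\<close>, or else \<open>x\<^sub>n\<close> and all \<open>x\<^sub>j\<close> with \<open>j \<in> J\<close>, so the cover ideal of \<open>G\<close> is
  \<open>y\<^sub>n L' + x\<^sub>n q L''\<close> with \<open>q = \<Prod>\<^bsub>j\<in>J\<^esub> x\<^sub>j\<close>; the two summands meet in \<open>x\<^sub>n y\<^sub>n q L''\<close>, a copy
  of \<open>L''\<close>. The mapping cone of minimal resolutions along \<open>L'' \<rightarrow> L' \<oplus> L''\<close> is again minimal, since
  the comparison maps are multiples of \<open>x\<^sub>n\<close> and \<open>y\<^sub>n\<close>, and the ranks in a minimal resolution are
  the Betti numbers.
\<close>

section \<open>Regular elements and prime avoidance in Noetherian rings\<close>

text \<open>\<open>local_depth\<close> is a supremum over all regular sequences, and a long sequence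
  in a localization of \<open>R/I(G)\<close> need not begin with \<open>z - 1\<close>; this is what
  forces the exchange of sequences. One-sided estimates then suffice: the dimension drops by at
  least one, the depth by at most one, and depth never exceeds dimension.

  \<open>Tor\<close> is evaluated on a resolution picked by choice, of which only exactness is
  known. A minimal resolution is therefore compared with it up to homotopy, and the outcome is read
  modulo the maximal ideal. Minimal resolutions are supplied by the recursion itself: the cone makes
  one for the graph out of those for its two subgraphs, starting from the unit ideal.

  Edge ideals and cover ideals are handled term by term. Membership in a squarefree monomial ideal
  depends only on the supports of the exponents, so that identities between ideals become statements
  about sets of vertices.\<close>

locale noetherian_cring = cring R + noetherian_ring R for R (structure)

definition regular_mod :: "('a, 'm) ring_scheme \<Rightarrow> 'a set \<Rightarrow> 'a \<Rightarrow> bool" where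
  "regular_mod R I a \<longleftrightarrow> (\<forall>b\<in>carrier R. a \<otimes>\<^bsub>R\<^esub> b \<in> I \<longrightarrow> b \<in> I)"

lemma regular_modD: "regular_mod R I a \<Longrightarrow> b \<in> carrier R \<Longrightarrow> a \<otimes>\<^bsub>R\<^esub> b \<in> I \<Longrightarrow> b \<in> I"
  by (auto simp: regular_mod_def)

text \<open>Regular sequences relative to a base set \<open>S\<close>: each element is moved into
  \<open>S\<close> once it has been tested, so an induction over the list only changes
  \<open>S\<close>. Properness of the final ideal is kept apart, since the exchange argument
  manipulates the regularity conditions alone.\<close>

fun regular_over :: "('a, 'm) ring_scheme \<Rightarrow> 'a set \<Rightarrow> 'a list \<Rightarrow> bool" where
  "regular_over R S [] \<longleftrightarrow> True"
| "regular_over R S (a # as) \<longleftrightarrow> regular_mod R (Idl\<^bsub>R\<^esub> S) a \<and> regular_over R (insert a S) as"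

lemma regular_over_iff:
  "regular_over R S as \<longleftrightarrow>
    (\<forall>i<length as. regular_mod R (Idl\<^bsub>R\<^esub> (S \<union> set (take i as))) (as ! i))"
  by (induction as arbitrary: S) (auto simp: All_less_Suc2)

lemma regular_sequence_iff:
  "regular_sequence R as \<longleftrightarrow> set as \<subseteq> carrier R \<and> regular_over R {} as \<and> Idl\<^bsub>R\<^esub> (set as) \<noteq> carrier R"
  by (auto simp: regular_sequence_def regular_over_iff regular_mod_def)

text \<open>A nonempty chain of ideals in a Noetherian ring contains its own union, so the bound
  required by Zorn's lemma lies in the family, whatever the family is.\<close>

lemma (in noetherian_ring) exists_maximal_in_family:
  assumes "F \<noteq> {}" "\<And>I. I \<in> F \<Longrightarrow> ideal I R"
  shows "\<exists>M\<in>F. \<forall>I\<in>F. M \<subseteq> I \<longrightarrow> I = M"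
proof (rule subset_Zorn)
  fix C assume C: "subset.chain F C"
  show "\<exists>U\<in>F. \<forall>X\<in>C. X \<subseteq> U"
  proof (cases "C = {}")
    case True then show ?thesis using assms by auto
  next
    case False
    have "subset.chain {I. ideal I R} C" using C assms unfolding pred_on.chain_def by blast
    then have "\<Union>C \<in> C" using ideal_chain_is_trivial[OF False] by blast
    then have "\<Union>C \<in> F" using C unfolding pred_on.chain_def by (meson subsetD)
    then show ?thesis by (intro bexI[of _ "\<Union>C"]) auto
  qed
qed

lemma (in noetherian_ring) exists_maximal_above:
  assumes "I\<^sub>0 \<in> F" "\<And>I. I \<in> F \<Longrightarrow> ideal I R"
  shows "\<exists>M\<in>F. I\<^sub>0 \<subseteq> M \<and> (\<forall>I\<in>F. M \<subseteq> I \<longrightarrow> I = M)"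
proof -
  have "{I \<in> F. I\<^sub>0 \<subseteq> I} \<noteq> {}" "\<And>I. I \<in> {I \<in> F. I\<^sub>0 \<subseteq> I} \<Longrightarrow> ideal I R"
    using assms by blast+
  from exists_maximal_in_family[OF this] show ?thesis
    by (metis (mono_tags, lifting) mem_Collect_eq order_trans)
qed

lemma (in ring) add_minus_cancel_left:
  "u \<in> carrier R \<Longrightarrow> v \<in> carrier R \<Longrightarrow> (u \<oplus> v) \<ominus> u = v"
  by (metis a_comm add.inv_closed add.m_assoc minus_eq r_neg r_zero)

lemma (in ring) add_minus_cancel_right:
  "u \<in> carrier R \<Longrightarrow> v \<in> carrier R \<Longrightarrow> (u \<oplus> v) \<ominus> v = u"
  by (metis a_comm add_minus_cancel_left)

lemma (in ring) minus_minus_cancel_left: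
  assumes "p \<in> carrier R" "q \<in> carrier R" "r \<in> carrier R"
  shows "(p \<ominus> q) \<ominus> (p \<ominus> r) = r \<ominus> q"
proof -
  have "(p \<ominus> q) \<ominus> (p \<ominus> r) = (p \<oplus> (r \<ominus> q)) \<ominus> p"
    using assms by (simp add: minus_eq minus_add a_ac)
  then show ?thesis using assms by (simp add: add_minus_cancel_left)
qed

lemma (in ring) add_minus_cancel:
  assumes "a \<in> carrier R" "b \<in> carrier R"
  shows "b \<oplus> (a \<ominus> b) = a"
  using assms by (simp add: minus_eq a_ac r_neg r_neg1 r_neg2)

lemma (in cring) ideal_minus_cancel:
  assumes "ideal I R" "a \<in> carrier R" "b \<in> I" "a \<oplus> b \<in> I"
  shows "a \<in> I"
proof -
  interpret I: ideal I R by fact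
  have "(a \<oplus> b) \<ominus> b \<in> I" using assms by (simp add: I.a_closed I.a_inv_closed minus_eq)
  moreover have "(a \<oplus> b) \<ominus> b = a" using assms I.Icarr by (simp add: minus_eq a_assoc r_neg)
  ultimately show ?thesis by simp
qed

lemma (in cring) colon_ideal:
  assumes "ideal I R" "e \<in> carrier R"
  shows "ideal {x \<in> carrier R. e \<otimes> x \<in> I} R"
  using ideal.helper_max_prime[OF assms(1) is_cring assms(2)] .

text \<open>Multiply elements outside \<open>P\<close>, one from \<open>m\<close> and one from each
  ideal in \<open>Q\<close>: the product lies in all of these ideals, and primeness keeps it outside
  \<open>P\<close>.\<close>

lemma (in cring) ideal_inter_not_subset_prime:
  assumes "finite Q" "primeideal P R" "ideal m R" "\<not> m \<subseteq> P"
    and "\<And>I. I \<in> Q \<Longrightarrow> ideal I R \<and> \<not> I \<subseteq> P"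
  shows "\<exists>w\<in>m. (\<forall>I\<in>Q. w \<in> I) \<and> w \<notin> P"
  using assms(1,5)
proof (induction Q)
  case empty then show ?case using assms by auto
next
  case (insert I Q)
  then obtain w where w: "w \<in> m" "\<forall>I\<in>Q. w \<in> I" "w \<notin> P" by blast
  obtain q where q: "q \<in> I" "q \<notin> P" using insert by blast
  interpret m: ideal m R by fact
  interpret P: primeideal P R by fact
  interpret I: ideal I R using insert by auto
  have c: "w \<in> carrier R" "q \<in> carrier R" using w q m.Icarr I.Icarr by auto
  have "w \<otimes> q \<in> m" "w \<otimes> q \<in> I" "w \<otimes> q \<notin> P"
    using m.I_r_closed[OF w(1) c(2)] I.I_l_closed[OF q(1) c(1)] P.I_prime[OF c] w q by auto
  moreover have "w \<otimes> q \<in> I'" if "I' \<in> Q" for I'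
    using ideal.I_r_closed[of I' R w q] insert.prems[of I'] that w c by auto
  ultimately show ?case by blast
qed

text \<open>Induction on the number of primes: an element avoiding all primes but \<open>P\<close>
  is corrected, if it lies in \<open>P\<close>, by an element lying in all the others but not in
  \<open>P\<close>.\<close>

lemma (in cring) prime_avoidance:
  assumes "finite Q" "\<And>P. P \<in> Q \<Longrightarrow> primeideal P R" "ideal m R" "\<And>P. P \<in> Q \<Longrightarrow> \<not> m \<subseteq> P"
  shows "\<exists>z\<in>m. \<forall>P\<in>Q. z \<notin> P"
  using assms(1,2,4)
proof (induction Q rule: finite_psubset_induct)
  case (psubset Q)
  interpret m: ideal m R by fact
  show ?case
  proof (cases "Q = {}")
    case True then show ?thesis using m.zero_closed by blast
  next
    case False
    \<comment> \<open>\<open>P\<close> is chosen minimal under inclusion so that no other member of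
      \<open>Q\<close> is contained in it; otherwise the correcting element \<open>w\<close> below
      might not exist.\<close>
    then obtain P where P: "P \<in> Q" "\<And>P'. P' \<in> Q \<Longrightarrow> P' \<subseteq> P \<Longrightarrow> P = P'"
      using finite_has_minimal[OF psubset.hyps] by metis
    obtain z where z: "z \<in> m" "\<forall>P'\<in>Q - {P}. z \<notin> P'"
      using psubset.IH[of "Q - {P}"] psubset.prems P(1) by blast
    show ?thesis
    proof (cases "z \<in> P")
      case False then show ?thesis using z by auto
    next
      case True
      have "\<exists>w\<in>m. (\<forall>I\<in>Q - {P}. w \<in> I) \<and> w \<notin> P"
      proof (rule ideal_inter_not_subset_prime[OF _ _ assms(3)])
        show "finite (Q - {P})" using psubset.hyps by simp
        show "primeideal P R" "\<not> m \<subseteq> P" using psubset.prems P(1) by auto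
        show "ideal I R \<and> \<not> I \<subseteq> P" if "I \<in> Q - {P}" for I
          using that P psubset.prems(1) by (auto intro: primeideal.axioms(1))
      qed
      then obtain w where w: "w \<in> m" "\<forall>I\<in>Q - {P}. w \<in> I" "w \<notin> P" by blast
      have c: "z \<in> carrier R" "w \<in> carrier R" using z w m.Icarr by auto
      have "z \<oplus> w \<notin> P'" if "P' \<in> Q" for P'
      proof (cases "P' = P")
        case True
        then show ?thesis
          using ideal_minus_cancel[of P w z] w \<open>z \<in> P\<close> c psubset.prems(1)[OF P(1)]
          by (auto simp: a_comm primeideal.axioms(1))
      next
        case False
        then show ?thesis
          using ideal_minus_cancel[of P' z w] w z c psubset.prems(1)[OF that] that
          by (auto simp: primeideal.axioms(1))
      qed
      then show ?thesis using m.a_closed z w by blast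
    qed
  qed
qed

text \<open>Zero divisors modulo an ideal form a finite union of associated primes. These are the maximal
  colon ideals; there are finitely many of them because the corresponding elements span a finitely
  generated ideal.\<close>

lemma (in noetherian_cring) zero_divisors_union_primes:
  assumes I: "ideal I R"
  shows "\<exists>Q. finite Q \<and> (\<forall>P\<in>Q. primeideal P R)
    \<and> (\<forall>P\<in>Q. \<exists>e\<in>carrier R - I. P = {x \<in> carrier R. e \<otimes> x \<in> I})
    \<and> (\<forall>a\<in>carrier R. regular_mod R I a \<longleftrightarrow> (\<forall>P\<in>Q. a \<notin> P))"
proof -
  interpret I: ideal I R by fact
  define col where "col = (\<lambda>e. {x \<in> carrier R. e \<otimes> x \<in> I})"
  have col: "ideal (col e) R" if "e \<in> carrier R" for e
    unfolding col_def using colon_ideal[OF I that] .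
  define A where "A = col ` (carrier R - I)"
  define E where "E = {e \<in> carrier R - I. \<forall>J\<in>A. col e \<subseteq> J \<longrightarrow> J = col e}"
  have Ec: "E \<subseteq> carrier R" by (auto simp: E_def)
  have prime: "primeideal (col e) R" if e: "e \<in> E" for e
  proof (rule primeidealI)
    have ec: "e \<in> carrier R" "e \<notin> I" using e by (auto simp: E_def)
    show "ideal (col e) R" using col ec by auto
    show "cring R" by (rule is_cring)
    have "\<one> \<notin> col e" using ec by (simp add: col_def)
    then show "carrier R \<noteq> col e" by auto
    fix a b assume ab: "a \<in> carrier R" "b \<in> carrier R" "a \<otimes> b \<in> col e"
    show "a \<in> col e \<or> b \<in> col e"
    proof (rule disjCI)
      assume "b \<notin> col e"
      then have be: "e \<otimes> b \<notin> I" using ab by (auto simp: col_def)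
      \<comment> \<open>Replacing \<open>e\<close> by \<open>e \<otimes> b\<close> can only enlarge
        the colon ideal, so maximality forces equality, and \<open>a\<close> visibly belongs to the
        new one.\<close>
      have "col e \<subseteq> col (e \<otimes> b)"
      proof
        fix x assume "x \<in> col e"
        then have "x \<in> carrier R" "e \<otimes> x \<in> I" by (auto simp: col_def)
        moreover have "e \<otimes> b \<otimes> x = (e \<otimes> x) \<otimes> b"
          using ec ab \<open>x \<in> carrier R\<close> by (simp add: m_ac)
        ultimately show "x \<in> col (e \<otimes> b)" using I.I_r_closed ab by (auto simp: col_def)
      qed
      moreover have "col (e \<otimes> b) \<in> A" using be ec ab by (auto simp: A_def)
      ultimately have "col (e \<otimes> b) = col e" using e by (auto simp: E_def)
      moreover have "e \<otimes> b \<otimes> a \<in> I"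
      proof -
        have "e \<otimes> b \<otimes> a = e \<otimes> (a \<otimes> b)" using ec ab by (simp add: m_ac)
        then show ?thesis using ab by (auto simp: col_def)
      qed
      ultimately show "a \<in> col e" using ab by (auto simp: col_def)
    qed
  qed
  \<comment> \<open>A maximal member of \<open>F\<close> is the ideal generated by all of
    \<open>E\<close>, exhibited with finitely many generators \<open>E'\<close> taken from
    \<open>E\<close>.\<close>
  define F where "F = {Idl E' | E'. finite E' \<and> E' \<subseteq> E}"
  have "F \<noteq> {}" "\<And>J. J \<in> F \<Longrightarrow> ideal J R" using Ec by (auto simp: F_def intro!: genideal_ideal)
  from exists_maximal_in_family[OF this] obtain E' where
    E': "finite E'" "E' \<subseteq> E" "\<And>J. J \<in> F \<Longrightarrow> Idl E' \<subseteq> J \<Longrightarrow> J = Idl E'"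
    by (auto simp: F_def)
  have E_Idl: "e \<in> Idl E'" if "e \<in> E" for e
  proof -
    have "Idl (insert e E') \<in> F" using E' that by (auto simp: F_def)
    moreover have "Idl E' \<subseteq> Idl (insert e E')" using that E' Ec by (intro subset_Idl_subset) auto
    ultimately have "Idl (insert e E') = Idl E'" using E'(3) by auto
    then show ?thesis using genideal_self[of "insert e E'"] that E' Ec by blast
  qed
  \<comment> \<open>Otherwise, by maximality, \<open>col e\<close> contains none of the ideals
    \<open>col e'\<close>, so some \<open>w\<close> lies in all of them but not in the prime
    \<open>col e\<close>. This \<open>w\<close> multiplies \<open>E'\<close> into \<open>I\<close>,
    hence also \<open>e\<close>, which lies in the ideal generated by \<open>E'\<close>: a
    contradiction.\<close>
  have eq: "col e \<in> col ` E'" if e: "e \<in> E" for e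
  proof (rule ccontr)
    assume no: "col e \<notin> col ` E'"
    have "\<not> col e' \<subseteq> col e" if "e' \<in> E'" for e'
    proof
      assume "col e' \<subseteq> col e"
      moreover have "col e \<in> A" using e by (auto simp: A_def E_def)
      ultimately have "col e = col e'" using that E'(2) by (auto simp: E_def)
      with no that show False by auto
    qed
    note not_sub = this
    have "\<exists>w\<in>carrier R. (\<forall>J\<in>col ` E'. w \<in> J) \<and> w \<notin> col e"
    proof (rule ideal_inter_not_subset_prime[OF _ prime[OF e] oneideal])
      show "finite (col ` E')" using E'(1) by simp
      show "\<not> carrier R \<subseteq> col e"
        using primeideal.I_notcarr[OF prime[OF e]] by (auto simp: col_def)
      show "ideal I' R \<and> \<not> I' \<subseteq> col e" if "I' \<in> col ` E'" for I'
        using that not_sub col E'(2) Ec by blast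
    qed
    then obtain w where w: "w \<in> carrier R" "\<forall>e'\<in>E'. w \<in> col e'" "w \<notin> col e" by auto
    have "ideal {x \<in> carrier R. w \<otimes> x \<in> I} R" by (rule colon_ideal[OF I w(1)])
    moreover have "E' \<subseteq> {x \<in> carrier R. w \<otimes> x \<in> I}"
      using w E' Ec by (auto simp: col_def m_comm)
    ultimately have "Idl E' \<subseteq> {x \<in> carrier R. w \<otimes> x \<in> I}" by (rule genideal_minimal)
    then have "w \<otimes> e \<in> I" "e \<in> carrier R" using E_Idl[OF e] by auto
    then show False using w by (auto simp: col_def m_comm)
  qed
  show ?thesis
  proof (intro exI[of _ "col ` E"] conjI ballI)
    have "col ` E \<subseteq> col ` E'" using eq by auto
    then show "finite (col ` E)" using E'(1) by (meson finite_imageI finite_subset)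
    show "primeideal P R" if "P \<in> col ` E" for P using that prime by auto
    show "\<exists>e\<in>carrier R - I. P = {x \<in> carrier R. e \<otimes> x \<in> I}" if "P \<in> col ` E" for P
      using that by (auto simp: col_def E_def)
    show "regular_mod R I a \<longleftrightarrow> (\<forall>P\<in>col ` E. a \<notin> P)" if a: "a \<in> carrier R" for a
    proof
      assume "regular_mod R I a"
      then show "\<forall>P\<in>col ` E. a \<notin> P"
        using a by (fastforce simp: col_def E_def m_comm dest: regular_modD)
    next
      assume r: "\<forall>P\<in>col ` E. a \<notin> P"
      show "regular_mod R I a"
        unfolding regular_mod_def
      proof (intro ballI impI, rule ccontr)
        fix b assume b: "b \<in> carrier R" "a \<otimes> b \<in> I" "b \<notin> I"
        then have "col b \<in> A" by (auto simp: A_def)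
        moreover have "\<And>J. J \<in> A \<Longrightarrow> ideal J R" using col by (auto simp: A_def)
        ultimately obtain M where M: "M \<in> A" "col b \<subseteq> M" "\<forall>J\<in>A. M \<subseteq> J \<longrightarrow> J = M"
          using exists_maximal_above[of "col b" A] by blast
        from M(1) obtain e where "e \<in> carrier R - I" "M = col e" by (auto simp: A_def)
        with M(3) have "e \<in> E" by (auto simp: E_def)
        moreover have "a \<in> M" using M(2) a b(1,2) by (auto simp: col_def m_comm)
        ultimately show False using r \<open>M = col e\<close> by blast
      qed
    qed
  qed
qed

text \<open>The associated primes of both ideals form one finite set, and none of them contains
  \<open>m\<close> because of the witnesses \<open>a\<close> and \<open>b\<close>; prime avoidance
  handles all of them at once.\<close>

lemma (in noetherian_cring) common_regular_element:
  assumes I: "ideal I R" and J: "ideal J R" and m: "ideal m R"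
    and "a \<in> m" "regular_mod R I a" "b \<in> m" "regular_mod R J b"
  shows "\<exists>z\<in>m. regular_mod R I z \<and> regular_mod R J z"
proof -
  obtain Q where Q: "finite Q" "\<forall>P\<in>Q. primeideal P R"
    "\<forall>P\<in>Q. \<exists>e\<in>carrier R - I. P = {x \<in> carrier R. e \<otimes> x \<in> I}"
    "\<forall>a\<in>carrier R. regular_mod R I a \<longleftrightarrow> (\<forall>P\<in>Q. a \<notin> P)"
    using zero_divisors_union_primes[OF I] by (elim exE conjE) (rule that)
  obtain Q' where Q': "finite Q'" "\<forall>P\<in>Q'. primeideal P R"
    "\<forall>P\<in>Q'. \<exists>e\<in>carrier R - J. P = {x \<in> carrier R. e \<otimes> x \<in> J}"
    "\<forall>a\<in>carrier R. regular_mod R J a \<longleftrightarrow> (\<forall>P\<in>Q'. a \<notin> P)"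
    using zero_divisors_union_primes[OF J] by (elim exE conjE) (rule that)
  have c: "\<And>x. x \<in> m \<Longrightarrow> x \<in> carrier R" using m by (rule ideal.Icarr)
  have ac: "\<forall>P\<in>Q. a \<notin> P" "\<forall>P\<in>Q'. b \<notin> P" using Q(4) Q'(4) assms c by auto
  have "\<exists>z\<in>m. \<forall>P\<in>Q \<union> Q'. z \<notin> P"
  proof (rule prime_avoidance[OF _ _ m])
    show "finite (Q \<union> Q')" using Q(1) Q'(1) by simp
    show "primeideal P R" if "P \<in> Q \<union> Q'" for P using that Q(2) Q'(2) by blast
    show "\<not> m \<subseteq> P" if "P \<in> Q \<union> Q'" for P using that ac assms by blast
  qed
  then show ?thesis using Q(4) Q'(4) c by (metis Un_iff)
qed

text \<open>An ideal of zero divisors is covered by the associated primes, hence contained in one of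
  them by prime avoidance, and that prime is the colon ideal of a single element
  \<open>e\<close>.\<close>

lemma (in noetherian_cring) all_zero_divisors_annihilator:
  assumes I: "ideal I R" and m: "ideal m R" and "\<And>z. z \<in> m \<Longrightarrow> \<not> regular_mod R I z"
  shows "\<exists>e\<in>carrier R - I. \<forall>z\<in>m. e \<otimes> z \<in> I"
proof -
  obtain Q where Q: "finite Q" "\<forall>P\<in>Q. primeideal P R"
    "\<forall>P\<in>Q. \<exists>e\<in>carrier R - I. P = {x \<in> carrier R. e \<otimes> x \<in> I}"
    "\<forall>a\<in>carrier R. regular_mod R I a \<longleftrightarrow> (\<forall>P\<in>Q. a \<notin> P)"
    using zero_divisors_union_primes[OF I] by (elim exE conjE) (rule that)
  have c: "\<And>x. x \<in> m \<Longrightarrow> x \<in> carrier R" using m by (rule ideal.Icarr)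
  obtain P where P: "P \<in> Q" "m \<subseteq> P"
    using prime_avoidance[of Q m] m Q c assms(3) by metis
  then obtain e where "e \<in> carrier R - I" "P = {x \<in> carrier R. e \<otimes> x \<in> I}" using Q(3) by blast
  then show ?thesis using P by blast
qed

lemma (in cring) Idl_insert:
  assumes S: "S \<subseteq> carrier R" and a: "a \<in> carrier R"
  shows "Idl (insert a S) = {a \<otimes> c \<oplus> i | c i. c \<in> carrier R \<and> i \<in> Idl S}"
proof -
  have i1: "ideal (Idl {a}) R" and i2: "ideal (Idl S) R" using assms by (auto intro!: genideal_ideal)
  have "Idl (insert a S) = Idl (Idl {a} \<union> Idl S)"
  proof
    show "Idl (insert a S) \<subseteq> Idl (Idl {a} \<union> Idl S)"
      using assms genideal_self[of S] genideal_self'[OF a] i1 i2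
      by (intro subset_Idl_subset) (auto dest: ideal.Icarr)
    have "Idl {a} \<subseteq> Idl (insert a S)" "Idl S \<subseteq> Idl (insert a S)"
      using assms by (intro subset_Idl_subset; blast)+
    then show "Idl (Idl {a} \<union> Idl S) \<subseteq> Idl (insert a S)"
      using assms by (intro genideal_minimal genideal_ideal) auto
  qed
  also have "\<dots> = Idl {a} <+> Idl S" by (rule union_genideal[OF i1 i2])
  also have "\<dots> = {a \<otimes> c \<oplus> i | c i. c \<in> carrier R \<and> i \<in> Idl S}"
    unfolding cgenideal_eq_genideal[OF a, symmetric] set_add_def' cgenideal_def
    using a by (auto, (metis m_comm)+)
  finally show ?thesis .
qed

lemma (in cring) Idl_insertI:
  assumes "S \<subseteq> carrier R" "a \<in> carrier R" "c \<in> carrier R" "i \<in> Idl S"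
  shows "a \<otimes> c \<oplus> i \<in> Idl (insert a S)"
  using assms by (auto simp: Idl_insert)

section \<open>Exchange of regular sequences\<close>

text \<open>From \<open>a u = z v\<close> modulo \<open>Idl S\<close>, regularity of
  \<open>z\<close> modulo \<open>a\<close> gives \<open>v = a w\<close> modulo \<open>Idl S\<close>;
  cancelling \<open>a\<close> leaves \<open>u = z w\<close>.\<close>

lemma (in cring) regular_mod_swap:
  assumes "S \<subseteq> carrier R" "a \<in> carrier R" "z \<in> carrier R"
    and "regular_mod R (Idl S) a" "regular_mod R (Idl (insert a S)) z"
  shows "regular_mod R (Idl (insert z S)) a"
  unfolding regular_mod_def
proof (intro ballI impI)
  interpret I: ideal "Idl S" R using assms by (intro genideal_ideal) auto
  fix u assume u: "u \<in> carrier R" "a \<otimes> u \<in> Idl (insert z S)"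
  then obtain v i where v: "v \<in> carrier R" "i \<in> Idl S" "a \<otimes> u = z \<otimes> v \<oplus> i"
    by (auto simp: Idl_insert assms)
  have ic: "i \<in> carrier R" using v by auto
  have "z \<otimes> v = a \<otimes> u \<oplus> \<ominus> i" unfolding v(3) using assms v ic by (simp add: a_assoc r_neg)
  then have "z \<otimes> v \<in> Idl (insert a S)"
    using Idl_insertI[OF assms(1,2) u(1) I.a_inv_closed[OF v(2)]] by simp
  then have "v \<in> Idl (insert a S)" by (rule regular_modD[OF assms(5) v(1)])
  then obtain w j where w: "w \<in> carrier R" "j \<in> Idl S" "v = a \<otimes> w \<oplus> j"
    by (auto simp: Idl_insert assms)
  have jc: "j \<in> carrier R" using w by auto
  have "a \<otimes> (u \<ominus> z \<otimes> w) = a \<otimes> u \<ominus> z \<otimes> (a \<otimes> w)"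
    using assms u w by (simp add: minus_eq r_distr r_minus m_ac)
  also have "\<dots> = (z \<otimes> (a \<otimes> w \<oplus> j) \<oplus> i) \<ominus> z \<otimes> (a \<otimes> w)"
    unfolding v(3) w(3) ..
  also have "\<dots> = z \<otimes> j \<oplus> i"
    using assms w jc ic by (simp add: r_distr a_assoc add_minus_cancel_left)
  also have "\<dots> \<in> Idl S" using v w assms by (simp add: I.I_l_closed I.a_closed)
  finally have "u \<ominus> z \<otimes> w \<in> Idl S"
    by (rule regular_modD[OF assms(4), rotated]) (use assms(3) u(1) w(1) in simp)
  moreover have "z \<otimes> w \<oplus> (u \<ominus> z \<otimes> w) = u" using assms(3) u(1) w(1) by (simp add: add_minus_cancel)
  ultimately show "u \<in> Idl (insert z S)" using Idl_insertI[OF assms(1,3) w(1)] by metis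
qed

text \<open>If \<open>m\<close> consisted of zero divisors modulo \<open>insert a S\<close>, some
  \<open>e\<close> outside that ideal would be multiplied into it by all of \<open>m\<close>. The
  equation \<open>e b = a f\<close> modulo \<open>Idl S\<close> passes from \<open>e\<close> to an
  element \<open>f\<close> with the same behavior modulo \<open>insert b S\<close>: this is the
  isomorphism between the socles of the two quotients in elementary form. Regularity of
  \<open>c\<close> forces \<open>f\<close> into the ideal of \<open>insert b S\<close>, and
  cancelling \<open>b\<close> brings \<open>e\<close> back into the ideal of
  \<open>insert a S\<close>.\<close>

lemma (in noetherian_cring) regular_mod_exchange:
  assumes S: "S \<subseteq> carrier R" and m: "ideal m R" and ab: "a \<in> m" "b \<in> m" "c \<in> m"
    and ra: "regular_mod R (Idl S) a" and rb: "regular_mod R (Idl S) b"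
    and rc: "regular_mod R (Idl (insert b S)) c"
  shows "\<exists>z\<in>m. regular_mod R (Idl (insert a S)) z"
proof (rule ccontr)
  assume no: "\<not> ?thesis"
  have cc: "a \<in> carrier R" "b \<in> carrier R" "c \<in> carrier R" using ab m ideal.Icarr by metis+
  interpret I: ideal "Idl S" R using S by (intro genideal_ideal) auto
  have "ideal (Idl (insert a S)) R" using S cc by (intro genideal_ideal) auto
  with no obtain e where e: "e \<in> carrier R" "e \<notin> Idl (insert a S)"
    "\<And>z. z \<in> m \<Longrightarrow> e \<otimes> z \<in> Idl (insert a S)"
    using all_zero_divisors_annihilator[OF _ m] by blast
  obtain f i where f: "f \<in> carrier R" "i \<in> Idl S" "e \<otimes> b = a \<otimes> f \<oplus> i"
    using e(3)[OF ab(2)] by (auto simp: Idl_insert S cc)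
  have ic: "i \<in> carrier R" using f by auto
  have "c \<otimes> f \<in> Idl (insert b S)"
  proof -
    obtain g j where g: "g \<in> carrier R" "j \<in> Idl S" "e \<otimes> c = a \<otimes> g \<oplus> j"
      using e(3)[OF ab(3)] by (auto simp: Idl_insert S cc)
    have jc: "j \<in> carrier R" using g by auto
    \<comment> \<open>Cross-multiplication: \<open>c\<close> times the first equation and
      \<open>b\<close> times the second share the term \<open>b c e\<close>, so \<open>a\<close>
      times \<open>c f - b g\<close> falls into \<open>Idl S\<close>, and \<open>a\<close>
      cancels.\<close>
    have "a \<otimes> f = e \<otimes> b \<ominus> i" "a \<otimes> g = e \<otimes> c \<ominus> j"
      unfolding f(3) g(3) using cc f(1) g(1) ic jc by (simp_all add: add_minus_cancel_right)
    moreover have "a \<otimes> (c \<otimes> f \<ominus> b \<otimes> g) = c \<otimes> (a \<otimes> f) \<ominus> b \<otimes> (a \<otimes> g)"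
      using cc f(1) g(1) by (simp add: minus_eq r_distr r_minus m_ac)
    moreover have "c \<otimes> (e \<otimes> b \<ominus> i) \<ominus> b \<otimes> (e \<otimes> c \<ominus> j) = b \<otimes> j \<ominus> c \<otimes> i"
    proof -
      have "c \<otimes> (e \<otimes> b \<ominus> i) = b \<otimes> (e \<otimes> c) \<ominus> c \<otimes> i"
        using cc e(1) ic by (simp add: minus_eq r_distr r_minus m_ac)
      moreover have "b \<otimes> (e \<otimes> c \<ominus> j) = b \<otimes> (e \<otimes> c) \<ominus> b \<otimes> j"
        using cc e(1) jc by (simp add: minus_eq r_distr r_minus)
      ultimately show ?thesis using cc e(1) ic jc by (simp add: minus_minus_cancel_left)
    qed
    ultimately have "a \<otimes> (c \<otimes> f \<ominus> b \<otimes> g) = b \<otimes> j \<ominus> c \<otimes> i" by simp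
    also have "\<dots> \<in> Idl S" using f g cc
      by (simp add: I.I_l_closed I.a_closed I.a_inv_closed minus_eq)
    finally have *: "c \<otimes> f \<ominus> b \<otimes> g \<in> Idl S"
      by (rule regular_modD[OF ra, rotated]) (use f(1) g(1) cc in simp)
    have "b \<otimes> g \<oplus> (c \<otimes> f \<ominus> b \<otimes> g) = c \<otimes> f" using cc f(1) g(1) by (simp add: add_minus_cancel)
    with Idl_insertI[OF S cc(2) g(1) *] show ?thesis by metis
  qed
  then have "f \<in> Idl (insert b S)" by (rule regular_modD[OF rc f(1)])
  then obtain h k where h: "h \<in> carrier R" "k \<in> Idl S" "f = b \<otimes> h \<oplus> k"
    by (auto simp: Idl_insert S cc)
  have kc: "k \<in> carrier R" using h by auto
  have "b \<otimes> (e \<ominus> a \<otimes> h) = e \<otimes> b \<ominus> a \<otimes> b \<otimes> h"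
    using cc e(1) h(1) by (simp add: minus_eq r_distr r_minus m_ac)
  also have "\<dots> = a \<otimes> (b \<otimes> h \<oplus> k) \<oplus> i \<ominus> a \<otimes> b \<otimes> h" unfolding f(3) h(3) ..
  also have "\<dots> = a \<otimes> k \<oplus> i"
    using cc h kc ic by (simp add: r_distr a_assoc m_assoc add_minus_cancel_left)
  also have "\<dots> \<in> Idl S" using f h cc by (simp add: I.I_l_closed I.a_closed)
  finally have *: "e \<ominus> a \<otimes> h \<in> Idl S" 
    by (rule regular_modD[OF rb, rotated]) (use e(1) h(1) cc in simp)
  have "a \<otimes> h \<oplus> (e \<ominus> a \<otimes> h) = e" using cc e(1) h(1) by (simp add: add_minus_cancel)
  with Idl_insertI[OF S cc(1) h(1) *] e(2) show False by metis
qed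

text \<open>The new first element \<open>a\<close> and the old one \<open>b\<close> are linked by an
  auxiliary \<open>z\<close> that is regular modulo each of them. The induction hypothesis is
  applied twice: over \<open>insert b S\<close> to bring \<open>z\<close> in, then over
  \<open>insert z S\<close> to trade \<open>b\<close> for \<open>a\<close>.\<close>

theorem (in noetherian_cring) regular_sequence_exchange:
  assumes "ideal m R" "S \<subseteq> carrier R" "a \<in> m" "regular_mod R (Idl S) a"
    and "regular_over R S bs" "set bs \<subseteq> m" "length bs = Suc d"
  shows "\<exists>cs. regular_over R (insert a S) cs \<and> set cs \<subseteq> m \<and> length cs = d"
  using assms(2-)
proof (induction d arbitrary: S a bs)
  case 0 then show ?case by (intro exI[of _ "[]"]) auto
next
  case (Suc d)
  note m = assms(1)
  have c: "\<And>x. x \<in> m \<Longrightarrow> x \<in> carrier R" using m by (rule ideal.Icarr)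
  obtain b b2 bs' where bs: "bs = b # b2 # bs'" using Suc.prems by (metis Suc_length_conv)
  have ab: "a \<in> carrier R" "b \<in> carrier R" "b \<in> m" "b2 \<in> m" using Suc.prems bs c by auto
  \<comment> \<open>The two elements \<open>b\<close>, \<open>b2\<close> already show that something
    in \<open>m\<close> is regular after \<open>a\<close>; together with \<open>b2\<close>, which is
    regular after \<open>b\<close>, this yields a common \<open>z\<close>.\<close>
  obtain z0 where "z0 \<in> m" "regular_mod R (Idl (insert a S)) z0"
    using regular_mod_exchange[OF Suc.prems(1) m, of a b b2] Suc.prems bs by auto
  moreover have "regular_mod R (Idl (insert b S)) b2" using Suc.prems bs by auto
  moreover have "ideal (Idl (insert a S)) R" "ideal (Idl (insert b S)) R"
    using Suc.prems ab by (auto intro!: genideal_ideal)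
  ultimately obtain z where z: "z \<in> m" "regular_mod R (Idl (insert a S)) z"
    "regular_mod R (Idl (insert b S)) z"
    using common_regular_element m \<open>b2 \<in> m\<close> by meson
  have zc: "z \<in> carrier R" using z c by auto
  have "\<exists>cs. regular_over R (insert z (insert b S)) cs \<and> set cs \<subseteq> m \<and> length cs = d"
    using Suc.prems bs ab z by (intro Suc.IH[of _ _ "b2 # bs'"]) auto
  then obtain cs where cs: "regular_over R (insert z (insert b S)) cs" "set cs \<subseteq> m" "length cs = d"
    by blast
  \<comment> \<open>Both \<open>a\<close> and \<open>b\<close> stay regular when \<open>z\<close> is
    moved in front of them, so \<open>b # cs\<close> is a sequence of length \<open>Suc d\<close>
    over \<open>insert z S\<close> in which \<open>b\<close> can be traded for
    \<open>a\<close>.\<close>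
  have "regular_mod R (Idl (insert z S)) b" "regular_mod R (Idl (insert z S)) a"
    using Suc.prems bs ab z zc by (auto intro: regular_mod_swap)
  then have "\<exists>ds. regular_over R (insert a (insert z S)) ds \<and> set ds \<subseteq> m \<and> length ds = d"
    using Suc.prems ab zc cs by (intro Suc.IH[of _ _ "b # cs"]) (auto simp: insert_commute)
  then obtain ds where ds: "regular_over R (insert a (insert z S)) ds" "set ds \<subseteq> m" "length ds = d"
    by blast
  then show ?case using z by (intro exI[of _ "z # ds"]) (auto simp: insert_commute)
qed

section \<open>Depth and dimension\<close>

lemma (in cring) Idl_ideal: "ideal I R \<Longrightarrow> Idl I = I"
  by (meson genideal_minimal genideal_self ideal.Icarr order_refl subsetI subset_antisym)

lemma (in cring) Idl_empty: "Idl {} = {\<zero>}"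
proof
  show "Idl {} \<subseteq> {\<zero>}" by (rule genideal_minimal[OF zeroideal]) simp
  show "{\<zero>} \<subseteq> Idl {}"
    using additive_subgroup.zero_closed[OF ideal.axioms(1)[OF genideal_ideal[of "{}"]]] by simp
qed

lemma (in noetherian_cring) exists_prime_above:
  assumes I: "ideal I R" and "I \<noteq> carrier R"
  shows "\<exists>P. primeideal P R \<and> I \<subseteq> P"
proof -
  define F where "F = {J. ideal J R \<and> J \<noteq> carrier R}"
  have "I \<in> F" "\<And>J. J \<in> F \<Longrightarrow> ideal J R" using assms by (auto simp: F_def)
  from exists_maximal_above[OF this] obtain M where
    M: "M \<in> F" "I \<subseteq> M" "\<forall>J\<in>F. M \<subseteq> J \<longrightarrow> J = M" by blast
  have "maximalideal M R"
    using M by (intro maximalidealI) (auto simp: F_def)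
  then show ?thesis using maximalideal_prime M(2) by blast
qed

text \<open>\<open>Q\<close> is maximal among the ideals above \<open>I\<close> that avoid all
  products of an element outside \<open>P\<close> with a power of \<open>a\<close>. These products
  form a multiplicative set, so \<open>Q\<close> is prime; the zeroth power puts \<open>Q\<close>
  inside \<open>P\<close>, and \<open>s = \<one>\<close> keeps \<open>a\<close> outside
  \<open>Q\<close>. Regularity of \<open>a\<close> makes \<open>I\<close> itself a
  candidate.\<close>

lemma (in noetherian_cring) exists_prime_below:
  assumes I: "ideal I R" and P: "primeideal P R" and IP: "I \<subseteq> P"
    and a: "a \<in> carrier R" "regular_mod R I a"
  shows "\<exists>Q. primeideal Q R \<and> I \<subseteq> Q \<and> Q \<subseteq> P \<and> a \<notin> Q"
proof -
  interpret P: primeideal P R by fact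
  define F where "F = {J. ideal J R \<and> I \<subseteq> J \<and> (\<forall>s\<in>carrier R - P. \<forall>k::nat. s \<otimes> a [^] k \<notin> J)}"
  have one: "\<one> \<notin> P" using P.one_imp_carrier P.I_notcarr by auto
  have pow: "s \<in> I" if "s \<in> carrier R" "s \<otimes> a [^] (k::nat) \<in> I" for s k
    using that(2)
  proof (induction k)
    case 0 then show ?case using that by simp
  next
    case (Suc k)
    then have "a \<otimes> (s \<otimes> a [^] k) \<in> I" using that(1) a(1) by (simp add: m_ac)
    then have "s \<otimes> a [^] k \<in> I"
      by (rule regular_modD[OF a(2), rotated]) (use that(1) a(1) in simp)
    then show ?case by (rule Suc.IH)
  qed
  have "s \<otimes> a [^] (k::nat) \<notin> I" if "s \<in> carrier R - P" for s k
    using pow[of s k] that IP by (meson DiffD1 DiffD2 subsetD)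
  then have "I \<in> F" using I by (simp add: F_def)
  moreover have "\<And>J. J \<in> F \<Longrightarrow> ideal J R" by (simp add: F_def)
  ultimately obtain Q where Q: "Q \<in> F" "I \<subseteq> Q" "\<forall>J\<in>F. Q \<subseteq> J \<longrightarrow> J = Q"
    using exists_maximal_above[of I F] by metis
  have iQ: "ideal Q R" and nQ: "\<And>s k. s \<in> carrier R \<Longrightarrow> s \<notin> P \<Longrightarrow> s \<otimes> a [^] (k::nat) \<notin> Q"
    using Q(1) by (auto simp: F_def)
  interpret Q: ideal Q R by fact
  have "\<one> \<otimes> a [^] (0::nat) \<notin> Q" "\<one> \<otimes> a [^] (1::nat) \<notin> Q"
    using nQ[OF one_closed one] by blast+
  then have nin: "\<one> \<notin> Q" "a \<notin> Q" using a by auto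
  have QP: "Q \<subseteq> P"
  proof
    fix q assume q: "q \<in> Q"
    then show "q \<in> P" using nQ[of q 0] Q.Icarr by auto
  qed
  have ext: "\<exists>s\<in>carrier R - P. \<exists>k::nat. \<exists>c\<in>carrier R. \<exists>q\<in>Q. s \<otimes> a [^] k = x \<otimes> c \<oplus> q"
    if x: "x \<in> carrier R" "x \<notin> Q" for x
  proof -
    have Qc: "Q \<subseteq> carrier R" using Q.Icarr by auto
    have i: "ideal (Idl (insert x Q)) R" using x Qc by (intro genideal_ideal) auto
    have sub: "insert x Q \<subseteq> Idl (insert x Q)" using x Qc by (intro genideal_self) auto
    then have "Idl (insert x Q) \<noteq> Q" using x by auto
    then have "Idl (insert x Q) \<notin> F" using Q(3) sub by blast
    then obtain s k where s: "s \<in> carrier R - P" "s \<otimes> a [^] (k::nat) \<in> Idl (insert x Q)"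
      using i sub Q(2) by (auto simp: F_def)
    then show ?thesis unfolding Idl_insert[OF Qc x(1)] Idl_ideal[OF iQ] by blast
  qed
  have "primeideal Q R"
  proof (rule primeidealI[OF iQ is_cring])
    show "carrier R \<noteq> Q" using nin by auto
    fix x y assume xy: "x \<in> carrier R" "y \<in> carrier R" "x \<otimes> y \<in> Q"
    show "x \<in> Q \<or> y \<in> Q"
    proof (rule ccontr)
      assume "\<not> (x \<in> Q \<or> y \<in> Q)"
      then obtain s k c q s' k' c' q' where
        s: "s \<in> carrier R" "s \<notin> P" "c \<in> carrier R" "q \<in> Q" "s \<otimes> a [^] (k::nat) = x \<otimes> c \<oplus> q" and
        s': "s' \<in> carrier R" "s' \<notin> P" "c' \<in> carrier R" "q' \<in> Q" "s' \<otimes> a [^] (k'::nat) = y \<otimes> c' \<oplus> q'"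
        using ext[of x] ext[of y] xy by blast
      have qc: "q \<in> carrier R" "q' \<in> carrier R" using s s' by auto
      \<comment> \<open>The product of the two witnesses is again one of the forbidden elements, yet
        every term of its expansion contains \<open>x \<otimes> y\<close>, \<open>q\<close> or
        \<open>q'\<close> and so lies in \<open>Q\<close>.\<close>
      have "(s \<otimes> s') \<otimes> a [^] (k + k') = (s \<otimes> a [^] k) \<otimes> (s' \<otimes> a [^] k')"
        using s(1) s'(1) a(1) by (simp add: nat_pow_mult[symmetric] m_ac)
      also have "\<dots> = (x \<otimes> y) \<otimes> (c \<otimes> c') \<oplus> ((x \<otimes> c) \<otimes> q' \<oplus> (y \<otimes> c' \<oplus> q') \<otimes> q)"
        unfolding s(5) s'(5) using xy(1,2) s(3) s'(3) qc
        by (simp add: r_distr l_distr m_ac a_ac)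
      also have "\<dots> \<in> Q"
        using xy s(3,4) s'(3,4) qc by (intro Q.a_closed) (auto intro: Q.I_l_closed Q.I_r_closed)
      finally have "(s \<otimes> s') \<otimes> a [^] (k + k') \<in> Q" .
      moreover have "s \<otimes> s' \<notin> P" using P.I_prime s s' by blast
      ultimately show False using nQ s(1) s'(1) by blast
    qed
  qed
  then show ?thesis using Q(2) QP nin by blast
qed

text \<open>The chain is built downwards. The primes obtained for \<open>insert a S\<close> all
  contain \<open>a\<close>; as \<open>a\<close> is regular modulo \<open>S\<close>, a prime missing
  \<open>a\<close> fits below the smallest of them.\<close>

lemma (in noetherian_cring) regular_over_prime_chain:
  assumes "S \<subseteq> carrier R" "set as \<subseteq> carrier R" "regular_over R S as"
    and "primeideal P R" "S \<union> set as \<subseteq> P"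
  shows "\<exists>Ps. length Ps = Suc (length as) \<and> sorted_wrt (\<subset>) Ps \<and> (\<forall>Q\<in>set Ps. primeideal Q R \<and> S \<subseteq> Q)"
  using assms
proof (induction as arbitrary: S)
  case Nil then show ?case by (intro exI[of _ "[P]"]) auto
next
  case (Cons a as)
  from Cons.IH[of "insert a S"] Cons.prems obtain Ps where
    Ps: "length Ps = Suc (length as)" "sorted_wrt (\<subset>) Ps"
    "\<forall>Q\<in>set Ps. primeideal Q R \<and> insert a S \<subseteq> Q" by auto
  then obtain P0 Ps' where P0: "Ps = P0 # Ps'" by (metis Suc_length_conv)
  have pr: "primeideal P0 R" "insert a S \<subseteq> P0" using Ps P0 by auto
  have "ideal (Idl S) R" using Cons.prems by (intro genideal_ideal) auto
  moreover have "Idl S \<subseteq> P0" using pr by (intro genideal_minimal) (auto intro: primeideal.axioms(1))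
  moreover have "a \<in> carrier R" "regular_mod R (Idl S) a" using Cons.prems by auto
  ultimately obtain Q where Q: "primeideal Q R" "Idl S \<subseteq> Q" "Q \<subseteq> P0" "a \<notin> Q"
    using exists_prime_below[of "Idl S" P0 a] pr(1) by blast
  have "S \<subseteq> Q" using Q genideal_self Cons.prems by blast
  moreover have "Q \<subset> P0" using Q pr by blast
  ultimately show ?case
  proof (intro exI[of _ "Q # Ps"] conjI)
    have "Q \<subset> P'" if "P' \<in> set Ps" for P'
    proof (cases "P' = P0")
      case False
      with that Ps(2) P0 have "P0 \<subset> P'" by simp
      with \<open>Q \<subset> P0\<close> show ?thesis by (rule psubset_trans)
    qed (use \<open>Q \<subset> P0\<close> in simp)
    with Ps(2) show "sorted_wrt (\<subset>) (Q # Ps)" by simp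
    show "\<forall>P'\<in>set (Q # Ps). primeideal P' R \<and> S \<subseteq> P'" using Ps(3) Q(1) \<open>S \<subseteq> Q\<close> by simp
  qed (use Ps(1) in simp)
qed

lemma (in noetherian_cring) local_depth_le_krull_dim: "local_depth R \<le> krull_dim R"
  unfolding local_depth_def
proof (rule Sup_least)
  fix d assume "d \<in> {enat (length as) |as. set as \<subseteq> carrier R - Units R \<and> regular_sequence R as}"
  then obtain as where as: "d = enat (length as)" "set as \<subseteq> carrier R" "regular_over R {} as"
    "Idl (set as) \<noteq> carrier R" by (auto simp: regular_sequence_iff)
  obtain P where "primeideal P R" "Idl (set as) \<subseteq> P"
    using exists_prime_above[OF genideal_ideal as(4)] as(2) by blast
  moreover have "set as \<subseteq> Idl (set as)" by (rule genideal_self[OF as(2)])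
  ultimately obtain Ps where Ps: "length Ps = Suc (length as)" "sorted_wrt (\<subset>) Ps"
    "\<forall>Q\<in>set Ps. primeideal Q R"
    using regular_over_prime_chain[of "{}" as P] as by auto
  have "Ps \<noteq> []" using Ps(1) by auto
  then show "d \<le> krull_dim R"
    unfolding krull_dim_def as(1) using Ps by (intro Sup_upper CollectI exI[of _ Ps]) simp
qed

lemma Sup_enat_add_1_le:
  assumes "A \<noteq> {}" "\<And>x. x \<in> A \<Longrightarrow> x + 1 \<le> c"
  shows "Sup A + 1 \<le> (c :: enat)"
proof (cases c)
  case (enat n)
  obtain x where "x \<in> A" using assms by auto
  with assms(2)[of x] enat have n: "n \<ge> 1" by (cases x) (auto simp: one_enat_def)
  have "Sup A \<le> enat (n - 1)"
  proof (rule Sup_least)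
    fix x assume "x \<in> A"
    with assms(2)[of x] enat show "x \<le> enat (n - 1)" by (cases x) (auto simp: one_enat_def)
  qed
  then have "Sup A + 1 \<le> enat (n - 1) + 1" by (rule add_right_mono)
  then show ?thesis using n enat by (simp add: one_enat_def)
qed simp

section \<open>Ideals, dimension and depth along a surjective ring homomorphism\<close>

locale surjective_hom = C: cring C + D: cring D + ring_hom_ring C D h
  for C (structure) and D (structure) and h +
  assumes surj: "h ` carrier C = carrier D"
begin

lemma obtain_preimage: "d \<in> carrier D \<Longrightarrow> \<exists>c\<in>carrier C. h c = d"
  unfolding surj[symmetric] by auto

lemma vimage_primeideal:
  assumes "primeideal P D"
  shows "primeideal {r \<in> carrier C. h r \<in> P} C"
proof -
  interpret P: primeideal P D by fact
  show ?thesis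
  proof (rule primeidealI[OF _ C.is_cring])
    show "ideal {r \<in> carrier C. h r \<in> P} C" by (rule ideal_vimage[OF P.is_ideal])
    have "h \<one> \<notin> P" using P.one_imp_carrier P.I_notcarr by auto
    then show "carrier C \<noteq> {r \<in> carrier C. h r \<in> P}" using C.one_closed by blast
    show "x \<in> {r \<in> carrier C. h r \<in> P} \<or> y \<in> {r \<in> carrier C. h r \<in> P}"
      if "x \<in> carrier C" "y \<in> carrier C" "x \<otimes> y \<in> {r \<in> carrier C. h r \<in> P}" for x y
      using that P.I_prime by auto
  qed
qed

lemma vimage_maximalideal:
  assumes "maximalideal M D"
  shows "maximalideal {r \<in> carrier C. h r \<in> M} C"
proof -
  interpret M: maximalideal M D by fact
  have iM: "ideal {r \<in> carrier C. h r \<in> M} C" by (rule ideal_vimage[OF M.is_ideal])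
  show ?thesis
  proof (rule maximalidealI[OF iM])
    have "h \<one> \<notin> M" using M.one_imp_carrier M.I_notcarr by auto
    then show "carrier C \<noteq> {r \<in> carrier C. h r \<in> M}" using C.one_closed by blast
    fix J assume J: "ideal J C" "{r \<in> carrier C. h r \<in> M} \<subseteq> J" "J \<subseteq> carrier C"
    interpret J: ideal J C by fact
    show "J = {r \<in> carrier C. h r \<in> M} \<or> J = carrier C"
    proof (rule ccontr)
      assume "\<not> (J = {r \<in> carrier C. h r \<in> M} \<or> J = carrier C)"
      then have "J \<noteq> carrier C" "J \<noteq> {r \<in> carrier C. h r \<in> M}" by auto
      with J obtain j where j: "j \<in> J" "h j \<notin> M" "j \<in> carrier C" by blast
      have Mc: "M \<subseteq> carrier D" using M.Icarr by auto
      have sub: "insert (h j) M \<subseteq> Idl\<^bsub>D\<^esub> (insert (h j) M)"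
        using j Mc by (intro D.genideal_self) auto
      have "ideal (Idl\<^bsub>D\<^esub> (insert (h j) M)) D" using j Mc by (intro D.genideal_ideal) auto
      then have "Idl\<^bsub>D\<^esub> (insert (h j) M) = M \<or> Idl\<^bsub>D\<^esub> (insert (h j) M) = carrier D"
        using sub by (intro M.I_maximal) (auto dest: ideal.Icarr)
      then have "\<one>\<^bsub>D\<^esub> \<in> Idl\<^bsub>D\<^esub> (insert (h j) M)" using sub j by auto
      moreover have "h j \<in> carrier D" using j by simp
      ultimately obtain d i where d: "d \<in> carrier D" "i \<in> M" "\<one>\<^bsub>D\<^esub> = h j \<otimes>\<^bsub>D\<^esub> d \<oplus>\<^bsub>D\<^esub> i"
        using D.Idl_insert[OF Mc] D.Idl_ideal[OF M.is_ideal] by auto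
      obtain r where r: "r \<in> carrier C" "h r = d" using obtain_preimage d by blast
      have ic: "i \<in> carrier D" using d by auto
      have "h (\<one> \<ominus> j \<otimes> r) = \<one>\<^bsub>D\<^esub> \<ominus>\<^bsub>D\<^esub> h j \<otimes>\<^bsub>D\<^esub> d"
        using j r by (simp add: C.minus_eq D.minus_eq)
      also have "\<dots> = i" unfolding d(3) using d(1) ic j
        by (simp add: D.minus_eq D.a_ac D.r_neg D.r_neg1 D.r_neg2)
      finally have "\<one> \<ominus> j \<otimes> r \<in> J" using J(2) d(2) j r by auto
      moreover have "j \<otimes> r \<in> J" using j r by (simp add: J.I_r_closed)
      ultimately have "j \<otimes> r \<oplus> (\<one> \<ominus> j \<otimes> r) \<in> J" by (rule J.a_closed[rotated])
      then have "J = carrier C" using J.one_imp_carrier j r by (simp add: C.add_minus_cancel)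
      with \<open>J \<noteq> carrier C\<close> show False by simp
    qed
  qed
qed

lemma genideal_image:
  assumes "ideal J D" "{r \<in> carrier C. h r \<in> J} = Idl X" "X \<subseteq> carrier C"
  shows "J = Idl\<^bsub>D\<^esub> (h ` X)"
proof
  have Xc: "h ` X \<subseteq> carrier D" using assms(3) by auto
  have "X \<subseteq> Idl X" by (rule C.genideal_self[OF assms(3)])
  then have "h ` X \<subseteq> J" using assms(2) by auto
  then show "Idl\<^bsub>D\<^esub> (h ` X) \<subseteq> J" by (rule D.genideal_minimal[OF assms(1)])
  have "ideal {r \<in> carrier C. h r \<in> Idl\<^bsub>D\<^esub> (h ` X)} C"
    by (rule ideal_vimage[OF D.genideal_ideal[OF Xc]])
  moreover have "X \<subseteq> {r \<in> carrier C. h r \<in> Idl\<^bsub>D\<^esub> (h ` X)}"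
    using D.genideal_self[OF Xc] assms(3) by auto
  ultimately have sub: "Idl X \<subseteq> {r \<in> carrier C. h r \<in> Idl\<^bsub>D\<^esub> (h ` X)}" by (rule C.genideal_minimal)
  show "J \<subseteq> Idl\<^bsub>D\<^esub> (h ` X)"
  proof
    fix d assume d: "d \<in> J"
    then obtain c where "c \<in> carrier C" "h c = d"
      using obtain_preimage ideal.Icarr[OF assms(1)] by blast
    then show "d \<in> Idl\<^bsub>D\<^esub> (h ` X)" using sub assms(2) d by auto
  qed
qed

lemma noetherian_image: "noetherian_ring C \<Longrightarrow> noetherian_ring D"
proof (rule D.noetherian_ringI)
  assume "noetherian_ring C"
  then interpret noetherian_ring C .
  fix J assume J: "ideal J D"
  obtain X where X: "X \<subseteq> carrier C" "finite X" "{r \<in> carrier C. h r \<in> J} = Idl X"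
    using finetely_gen[OF ideal_vimage[OF J]] by auto
  have "J = Idl\<^bsub>D\<^esub> (h ` X)" by (rule genideal_image[OF J X(3,1)])
  then show "\<exists>A\<subseteq>carrier D. finite A \<and> J = Idl\<^bsub>D\<^esub> A" using X by (intro exI[of _ "h ` X"]) auto
qed

text \<open>A chain of primes of \<open>D\<close> pulls back to primes of \<open>C\<close> that all
  contain \<open>a\<close>; since \<open>a\<close> is regular, one more prime, missing
  \<open>a\<close>, fits below. The prime \<open>P\<close> guarantees that there is a chain at all:
  the supremum of the empty set would be 0, and adding 1 to it would not be justified.\<close>

lemma krull_dim_add_1_le:
  assumes "noetherian_ring C" and a: "a \<in> carrier C" "h a = \<zero>\<^bsub>D\<^esub>" "regular_mod C {\<zero>} a"
    and P: "primeideal P D"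
  shows "krull_dim D + 1 \<le> krull_dim C"
proof -
  interpret N: noetherian_cring C using assms(1) C.is_cring by (simp add: noetherian_cring_def)
  show ?thesis
    unfolding krull_dim_def[of D]
  proof (rule Sup_enat_add_1_le)
    show "{enat (length Ps - 1) |Ps. Ps \<noteq> [] \<and> (\<forall>P\<in>set Ps. primeideal P D) \<and> sorted_wrt (\<subset>) Ps} \<noteq> {}"
      using P by (auto intro!: exI[of _ "[P]"])
    fix x assume "x \<in> {enat (length Ps - 1) |Ps. Ps \<noteq> [] \<and> (\<forall>P\<in>set Ps. primeideal P D) \<and> sorted_wrt (\<subset>) Ps}"
    then obtain Ps where Ps: "x = enat (length Ps - 1)" "Ps \<noteq> []" "\<forall>P\<in>set Ps. primeideal P D"
      "sorted_wrt (\<subset>) Ps" by auto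
    define pre where "pre = (\<lambda>P. {r \<in> carrier C. h r \<in> P})"
    obtain P0 Ps' where P0: "Ps = P0 # Ps'" using Ps by (cases Ps) auto
    have ip: "\<And>P. P \<in> set Ps \<Longrightarrow> ideal P D" using Ps(3) primeideal.axioms(1) by blast
    have pre_mono: "pre P \<subset> pre Q" if "P \<subset> Q" "P \<in> set Ps" "Q \<in> set Ps" for P Q
    proof -
      from that(1) obtain q where q: "q \<in> Q" "q \<notin> P" by blast
      then have "q \<in> carrier D" using ip that(3) ideal.Icarr by metis
      then show ?thesis using q that obtain_preimage[of q] by (auto simp: pre_def)
    qed
    have prime: "primeideal (pre P) C" if "P \<in> set Ps" for P
      unfolding pre_def using vimage_primeideal Ps(3) that by blast
    have zP: "\<zero>\<^bsub>D\<^esub> \<in> P0" using ip[of P0] P0 by (auto intro: additive_subgroup.zero_closed ideal.axioms(1))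
    obtain Q where Q: "primeideal Q C" "Q \<subseteq> pre P0" "a \<notin> Q"
      using N.exists_prime_below[OF C.zeroideal prime, of P0 a] P0 zP a by (auto simp: pre_def)
    have "a \<in> pre P0" using a zP by (auto simp: pre_def)
    then have QP: "Q \<subset> pre P0" using Q by auto
    have "sorted_wrt (\<subset>) (map pre Ps)"
      unfolding sorted_wrt_map
      by (rule sorted_wrt_mono_rel[OF _ Ps(4)]) (use pre_mono in auto)
    then have "sorted_wrt (\<subset>) (Q # map pre Ps)" using QP P0 by auto
    then have "enat (length (Q # map pre Ps) - 1) \<le> krull_dim C"
      unfolding krull_dim_def using Q(1) prime by (intro Sup_upper) (auto intro!: exI[of _ "Q # map pre Ps"])
    moreover have "enat (length (Q # map pre Ps) - 1) = x + 1" using Ps by (simp add: one_enat_def)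
    ultimately show "x + 1 \<le> krull_dim C" by simp
  qed
qed

text \<open>That \<open>Idl S\<close> is the full preimage of the ideal of \<open>S'\<close>
  survives adjoining matching generators. Started with a generator of the kernel on one side and
  nothing on the other, this carries regularity conditions from \<open>C\<close> to
  \<open>D\<close>.\<close>

lemma Idl_correspondence_insert:
  assumes S: "S \<subseteq> carrier C" "S' \<subseteq> carrier D" and c: "c \<in> carrier C"
    and corr: "\<forall>x\<in>carrier C. x \<in> Idl S \<longleftrightarrow> h x \<in> Idl\<^bsub>D\<^esub> S'" and x: "x \<in> carrier C"
  shows "x \<in> Idl (insert c S) \<longleftrightarrow> h x \<in> Idl\<^bsub>D\<^esub> (insert (h c) S')"
proof
  interpret I: ideal "Idl S" C by (rule C.genideal_ideal[OF S(1)])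
  interpret I': ideal "Idl\<^bsub>D\<^esub> S'" D by (rule D.genideal_ideal[OF S(2)])
  have hc: "h c \<in> carrier D" using c by simp
  {
    assume "x \<in> Idl (insert c S)"
    then obtain r i where r: "r \<in> carrier C" "i \<in> Idl S" "x = c \<otimes> r \<oplus> i"
      by (auto simp: C.Idl_insert[OF S(1) c])
    have i: "i \<in> carrier C" using r by auto
    then have "h i \<in> Idl\<^bsub>D\<^esub> S'" using corr r by auto
    then have "h c \<otimes>\<^bsub>D\<^esub> h r \<oplus>\<^bsub>D\<^esub> h i \<in> Idl\<^bsub>D\<^esub> (insert (h c) S')"
      using r by (intro D.Idl_insertI S hc) auto
    then show "h x \<in> Idl\<^bsub>D\<^esub> (insert (h c) S')" unfolding r(3) using r(1) c i by simp
  next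
    assume "h x \<in> Idl\<^bsub>D\<^esub> (insert (h c) S')"
    then obtain d j where d: "d \<in> carrier D" "j \<in> Idl\<^bsub>D\<^esub> S'" "h x = h c \<otimes>\<^bsub>D\<^esub> d \<oplus>\<^bsub>D\<^esub> j"
      by (auto simp: D.Idl_insert[OF S(2) hc])
    have j: "j \<in> carrier D" using d by auto
    obtain r where r: "r \<in> carrier C" "h r = d" using obtain_preimage d by blast
    have "h (x \<ominus> c \<otimes> r) = h x \<ominus>\<^bsub>D\<^esub> h c \<otimes>\<^bsub>D\<^esub> d"
      using x c r by (simp add: C.minus_eq D.minus_eq)
    also have "\<dots> = j" unfolding d(3) using d(1) j c
      by (simp add: D.minus_eq D.a_ac D.r_neg D.r_neg1 D.r_neg2)
    finally have "x \<ominus> c \<otimes> r \<in> Idl S" using corr d(2) x c r(1) by auto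
    from C.Idl_insertI[OF S(1) c r(1) this] show "x \<in> Idl (insert c S)"
      using x c r(1) by (simp add: C.add_minus_cancel)
  }
qed

lemma Idl_correspondence_list:
  assumes S: "S \<subseteq> carrier C" "S' \<subseteq> carrier D" and cs: "set cs \<subseteq> carrier C"
    and corr: "\<forall>x\<in>carrier C. x \<in> Idl S \<longleftrightarrow> h x \<in> Idl\<^bsub>D\<^esub> S'"
  shows "\<forall>x\<in>carrier C. x \<in> Idl (S \<union> set cs) \<longleftrightarrow> h x \<in> Idl\<^bsub>D\<^esub> (S' \<union> h ` set cs)"
  using cs
proof (induction cs)
  case (Cons c cs)
  then have "\<forall>x\<in>carrier C. x \<in> Idl (insert c (S \<union> set cs)) \<longleftrightarrow> h x \<in> Idl\<^bsub>D\<^esub> (insert (h c) (S' \<union> h ` set cs))"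
    using S by (intro ballI Idl_correspondence_insert) auto
  then show ?case by simp
qed (use corr in simp)

lemma regular_over_image:
  assumes "S \<subseteq> carrier C" "S' \<subseteq> carrier D" "set cs \<subseteq> carrier C"
    and "\<forall>x\<in>carrier C. x \<in> Idl S \<longleftrightarrow> h x \<in> Idl\<^bsub>D\<^esub> S'" "regular_over C S cs"
  shows "regular_over D S' (map h cs)"
  using assms
proof (induction cs arbitrary: S S')
  case (Cons c cs)
  have "regular_mod D (Idl\<^bsub>D\<^esub> S') (h c)"
    unfolding regular_mod_def
  proof (intro ballI impI)
    fix d assume d: "d \<in> carrier D" "h c \<otimes>\<^bsub>D\<^esub> d \<in> Idl\<^bsub>D\<^esub> S'"
    obtain r where r: "r \<in> carrier C" "h r = d" using obtain_preimage d by blast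
    then have "c \<otimes> r \<in> Idl S" using Cons.prems d by auto
    then have "r \<in> Idl S" using Cons.prems(5) r by (auto simp: regular_mod_def)
    then show "d \<in> Idl\<^bsub>D\<^esub> S'" using Cons.prems(4) r by auto
  qed
  moreover have "\<forall>x\<in>carrier C. x \<in> Idl (insert c S) \<longleftrightarrow> h x \<in> Idl\<^bsub>D\<^esub> (insert (h c) S')"
    using Cons.prems by (intro ballI Idl_correspondence_insert) auto
  then have "regular_over D (insert (h c) S') (map h cs)"
    using Cons.prems by (intro Cons.IH[of "insert c S"]) auto
  ultimately show ?case by simp
qed simp

text \<open>Any regular sequence of nonunits can be exchanged for one of the same length that begins
  with \<open>a\<close>; dropping \<open>a\<close> and applying \<open>h\<close> gives a regular
  sequence of \<open>D\<close> that is shorter by one.\<close>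

lemma local_depth_le_add_1:
  assumes "noetherian_ring C" and m: "ideal (carrier C - Units C) C"
    and a: "a \<in> carrier C - Units C" "h a = \<zero>\<^bsub>D\<^esub>" "regular_mod C {\<zero>} a"
    and ker: "\<And>x. x \<in> carrier C \<Longrightarrow> h x = \<zero>\<^bsub>D\<^esub> \<Longrightarrow> \<exists>c\<in>carrier C. x = a \<otimes> c"
  shows "local_depth C \<le> local_depth D + 1"
  unfolding local_depth_def[of C]
proof (rule Sup_least)
  interpret N: noetherian_cring C using assms(1) C.is_cring by (simp add: noetherian_cring_def)
  define m where "m = carrier C - Units C"
  fix d assume "d \<in> {enat (length as) |as. set as \<subseteq> carrier C - Units C \<and> regular_sequence C as}"
  then obtain bs where bs: "d = enat (length bs)" "set bs \<subseteq> m" "regular_over C {} bs"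
    by (auto simp: regular_sequence_iff m_def)
  show "d \<le> local_depth D + 1"
  proof (cases "length bs")
    case 0 then show ?thesis using bs by (simp add: zero_enat_def[symmetric])
  next
    case (Suc k)
    have "\<exists>cs. regular_over C (insert a {}) cs \<and> set cs \<subseteq> m \<and> length cs = k"
      using a bs m Suc unfolding m_def
      by (intro N.regular_sequence_exchange) (auto simp: C.Idl_empty)
    then obtain cs where cs: "regular_over C {a} cs" "set cs \<subseteq> m" "length cs = k" by blast
    have csc: "set cs \<subseteq> carrier C" using cs by (auto simp: m_def)
    have ac: "{a} \<subseteq> carrier C" using a by auto
    \<comment> \<open>The kernel of \<open>h\<close> is generated by \<open>a\<close>, so
      \<open>{a}\<close> corresponds to the empty set of generators.\<close>
    have corr: "\<forall>x\<in>carrier C. x \<in> Idl {a} \<longleftrightarrow> h x \<in> Idl\<^bsub>D\<^esub> {}"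
    proof
      fix x assume x: "x \<in> carrier C"
      have "x \<in> Idl {a} \<longleftrightarrow> (\<exists>c\<in>carrier C. x = a \<otimes> c)"
        using a by (subst C.Idl_insert) (auto simp: C.Idl_empty, metis C.m_closed C.r_zero)
      also have "\<dots> \<longleftrightarrow> h x \<in> Idl\<^bsub>D\<^esub> {}"
        using ker[OF x] a by (auto simp: D.Idl_empty)
      finally show "x \<in> Idl {a} \<longleftrightarrow> h x \<in> Idl\<^bsub>D\<^esub> {}" .
    qed
    have reg: "regular_over D {} (map h cs)"
      using regular_over_image[OF ac _ csc corr cs(1)] by simp
    have corr': "\<forall>x\<in>carrier C. x \<in> Idl ({a} \<union> set cs) \<longleftrightarrow> h x \<in> Idl\<^bsub>D\<^esub> ({} \<union> h ` set cs)"
      by (rule Idl_correspondence_list[OF ac _ csc corr]) simp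
    have "Idl ({a} \<union> set cs) \<subseteq> m"
      using m cs a unfolding m_def by (intro C.genideal_minimal) auto
    then have "\<one> \<notin> Idl ({a} \<union> set cs)" by (auto simp: m_def)
    then have one: "\<one>\<^bsub>D\<^esub> \<notin> Idl\<^bsub>D\<^esub> (h ` set cs)" using corr' by auto
    have hcs: "h ` set cs \<subseteq> carrier D" using csc by auto
    interpret I: ideal "Idl\<^bsub>D\<^esub> (h ` set cs)" D by (rule D.genideal_ideal[OF hcs])
    \<comment> \<open>The image of a nonunit could be a unit in general; here the images lie in an
      ideal not containing 1.\<close>
    have nu: "h ` set cs \<subseteq> carrier D - Units D"
    proof
      fix y assume y: "y \<in> h ` set cs"
      then have yI: "y \<in> Idl\<^bsub>D\<^esub> (h ` set cs)" using D.genideal_self[OF hcs] by auto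
      have "y \<notin> Units D"
      proof
        assume "y \<in> Units D"
        then have "inv\<^bsub>D\<^esub> y \<otimes>\<^bsub>D\<^esub> y \<in> Idl\<^bsub>D\<^esub> (h ` set cs)"
          using yI by (intro I.I_l_closed) auto
        then show False using one \<open>y \<in> Units D\<close> by simp
      qed
      then show "y \<in> carrier D - Units D" using y hcs by auto
    qed
    have "regular_sequence D (map h cs)"
      unfolding regular_sequence_iff using reg hcs one by auto
    then have "enat (length (map h cs)) \<le> local_depth D"
      unfolding local_depth_def using nu by (intro Sup_upper CollectI exI[of _ "map h cs"]) simp
    then have "enat k \<le> local_depth D" using cs by simp
    then have "enat k + 1 \<le> local_depth D + 1" by (rule add_right_mono)
    then show ?thesis using bs Suc by (simp add: one_enat_def)
  qed
qed

end

section \<open>Localization\<close>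

locale localizing = cring R for R (structure) +
  fixes S :: "'a set"
  assumes sub: "S \<subseteq> carrier R" and one_in: "\<one> \<in> S"
    and mult_in: "s \<in> S \<Longrightarrow> t \<in> S \<Longrightarrow> s \<otimes> t \<in> S"
begin

abbreviation fr :: "'a \<Rightarrow> 'a \<Rightarrow> ('a \<times> 'a) set" where "fr \<equiv> fraction R S"
abbreviation L :: "('a \<times> 'a) set ring" where "L \<equiv> localization R S"

lemma S_carrier: "s \<in> S \<Longrightarrow> s \<in> carrier R"
  using sub by auto

context
  notes S_carrier [simp] one_in [simp] mult_in [simp]
begin

lemma mem_fr:
  assumes "r \<in> carrier R" "s \<in> S"
  shows "(r', s') \<in> fr r s \<longleftrightarrow> r' \<in> carrier R \<and> s' \<in> S \<and> (\<exists>t\<in>S. t \<otimes> (r \<otimes> s') = t \<otimes> (r' \<otimes> s))"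
proof -
  have "t \<otimes> (r \<otimes> s' \<ominus> r' \<otimes> s) = \<zero> \<longleftrightarrow> t \<otimes> (r \<otimes> s') = t \<otimes> (r' \<otimes> s)"
    if "t \<in> S" "r' \<in> carrier R" "s' \<in> S" for t
  proof -
    have "t \<otimes> (r \<otimes> s' \<ominus> r' \<otimes> s) = t \<otimes> (r \<otimes> s') \<ominus> t \<otimes> (r' \<otimes> s)"
      using assms that by (simp add: minus_eq r_distr r_minus)
    then show ?thesis using assms that by simp
  qed
  then show ?thesis by (auto simp: fraction_def)
qed

lemma mem_frE:
  assumes "(p, q) \<in> fr r s" "r \<in> carrier R" "s \<in> S"
  obtains t where "p \<in> carrier R" "q \<in> S" "t \<in> S" "t \<otimes> (r \<otimes> q) = t \<otimes> (p \<otimes> s)"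
  using assms(1) unfolding mem_fr[OF assms(2,3)] by blast

lemma fr_eqI:
  assumes "r \<in> carrier R" "s \<in> S" "r' \<in> carrier R" "s' \<in> S" "t \<in> S"
    and "t \<otimes> (r \<otimes> s') = t \<otimes> (r' \<otimes> s)"
  shows "fr r s = fr r' s'"
proof -
  have sub: "fr r\<^sub>1 s\<^sub>1 \<subseteq> fr r\<^sub>2 s\<^sub>2"
    if c: "r\<^sub>1 \<in> carrier R" "s\<^sub>1 \<in> S" "r\<^sub>2 \<in> carrier R" "s\<^sub>2 \<in> S"
      and e: "t \<otimes> (r\<^sub>1 \<otimes> s\<^sub>2) = t \<otimes> (r\<^sub>2 \<otimes> s\<^sub>1)" for r\<^sub>1 s\<^sub>1 r\<^sub>2 s\<^sub>2
  proof
    fix x assume x: "x \<in> fr r\<^sub>1 s\<^sub>1"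
    obtain p q where pq: "x = (p, q)" by (cases x)
    from x obtain u where u: "p \<in> carrier R" "q \<in> S" "u \<in> S" "u \<otimes> (r\<^sub>1 \<otimes> q) = u \<otimes> (p \<otimes> s\<^sub>1)"
      unfolding pq mem_fr[OF c(1,2)] by auto
    have "(t \<otimes> u \<otimes> s\<^sub>1) \<otimes> (r\<^sub>2 \<otimes> q) = (u \<otimes> q) \<otimes> (t \<otimes> (r\<^sub>2 \<otimes> s\<^sub>1))"
      using u(1-3) c assms(5) by (simp add: m_ac)
    also have "\<dots> = (t \<otimes> s\<^sub>2) \<otimes> (u \<otimes> (r\<^sub>1 \<otimes> q))"
      unfolding e[symmetric] using u(1-3) c assms(5) by (simp add: m_ac)
    also have "\<dots> = (t \<otimes> u \<otimes> s\<^sub>1) \<otimes> (p \<otimes> s\<^sub>2)"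
      unfolding u(4) using u(1-3) c assms(5) by (simp add: m_ac)
    finally show "x \<in> fr r\<^sub>2 s\<^sub>2"
      unfolding pq mem_fr[OF c(3,4)] using u c assms(5) by (auto intro!: bexI[of _ "t \<otimes> u \<otimes> s\<^sub>1"])
  qed
  show ?thesis using sub[OF assms(1-4,6)] sub[OF assms(3,4,1,2) assms(6)[symmetric]] by blast
qed

lemma fr_self: "r \<in> carrier R \<Longrightarrow> s \<in> S \<Longrightarrow> (r, s) \<in> fr r s"
  unfolding mem_fr by auto

lemma fr_eq_iff:
  assumes "r \<in> carrier R" "s \<in> S" "r' \<in> carrier R" "s' \<in> S"
  shows "fr r s = fr r' s' \<longleftrightarrow> (\<exists>t\<in>S. t \<otimes> (r \<otimes> s') = t \<otimes> (r' \<otimes> s))"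
proof
  assume "fr r s = fr r' s'"
  then have "(r', s') \<in> fr r s" using fr_self assms by simp
  then show "\<exists>t\<in>S. t \<otimes> (r \<otimes> s') = t \<otimes> (r' \<otimes> s)" unfolding mem_fr[OF assms(1,2)] by auto
next
  assume "\<exists>t\<in>S. t \<otimes> (r \<otimes> s') = t \<otimes> (r' \<otimes> s)"
  then show "fr r s = fr r' s'" using fr_eqI[OF assms] by blast
qed

lemma fr_cancel:
  assumes "r \<in> carrier R" "s \<in> S" "t \<in> S"
  shows "fr (t \<otimes> r) (t \<otimes> s) = fr r s"
  using assms by (intro fr_eqI[of _ _ _ _ \<one>]) (auto simp: m_ac)

lemma fr_carrier [simp]: "r \<in> carrier R \<Longrightarrow> s \<in> S \<Longrightarrow> fr r s \<in> carrier L"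
  by (auto simp: localization_def)

lemma L_cases: "X \<in> carrier L \<Longrightarrow> (\<And>r s. r \<in> carrier R \<Longrightarrow> s \<in> S \<Longrightarrow> X = fr r s \<Longrightarrow> P) \<Longrightarrow> P"
  by (auto simp: localization_def)

lemma UN_fr_const:
  assumes "r \<in> carrier R" "s \<in> S" "\<And>p q. (p, q) \<in> fr r s \<Longrightarrow> f (p, q) = c"
  shows "(\<Union>x\<in>fr r s. f x) = c"
  using assms fr_self[of r s] by fastforce

lemma UN_fr_const2:
  assumes "r \<in> carrier R" "s \<in> S" "r' \<in> carrier R" "s' \<in> S"
    and "\<And>p q p' q'. (p, q) \<in> fr r s \<Longrightarrow> (p', q') \<in> fr r' s' \<Longrightarrow> f p q p' q' = c"
  shows "(\<Union>(p, q)\<in>fr r s. \<Union>(p', q')\<in>fr r' s'. f p q p' q') = c"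
proof (rule UN_fr_const[OF assms(1,2)])
  fix p q assume pq: "(p, q) \<in> fr r s"
  have "(\<Union>(p', q')\<in>fr r' s'. f p q p' q') = c"
    by (rule UN_fr_const[OF assms(3,4)]) (use assms(5) pq in simp)
  then show "(case (p, q) of (p, q) \<Rightarrow> \<Union>(p', q')\<in>fr r' s'. f p q p' q') = c" by simp
qed

lemma fr_mult:
  assumes "r \<in> carrier R" "s \<in> S" "r' \<in> carrier R" "s' \<in> S"
  shows "fr r s \<otimes>\<^bsub>L\<^esub> fr r' s' = fr (r \<otimes> r') (s \<otimes> s')"
proof -
  have "fr (p \<otimes> p') (q \<otimes> q') = fr (r \<otimes> r') (s \<otimes> s')"
    if "(p, q) \<in> fr r s" "(p', q') \<in> fr r' s'" for p q p' q'
  proof -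
    from that(1) obtain t where t: "p \<in> carrier R" "q \<in> S" "t \<in> S" "t \<otimes> (r \<otimes> q) = t \<otimes> (p \<otimes> s)"
      by (rule mem_frE[OF _ assms(1,2)])
    from that(2) obtain u where u: "p' \<in> carrier R" "q' \<in> S" "u \<in> S" "u \<otimes> (r' \<otimes> q') = u \<otimes> (p' \<otimes> s')"
      by (rule mem_frE[OF _ assms(3,4)])
    have "(t \<otimes> u) \<otimes> ((r \<otimes> r') \<otimes> (q \<otimes> q')) = (t \<otimes> (r \<otimes> q)) \<otimes> (u \<otimes> (r' \<otimes> q'))"
      using t(1-3) u(1-3) assms by (simp add: m_ac)
    also have "\<dots> = (t \<otimes> u) \<otimes> ((p \<otimes> p') \<otimes> (s \<otimes> s'))"
      unfolding t(4) u(4) using t(1-3) u(1-3) assms by (simp add: m_ac)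
    finally show ?thesis using t(1-3) u(1-3) assms by (intro fr_eqI[symmetric, of _ _ _ _ "t \<otimes> u"]) auto
  qed
  then show ?thesis
    unfolding localization_def using assms by (simp add: UN_fr_const2)
qed

lemma fr_add:
  assumes "r \<in> carrier R" "s \<in> S" "r' \<in> carrier R" "s' \<in> S"
  shows "fr r s \<oplus>\<^bsub>L\<^esub> fr r' s' = fr (r \<otimes> s' \<oplus> r' \<otimes> s) (s \<otimes> s')"
proof -
  have "fr (p \<otimes> q' \<oplus> p' \<otimes> q) (q \<otimes> q') = fr (r \<otimes> s' \<oplus> r' \<otimes> s) (s \<otimes> s')"
    if "(p, q) \<in> fr r s" "(p', q') \<in> fr r' s'" for p q p' q'
  proof -
    from that(1) obtain t where t: "p \<in> carrier R" "q \<in> S" "t \<in> S" "t \<otimes> (r \<otimes> q) = t \<otimes> (p \<otimes> s)"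
      by (rule mem_frE[OF _ assms(1,2)])
    from that(2) obtain u where u: "p' \<in> carrier R" "q' \<in> S" "u \<in> S" "u \<otimes> (r' \<otimes> q') = u \<otimes> (p' \<otimes> s')"
      by (rule mem_frE[OF _ assms(3,4)])
    have "(t \<otimes> u) \<otimes> ((r \<otimes> s' \<oplus> r' \<otimes> s) \<otimes> (q \<otimes> q'))
        = (u \<otimes> s' \<otimes> q') \<otimes> (t \<otimes> (r \<otimes> q)) \<oplus> (t \<otimes> s \<otimes> q) \<otimes> (u \<otimes> (r' \<otimes> q'))"
      using t(1-3) u(1-3) assms by (simp add: r_distr l_distr m_ac)
    also have "\<dots> = (t \<otimes> u) \<otimes> ((p \<otimes> q' \<oplus> p' \<otimes> q) \<otimes> (s \<otimes> s'))"
      unfolding t(4) u(4) using t(1-3) u(1-3) assms by (simp add: r_distr l_distr m_ac)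
    finally show ?thesis using t(1-3) u(1-3) assms by (intro fr_eqI[symmetric, of _ _ _ _ "t \<otimes> u"]) auto
  qed
  then show ?thesis
    unfolding localization_def using assms by (simp add: UN_fr_const2)
qed

lemma L_one: "\<one>\<^bsub>L\<^esub> = fr \<one> \<one>" and L_zero: "\<zero>\<^bsub>L\<^esub> = fr \<zero> \<one>"
  by (simp_all add: localization_def)

lemma fr_zero: "s \<in> S \<Longrightarrow> fr \<zero> s = \<zero>\<^bsub>L\<^esub>"
  unfolding L_zero by (intro fr_eqI[of _ _ _ _ \<one>]) auto

lemma fr_eq_zero_iff:
  assumes "r \<in> carrier R" "s \<in> S"
  shows "fr r s = \<zero>\<^bsub>L\<^esub> \<longleftrightarrow> (\<exists>t\<in>S. t \<otimes> r = \<zero>)"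
  unfolding L_zero using assms by (subst fr_eq_iff) auto

lemma L_cring: "cring L"
proof (rule cringI)
  show "abelian_group L"
  proof (rule abelian_groupI)
    fix X Y assume X: "X \<in> carrier L" and Y: "Y \<in> carrier L"
    obtain r s where rs: "r \<in> carrier R" "s \<in> S" "X = fr r s" using X by (rule L_cases)
    obtain r' s' where rs': "r' \<in> carrier R" "s' \<in> S" "Y = fr r' s'" using Y by (rule L_cases)
    show "X \<oplus>\<^bsub>L\<^esub> Y \<in> carrier L" using rs rs' by (simp add: fr_add)
    show "X \<oplus>\<^bsub>L\<^esub> Y = Y \<oplus>\<^bsub>L\<^esub> X" using rs rs' by (simp add: fr_add a_comm m_comm)
    show "\<zero>\<^bsub>L\<^esub> \<oplus>\<^bsub>L\<^esub> X = X" using rs by (simp add: L_zero fr_add)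
    have "fr (\<ominus> r) s \<oplus>\<^bsub>L\<^esub> X = \<zero>\<^bsub>L\<^esub>"
      using rs by (simp add: fr_add fr_zero l_minus l_neg)
    then show "\<exists>Y\<in>carrier L. Y \<oplus>\<^bsub>L\<^esub> X = \<zero>\<^bsub>L\<^esub>" using rs by (auto intro!: bexI[of _ "fr (\<ominus> r) s"])
    fix Z assume "Z \<in> carrier L"
    then obtain r'' s'' where "r'' \<in> carrier R" "s'' \<in> S" "Z = fr r'' s''" by (rule L_cases)
    then show "X \<oplus>\<^bsub>L\<^esub> Y \<oplus>\<^bsub>L\<^esub> Z = X \<oplus>\<^bsub>L\<^esub> (Y \<oplus>\<^bsub>L\<^esub> Z)"
      using rs rs' by (simp add: fr_add l_distr r_distr m_ac a_ac)
  qed (simp add: L_zero)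
  show "comm_monoid L"
  proof (rule comm_monoidI)
    fix X Y assume X: "X \<in> carrier L" and Y: "Y \<in> carrier L"
    obtain r s where rs: "r \<in> carrier R" "s \<in> S" "X = fr r s" using X by (rule L_cases)
    obtain r' s' where rs': "r' \<in> carrier R" "s' \<in> S" "Y = fr r' s'" using Y by (rule L_cases)
    show "X \<otimes>\<^bsub>L\<^esub> Y \<in> carrier L" using rs rs' by (simp add: fr_mult)
    show "X \<otimes>\<^bsub>L\<^esub> Y = Y \<otimes>\<^bsub>L\<^esub> X" using rs rs' by (simp add: fr_mult m_comm)
    show "\<one>\<^bsub>L\<^esub> \<otimes>\<^bsub>L\<^esub> X = X" using rs by (simp add: L_one fr_mult)
    fix Z assume "Z \<in> carrier L"
    then obtain r'' s'' where "r'' \<in> carrier R" "s'' \<in> S" "Z = fr r'' s''" by (rule L_cases)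
    then show "X \<otimes>\<^bsub>L\<^esub> Y \<otimes>\<^bsub>L\<^esub> Z = X \<otimes>\<^bsub>L\<^esub> (Y \<otimes>\<^bsub>L\<^esub> Z)"
      using rs rs' by (simp add: fr_mult m_ac)
  qed (simp add: L_one)
  fix X Y Z assume X: "X \<in> carrier L" and Y: "Y \<in> carrier L" and Z: "Z \<in> carrier L"
  obtain r s where rs: "r \<in> carrier R" "s \<in> S" "X = fr r s" using X by (rule L_cases)
  obtain r' s' where rs': "r' \<in> carrier R" "s' \<in> S" "Y = fr r' s'" using Y by (rule L_cases)
  obtain r'' s'' where rs'': "r'' \<in> carrier R" "s'' \<in> S" "Z = fr r'' s''" using Z by (rule L_cases)
  have "(X \<oplus>\<^bsub>L\<^esub> Y) \<otimes>\<^bsub>L\<^esub> Z = fr ((r \<otimes> s' \<oplus> r' \<otimes> s) \<otimes> r'') (s \<otimes> s' \<otimes> s'')"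
    using rs rs' rs'' by (simp add: fr_add fr_mult)
  also have "\<dots> = fr (s'' \<otimes> ((r \<otimes> s' \<oplus> r' \<otimes> s) \<otimes> r'')) (s'' \<otimes> (s \<otimes> s' \<otimes> s''))"
    using rs rs' rs'' by (simp add: fr_cancel)
  also have "\<dots> = X \<otimes>\<^bsub>L\<^esub> Z \<oplus>\<^bsub>L\<^esub> Y \<otimes>\<^bsub>L\<^esub> Z"
    using rs rs' rs'' by (simp add: fr_add fr_mult l_distr r_distr m_ac)
  finally show "(X \<oplus>\<^bsub>L\<^esub> Y) \<otimes>\<^bsub>L\<^esub> Z = X \<otimes>\<^bsub>L\<^esub> Z \<oplus>\<^bsub>L\<^esub> Y \<otimes>\<^bsub>L\<^esub> Z" .
qed

lemma fr_hom: "ring_hom_ring R L (\<lambda>r. fr r \<one>)"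
  using L_cring by (intro ring_hom_ringI local.ring_axioms) (auto simp: cring_def fr_mult fr_add L_one)

text \<open>An ideal of the localization is generated by its contraction, because \<open>r/s\<close>
  in the ideal gives \<open>r/1\<close> in it and conversely; finite generators of the contraction
  therefore suffice.\<close>

lemma noetherian_L:
  assumes "noetherian_ring R"
  shows "noetherian_ring L"
proof -
  interpret noetherian_ring R by fact
  interpret L: cring L by (rule L_cring)
  interpret h: ring_hom_ring R L "\<lambda>r. fr r \<one>" by (rule fr_hom)
  show ?thesis
  proof (rule L.noetherian_ringI)
    fix J assume J: "ideal J L"
    interpret J: ideal J L by fact
    obtain X where X: "X \<subseteq> carrier R" "finite X" "{r \<in> carrier R. fr r \<one> \<in> J} = Idl X"
      using finetely_gen[OF h.ideal_vimage[OF J]] by auto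
    define Y where "Y = (\<lambda>r. fr r \<one>) ` X"
    have Yc: "Y \<subseteq> carrier L" using X(1) by (auto simp: Y_def)
    interpret I: ideal "Idl\<^bsub>L\<^esub> Y" L by (rule L.genideal_ideal[OF Yc])
    have "X \<subseteq> {r \<in> carrier R. fr r \<one> \<in> Idl\<^bsub>L\<^esub> Y}"
      using X(1) L.genideal_self[OF Yc] by (auto simp: Y_def)
    then have sub: "Idl X \<subseteq> {r \<in> carrier R. fr r \<one> \<in> Idl\<^bsub>L\<^esub> Y}"
      by (rule genideal_minimal[OF h.ideal_vimage[OF I.is_ideal]])
    have "J = Idl\<^bsub>L\<^esub> Y"
    proof
      have "X \<subseteq> Idl X" by (rule genideal_self[OF X(1)])
      then have "Y \<subseteq> J" unfolding Y_def X(3)[symmetric] by auto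
      then show "Idl\<^bsub>L\<^esub> Y \<subseteq> J" by (rule L.genideal_minimal[OF J])
      show "J \<subseteq> Idl\<^bsub>L\<^esub> Y"
      proof
        fix x assume x: "x \<in> J"
        then have "x \<in> carrier L" by (rule J.Icarr)
        then obtain r s where rs: "r \<in> carrier R" "s \<in> S" "x = fr r s" by (rule L_cases)
        have "fr s \<one> \<otimes>\<^bsub>L\<^esub> x = fr (s \<otimes> r) (s \<otimes> \<one>)" using rs by (simp add: fr_mult)
        also have "\<dots> = fr r \<one>" using rs by (intro fr_cancel) auto
        finally have "fr r \<one> \<in> J" using J.I_l_closed[OF x, of "fr s \<one>"] rs by simp
        then have "fr r \<one> \<in> Idl\<^bsub>L\<^esub> Y" using sub X(3) rs by auto
        then have "fr \<one> s \<otimes>\<^bsub>L\<^esub> fr r \<one> \<in> Idl\<^bsub>L\<^esub> Y" using rs by (intro I.I_l_closed) auto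
        then show "x \<in> Idl\<^bsub>L\<^esub> Y" using rs by (simp add: fr_mult)
      qed
    qed
    then show "\<exists>A\<subseteq>carrier L. finite A \<and> J = Idl\<^bsub>L\<^esub> A"
      using Yc X(2) by (intro exI[of _ Y]) (auto simp: Y_def)
  qed
qed

end

end

section \<open>Localization at a prime ideal\<close>

locale local_at_prime = primeideal M R for M and R (structure)
begin

sublocale localizing R "carrier R - M"
proof
  show "\<one> \<in> carrier R - M" using one_imp_carrier I_notcarr by auto
  show "s \<otimes> t \<in> carrier R - M" if "s \<in> carrier R - M" "t \<in> carrier R - M" for s t
    using that I_prime by auto
qed auto

lemma fr_in_Units_iff:
  assumes "r \<in> carrier R" "s \<in> carrier R - M"
  shows "fr r s \<in> Units L \<longleftrightarrow> r \<notin> M"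
proof
  assume "fr r s \<in> Units L"
  then obtain Y where "Y \<in> carrier L" "Y \<otimes>\<^bsub>L\<^esub> fr r s = \<one>\<^bsub>L\<^esub>" by (auto simp: Units_def)
  then obtain p q where p: "p \<in> carrier R" "q \<in> carrier R - M" "fr p q \<otimes>\<^bsub>L\<^esub> fr r s = fr \<one> \<one>"
    unfolding L_one by (elim L_cases) simp
  then have "fr (p \<otimes> r) (q \<otimes> s) = fr \<one> \<one>" using assms by (simp add: fr_mult)
  then obtain t where t: "t \<in> carrier R - M" "t \<otimes> (p \<otimes> r \<otimes> \<one>) = t \<otimes> (\<one> \<otimes> (q \<otimes> s))"
    using fr_eq_iff[of "p \<otimes> r" "q \<otimes> s" \<one> \<one>] p(1,2) assms one_in mult_in by (metis m_closed one_closed)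
  have "t \<otimes> (q \<otimes> s) \<notin> M" using mult_in t(1) p(2) assms by blast
  moreover have "t \<otimes> (p \<otimes> r) = t \<otimes> (q \<otimes> s)" using t p(1,2) assms by simp
  moreover have "t \<otimes> (p \<otimes> r) \<in> M" if "r \<in> M" using that t(1) p(1) by (intro I_l_closed) auto
  ultimately show "r \<notin> M" by auto
next
  assume "r \<notin> M"
  then have r: "r \<in> carrier R - M" using assms by auto
  have "fr s r \<otimes>\<^bsub>L\<^esub> fr r s = \<one>\<^bsub>L\<^esub>" "fr r s \<otimes>\<^bsub>L\<^esub> fr s r = \<one>\<^bsub>L\<^esub>"
    using r assms one_in fr_cancel[OF one_closed one_in mult_in[OF r assms(2)]]
    by (simp_all add: fr_mult m_comm L_one)
  then show "fr r s \<in> Units L" using r assms unfolding Units_def by (auto intro!: bexI[of _ "fr s r"])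
qed

text \<open>By \<open>fr_in_Units_iff\<close>, the nonunits are the fractions with numerator in
  \<open>M\<close>. The depth estimate relies on this: regular sequences are exchanged inside the
  ideal of nonunits.\<close>

lemma nonunits_ideal: "ideal (carrier L - Units L) L"
proof -
  interpret L: cring L by (rule L_cring)
  have mem: "fr r s \<in> carrier L - Units L" if "r \<in> M" "s \<in> carrier R - M" for r s
    using that fr_in_Units_iff[of r s] by simp
  have cases: "\<exists>r s. r \<in> M \<and> s \<in> carrier R - M \<and> X = fr r s" if "X \<in> carrier L - Units L" for X
  proof -
    from that have "X \<in> carrier L" by simp
    then obtain r s where "r \<in> carrier R" "s \<in> carrier R - M" "X = fr r s"
      by (rule L_cases)
    then show ?thesis using that fr_in_Units_iff by blast
  qed
  have mult: "Y \<otimes>\<^bsub>L\<^esub> X \<in> carrier L - Units L" if XY: "X \<in> carrier L - Units L" "Y \<in> carrier L" for X Y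
  proof -
    obtain r s where r: "r \<in> M" "s \<in> carrier R - M" "X = fr r s" using cases[of X] XY by blast
    from that(2) obtain p q where p: "p \<in> carrier R" "q \<in> carrier R - M" "Y = fr p q"
      by (rule L_cases)
    have "Y \<otimes>\<^bsub>L\<^esub> X = fr (p \<otimes> r) (q \<otimes> s)" using r p by (simp add: fr_mult)
    also have "\<dots> \<in> carrier L - Units L" using r p by (intro mem mult_in I_l_closed) auto
    finally show ?thesis .
  qed
  have add: "X \<oplus>\<^bsub>L\<^esub> Y \<in> carrier L - Units L"
    if XY: "X \<in> carrier L - Units L" "Y \<in> carrier L - Units L" for X Y
  proof -
    obtain r s where r: "r \<in> M" "s \<in> carrier R - M" "X = fr r s" using cases[OF XY(1)] by blast
    obtain p q where p: "p \<in> M" "q \<in> carrier R - M" "Y = fr p q" using cases[OF XY(2)] by blast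
    have "X \<oplus>\<^bsub>L\<^esub> Y = fr (r \<otimes> q \<oplus> p \<otimes> s) (s \<otimes> q)" using r p by (simp add: fr_add)
    also have "\<dots> \<in> carrier L - Units L"
      using r p by (intro mem mult_in a_closed) (auto intro: I_r_closed)
    finally show ?thesis .
  qed
  show ?thesis
  proof (rule idealI[OF L.ring_axioms])
    show "subgroup (carrier L - Units L) (add_monoid L)"
    proof (rule L.add.subgroupI)
      have "\<zero>\<^bsub>L\<^esub> \<in> carrier L - Units L" unfolding L_zero 
        by (rule mem[OF additive_subgroup.zero_closed[OF additive_subgroup_axioms] one_in])
      then show "carrier L - Units L \<noteq> {}" by blast
      show "\<ominus>\<^bsub>L\<^esub> X \<in> carrier L - Units L" if "X \<in> carrier L - Units L" for X
      proof -
        have "(\<ominus>\<^bsub>L\<^esub> \<one>\<^bsub>L\<^esub>) \<otimes>\<^bsub>L\<^esub> X \<in> carrier L - Units L" using that by (intro mult) auto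
        moreover have "(\<ominus>\<^bsub>L\<^esub> \<one>\<^bsub>L\<^esub>) \<otimes>\<^bsub>L\<^esub> X = \<ominus>\<^bsub>L\<^esub> X" using that by (simp add: L.l_minus)
        ultimately show ?thesis by simp
      qed
    qed (use add in auto)
    show "Y \<otimes>\<^bsub>L\<^esub> X \<in> carrier L - Units L" "X \<otimes>\<^bsub>L\<^esub> Y \<in> carrier L - Units L"
      if "X \<in> carrier L - Units L" "Y \<in> carrier L" for X Y
      using mult[OF that] that by (auto simp: L.m_comm)
  qed
qed

end

text \<open>A Cohen-Macaulay ring stays Cohen-Macaulay after dividing out an ideal that is, locally at each
  maximal ideal containing it, generated by one regular element \<open>a\<close>.\<close>

locale hypersurface_section = surjective_hom A B \<phi> for A (structure) and B (structure) and \<phi> +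
  fixes a
  assumes a: "a \<in> carrier A" "\<phi> a = \<zero>\<^bsub>B\<^esub>" "regular_mod A {\<zero>} a"
    and ker: "x \<in> carrier A \<Longrightarrow> \<phi> x = \<zero>\<^bsub>B\<^esub> \<Longrightarrow>
      \<exists>u\<in>carrier A. \<phi> u = \<one>\<^bsub>B\<^esub> \<and> (\<exists>c\<in>carrier A. u \<otimes> x = a \<otimes> c)"
    and noeth: "noetherian_ring A"
begin

context
  fixes m assumes m: "primeideal m B"
begin

definition "M = {r \<in> carrier A. \<phi> r \<in> m}"

lemma M_prime: "primeideal M A"
  unfolding M_def by (rule vimage_primeideal[OF m])

lemma M_I: "r \<in> carrier A \<Longrightarrow> \<phi> r \<in> m \<Longrightarrow> r \<in> M"
  and not_M_I: "r \<in> carrier A \<Longrightarrow> \<phi> r \<notin> m \<Longrightarrow> r \<in> carrier A - M"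
  and \<phi>_S: "s \<in> carrier A - M \<Longrightarrow> \<phi> s \<in> carrier B - m"
  by (auto simp: M_def)

interpretation m: local_at_prime m B by (simp add: local_at_prime_def m)
interpretation M: local_at_prime M A by (simp add: local_at_prime_def M_prime)

definition "\<psi> X = (\<Union>(r, s)\<in>X. m.fr (\<phi> r) (\<phi> s))"

lemma \<psi>_fr:
  assumes "r \<in> carrier A" "s \<in> carrier A - M"
  shows "\<psi> (M.fr r s) = m.fr (\<phi> r) (\<phi> s)"
  unfolding \<psi>_def
proof (rule M.UN_fr_const[OF assms])
  fix p q assume "(p, q) \<in> M.fr r s"
  then obtain t where t: "p \<in> carrier A" "q \<in> carrier A - M" "t \<in> carrier A - M"
    "t \<otimes> (r \<otimes> q) = t \<otimes> (p \<otimes> s)" using assms M.mem_fr by auto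
  from arg_cong[OF t(4), of \<phi>] have
    "\<phi> t \<otimes>\<^bsub>B\<^esub> (\<phi> r \<otimes>\<^bsub>B\<^esub> \<phi> q) = \<phi> t \<otimes>\<^bsub>B\<^esub> (\<phi> p \<otimes>\<^bsub>B\<^esub> \<phi> s)" using t(1-3) assms by simp
  then show "(case (p, q) of (r, s) \<Rightarrow> m.fr (\<phi> r) (\<phi> s)) = m.fr (\<phi> r) (\<phi> s)"
    using m.fr_eqI[OF _ \<phi>_S[OF assms(2)] _ \<phi>_S[OF t(2)] \<phi>_S[OF t(3)], of "\<phi> r" "\<phi> p"]
      t(1) assms(1) by simp
qed

text \<open>\<open>\<psi>\<close> is the map of local rings induced by \<open>\<phi>\<close>. It is
  onto because any preimage of a denominator outside \<open>m\<close> lies outside the preimage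
  \<open>M\<close> of \<open>m\<close>.\<close>

lemma \<psi>_surjective_hom: "surjective_hom M.L m.L \<psi>"
proof -
  interpret CL: cring M.L by (rule M.L_cring)
  interpret DL: cring m.L by (rule m.L_cring)
  have "ring_hom_ring M.L m.L \<psi>"
  proof (rule ring_hom_ringI[OF CL.ring_axioms DL.ring_axioms])
    fix X assume "X \<in> carrier M.L"
    then obtain r s where rs: "r \<in> carrier A" "s \<in> carrier A - M" "X = M.fr r s" by (rule M.L_cases)
    then show "\<psi> X \<in> carrier m.L" using \<phi>_S by (simp add: \<psi>_fr)
    fix Y assume "Y \<in> carrier M.L"
    then obtain p q where pq: "p \<in> carrier A" "q \<in> carrier A - M" "Y = M.fr p q" by (rule M.L_cases)
    note c = rs(1,2) pq(1,2) \<phi>_S[OF rs(2)] \<phi>_S[OF pq(2)] M.mult_in[OF rs(2) pq(2)]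
    have "\<psi> (X \<otimes>\<^bsub>M.L\<^esub> Y) = m.fr (\<phi> (r \<otimes> p)) (\<phi> (s \<otimes> q))"
      unfolding rs(3) pq(3) using c by (simp only: M.fr_mult C.m_closed \<psi>_fr)
    then show "\<psi> (X \<otimes>\<^bsub>M.L\<^esub> Y) = \<psi> X \<otimes>\<^bsub>m.L\<^esub> \<psi> Y"
      unfolding rs(3) pq(3) using c by (simp add: \<psi>_fr m.fr_mult)
    have "\<psi> (X \<oplus>\<^bsub>M.L\<^esub> Y) = m.fr (\<phi> (r \<otimes> q \<oplus> p \<otimes> s)) (\<phi> (s \<otimes> q))"
      unfolding rs(3) pq(3) using c
      by (simp only: M.fr_add C.m_closed C.a_closed \<psi>_fr M.S_carrier)
    then show "\<psi> (X \<oplus>\<^bsub>M.L\<^esub> Y) = \<psi> X \<oplus>\<^bsub>m.L\<^esub> \<psi> Y"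
      unfolding rs(3) pq(3) using c by (simp add: \<psi>_fr m.fr_add)
  next
    show "\<psi> \<one>\<^bsub>M.L\<^esub> = \<one>\<^bsub>m.L\<^esub>" using M.one_in by (simp add: M.L_one m.L_one \<psi>_fr)
  qed
  moreover have "\<psi> ` carrier M.L = carrier m.L"
  proof
    show "\<psi> ` carrier M.L \<subseteq> carrier m.L"
      using ring_hom_ring.homh[OF calculation] by (auto simp: ring_hom_def)
    show "carrier m.L \<subseteq> \<psi> ` carrier M.L"
    proof
      fix Y assume "Y \<in> carrier m.L"
      then obtain p q where pq: "p \<in> carrier B" "q \<in> carrier B - m" "Y = m.fr p q" by (rule m.L_cases)
      obtain r s where rs: "r \<in> carrier A" "\<phi> r = p" "s \<in> carrier A" "\<phi> s = q"
        using obtain_preimage pq by blast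
      then have "s \<in> carrier A - M" using pq(2) by (intro not_M_I) auto
      then show "Y \<in> \<psi> ` carrier M.L" using rs pq by (auto intro!: image_eqI[of _ _ "M.fr r s"] simp: \<psi>_fr)
    qed
  qed
  ultimately show ?thesis
    by (simp add: surjective_hom_def surjective_hom_axioms_def CL.is_cring DL.is_cring)
qed

text \<open>With \<open>b = a/1\<close>, dim + 1 of the quotient is at most the dimension upstairs,
  which equals the depth upstairs, which is at most depth + 1 of the quotient. Hence dim \<le> depth
  in the quotient, and the opposite inequality always holds.\<close>

lemma local_cohen_macaulay_descent:
  assumes "local_depth M.L = krull_dim M.L"
  shows "local_depth m.L = krull_dim m.L"
proof -
  interpret h: surjective_hom M.L m.L \<psi> by (rule \<psi>_surjective_hom)
  have N: "noetherian_ring M.L" by (rule M.noetherian_L[OF noeth])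
  have "noetherian_ring m.L" by (rule h.noetherian_image[OF N])
  then interpret ND: noetherian_cring m.L by (simp add: noetherian_cring_def h.D.is_cring)
  define b where "b = M.fr a \<one>"
  have aM: "a \<in> M" by (rule M_I[OF a(1)]) (simp add: a(2))
  have b: "b \<in> carrier M.L - Units M.L"
    using M.fr_in_Units_iff[OF a(1) M.one_in] aM a(1) M.one_in by (simp add: b_def)
  have \<psi>b: "\<psi> b = \<zero>\<^bsub>m.L\<^esub>"
    unfolding b_def using a M.one_in by (simp add: \<psi>_fr m.L_zero)
  have reg: "regular_mod M.L {\<zero>\<^bsub>M.L\<^esub>} b"
    unfolding regular_mod_def
  proof (intro ballI impI)
    fix X assume "X \<in> carrier M.L" and bX: "b \<otimes>\<^bsub>M.L\<^esub> X \<in> {\<zero>\<^bsub>M.L\<^esub>}"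
    then obtain r s where rs: "r \<in> carrier A" "s \<in> carrier A - M" "X = M.fr r s" using M.L_cases by metis
    have "M.fr (a \<otimes> r) (\<one> \<otimes> s) = \<zero>\<^bsub>M.L\<^esub>"
      using bX rs a(1) M.one_in unfolding b_def by (simp add: M.fr_mult)
    then obtain t where t: "t \<in> carrier A - M" "t \<otimes> (a \<otimes> r) = \<zero>"
      using rs a(1) M.fr_eq_zero_iff[of "a \<otimes> r" s] by auto
    have "a \<otimes> (t \<otimes> r) = \<zero>" using t rs a(1) by (simp add: C.m_ac)
    then have "t \<otimes> r \<in> {\<zero>}" using regular_modD[OF a(3), of "t \<otimes> r"] t(1) rs(1) by simp
    then have "X = \<zero>\<^bsub>M.L\<^esub>" unfolding rs(3) using M.fr_eq_zero_iff[OF rs(1,2)] t(1) by auto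
    then show "X \<in> {\<zero>\<^bsub>M.L\<^esub>}" by simp
  qed
  have kernel: "\<exists>c\<in>carrier M.L. X = b \<otimes>\<^bsub>M.L\<^esub> c" if X: "X \<in> carrier M.L" "\<psi> X = \<zero>\<^bsub>m.L\<^esub>" for X
  proof -
    obtain r s where rs: "r \<in> carrier A" "s \<in> carrier A - M" "X = M.fr r s" using X(1) by (rule M.L_cases)
    have "m.fr (\<phi> r) (\<phi> s) = \<zero>\<^bsub>m.L\<^esub>" using X(2) rs by (simp add: \<psi>_fr)
    then obtain t' where t': "t' \<in> carrier B - m" "t' \<otimes>\<^bsub>B\<^esub> \<phi> r = \<zero>\<^bsub>B\<^esub>"
      using m.fr_eq_zero_iff[of "\<phi> r" "\<phi> s"] rs(1) \<phi>_S[OF rs(2)] by auto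
    obtain t where t: "t \<in> carrier A" "\<phi> t = t'" using obtain_preimage t' by blast
    have tM: "t \<in> carrier A - M" using t t' by (intro not_M_I) auto
    have "\<phi> (t \<otimes> r) = \<zero>\<^bsub>B\<^esub>" using t t' rs by simp
    then obtain u c where u: "u \<in> carrier A" "\<phi> u = \<one>\<^bsub>B\<^esub>" "c \<in> carrier A" "u \<otimes> (t \<otimes> r) = a \<otimes> c"
      using ker[of "t \<otimes> r"] t rs by auto
    \<comment> \<open>Since \<open>u\<close> maps to 1, it is a unit in the localization, so
      multiplying numerator and denominator by it is harmless; this is how a kernel that is
      generated by \<open>a\<close> only up to such factors becomes principal locally.\<close>
    have "u \<in> carrier A - M" using u(2) m.one_in by (intro not_M_I[OF u(1)]) simp
    then have ut: "u \<otimes> t \<in> carrier A - M" by (rule M.mult_in[OF _ tM])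
    have uts: "u \<otimes> t \<otimes> s \<in> carrier A - M" by (rule M.mult_in[OF ut rs(2)])
    have "X = M.fr ((u \<otimes> t) \<otimes> r) ((u \<otimes> t) \<otimes> s)"
      unfolding rs(3) by (rule M.fr_cancel[OF rs(1,2) ut, symmetric])
    also have "(u \<otimes> t) \<otimes> r = a \<otimes> c" using u(4) u(1) t rs by (simp add: C.m_assoc)
    also have "M.fr (a \<otimes> c) (u \<otimes> t \<otimes> s) = b \<otimes>\<^bsub>M.L\<^esub> M.fr c (u \<otimes> t \<otimes> s)"
      unfolding b_def using M.fr_mult[OF a(1) M.one_in u(3) uts] uts by simp
    finally show ?thesis using M.fr_carrier[OF u(3) uts] by blast
  qed
  have nz: "ideal (carrier m.L - Units m.L) m.L" by (rule m.nonunits_ideal)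
  have "carrier m.L - Units m.L \<noteq> carrier m.L" using h.D.Units_one_closed by blast
  then obtain P where "primeideal P m.L" using ND.exists_prime_above[OF nz] by blast
  then have "krull_dim m.L + 1 \<le> krull_dim M.L"
    using b by (intro h.krull_dim_add_1_le[OF N _ \<psi>b reg]) auto
  also have "\<dots> \<le> local_depth m.L + 1"
    unfolding assms[symmetric] by (rule h.local_depth_le_add_1[OF N M.nonunits_ideal b \<psi>b reg kernel])
  finally have "krull_dim m.L \<le> local_depth m.L"
    by (cases "krull_dim m.L"; cases "local_depth m.L") (auto simp: one_enat_def)
  with ND.local_depth_le_krull_dim show ?thesis by (rule antisym)
qed

end

theorem cohen_macaulay_descent:
  assumes "cohen_macaulay A"
  shows "cohen_macaulay B"
  unfolding cohen_macaulay_def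
proof (intro conjI allI impI)
  show "cring B" by (rule D.is_cring)
  show "noetherian_ring B" by (rule noetherian_image[OF noeth])
  fix m assume m: "maximalideal m B"
  then have p: "primeideal m B" by (rule D.maximalideal_prime)
  have "maximalideal (M m) A" unfolding M_def[OF p] by (rule vimage_maximalideal[OF m])
  with assms have "local_depth (localization A (carrier A - M m)) = krull_dim (localization A (carrier A - M m))"
    by (simp add: cohen_macaulay_def)
  then show "local_depth (localization B (carrier B - m)) = krull_dim (localization B (carrier B - m))"
    by (rule local_cohen_macaulay_descent[OF p])
qed

end

section \<open>Polynomials and monomial ideals\<close>

abbreviation keys where "keys \<equiv> Poly_Mapping.keys"
abbreviation lookup where "lookup \<equiv> Poly_Mapping.lookup"
abbreviation single where "single \<equiv> Poly_Mapping.single"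

lemma keys_plus_nat: "keys (s + t) = keys s \<union> keys (t :: 'v \<Rightarrow>\<^sub>0 nat)"
  by (auto simp: in_keys_iff lookup_add)

lemma keys_minus_nat: "keys (s - t) \<subseteq> keys (s :: 'v \<Rightarrow>\<^sub>0 nat)"
  by (auto simp: in_keys_iff lookup_minus)

lemma poly_eq_sum_single: "p = (\<Sum>t\<in>keys p. single t (lookup p t))"
  by (rule poly_mapping_eqI) (auto simp: lookup_sum lookup_single when_def in_keys_iff)

lemma poly_mapping_single_induct [case_names zero single add]:
  assumes "P 0" "\<And>t c. P (single t c)" "\<And>p q. P p \<Longrightarrow> P q \<Longrightarrow> P (p + q)"
  shows "P (p :: 'a \<Rightarrow>\<^sub>0 'b :: comm_monoid_add)"
proof -
  have "P (\<Sum>t\<in>A. single t (lookup p t))" if "finite A" for A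
    using that by (induction A rule: finite_induct) (auto intro: assms)
  from this[of "keys p"] show ?thesis by (simp flip: poly_eq_sum_single)
qed

lemma lookup_single_mult:
  fixes p :: "('v, 'k::field) mpoly"
  shows "lookup (single s c * p) (s + t) = c * lookup p t"
  by (induction p rule: poly_mapping_single_induct)
    (auto simp: mult_single lookup_single when_def distrib_left lookup_add)

lemma keys_single_one_mult:
  fixes p :: "('v, 'k::field) mpoly"
  shows "keys (single s 1 * p) = (+) s ` keys p"
proof
  show "keys (single s 1 * p) \<subseteq> (+) s ` keys p"
    using keys_mult[of "single s 1" p] by auto
  show "(+) s ` keys p \<subseteq> keys (single s 1 * p)"
    by (auto simp: in_keys_iff lookup_single_mult)
qed

lemma single_one_mult_cancel:
  fixes p q :: "('v, 'k::field) mpoly"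
  assumes "single s 1 * p = single s 1 * q"
  shows "p = q"
  by (rule poly_mapping_eqI) (metis assms lookup_single_mult mult_1)

lemma add_diff_monomial:
  fixes s t :: "'v \<Rightarrow>\<^sub>0 nat"
  assumes "\<And>v. lookup s v \<le> lookup t v"
  shows "s + (t - s) = t"
  by (rule poly_mapping_eqI) (use assms in \<open>simp add: lookup_add lookup_minus\<close>)

lemma divide_by_monomial:
  fixes p :: "('v, 'k::field) mpoly"
  assumes "\<And>t v. t \<in> keys p \<Longrightarrow> lookup s v \<le> lookup t v"
  obtains q where "p = single s 1 * q" "keys p = (+) s ` keys q"
proof
  define q where "q = (\<Sum>t\<in>keys p. single (t - s) (lookup p t))"
  have "single s 1 * q = (\<Sum>t\<in>keys p. single (s + (t - s)) (lookup p t))"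
    unfolding q_def by (simp add: sum_distrib_left mult_single)
  also have "\<dots> = (\<Sum>t\<in>keys p. single t (lookup p t))"
    using assms by (intro sum.cong) (simp_all add: add_diff_monomial)
  also have "\<dots> = p" by (rule poly_eq_sum_single[symmetric])
  finally show "p = single s 1 * q" by simp
  then show "keys p = (+) s ` keys q" by (simp add: keys_single_one_mult)
qed

definition polys :: "'v set \<Rightarrow> ('v, 'k::field) mpoly set" where
  "polys V = {p. \<forall>t\<in>keys p. keys t \<subseteq> V}"

lemma poly_ring_simps [simp]:
  "carrier (poly_ring K V) = polys V" "p \<otimes>\<^bsub>poly_ring K V\<^esub> q = p * q" "\<one>\<^bsub>poly_ring K V\<^esub> = 1"
  "\<zero>\<^bsub>poly_ring K V\<^esub> = 0" "p \<oplus>\<^bsub>poly_ring K V\<^esub> q = p + q"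
  by (simp_all add: poly_ring_def polys_def)

lemma polys_zero [simp]: "0 \<in> polys V" and polys_one [simp]: "1 \<in> polys V"
  and polys_const [simp]: "const c \<in> polys V"
  by (auto simp: polys_def const_def)

lemma polys_single: "keys t \<subseteq> V \<Longrightarrow> single t c \<in> polys V"
  by (auto simp: polys_def)

lemma polys_var: "v \<in> V \<Longrightarrow> var v \<in> polys V"
  by (auto simp: var_def intro!: polys_single)

lemma polys_add: "p \<in> polys V \<Longrightarrow> q \<in> polys V \<Longrightarrow> p + q \<in> polys V"
  using keys_add[of p q] by (auto simp: polys_def)

lemma polys_uminus: "p \<in> polys V \<Longrightarrow> - p \<in> polys V"
  by (auto simp: polys_def in_keys_iff)

lemma polys_diff: "p \<in> polys V \<Longrightarrow> q \<in> polys V \<Longrightarrow> p - q \<in> polys V"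
  using polys_add[of p V "- q"] polys_uminus[of q V] by simp

lemma polys_mult: "p \<in> polys V \<Longrightarrow> q \<in> polys V \<Longrightarrow> p * q \<in> polys V"
  using keys_mult[of p q] by (force simp: polys_def keys_plus_nat)

lemma polys_sum: "(\<And>i. i \<in> A \<Longrightarrow> f i \<in> polys V) \<Longrightarrow> sum f A \<in> polys V"
  by (induction A rule: infinite_finite_induct) (auto intro: polys_add)

lemma polys_power: "p \<in> polys V \<Longrightarrow> p ^ n \<in> polys V"
  by (induction n) (auto intro: polys_mult)

lemmas polys_intros = polys_zero polys_one polys_const polys_var polys_add polys_uminus polys_diff
  polys_mult polys_sum polys_power

lemma poly_ring_cring: "cring (poly_ring K V)"
proof (rule cringI)
  show "abelian_group (poly_ring K V)"
    by (rule abelian_groupI) (auto simp: algebra_simps intro: polys_intros bexI[of _ "- x" for x])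
  show "comm_monoid (poly_ring K V)"
    by (rule comm_monoidI) (auto simp: algebra_simps intro: polys_intros)
qed (auto simp: algebra_simps)

lemma poly_ring_minus:
  assumes "p \<in> polys V" "q \<in> polys V"
  shows "p \<ominus>\<^bsub>poly_ring K V\<^esub> q = p - q"
proof -
  interpret cring "poly_ring K V" by (rule poly_ring_cring)
  have "\<ominus>\<^bsub>poly_ring K V\<^esub> q = - q"
    by (rule minus_equality) (use assms in \<open>auto intro: polys_intros\<close>)
  then show ?thesis by (simp add: a_minus_def)
qed

text \<open>The exponent vector of the squarefree monomial with support \<open>W\<close>.\<close>

definition smon :: "'v set \<Rightarrow> 'v \<Rightarrow>\<^sub>0 nat" where
  "smon W = (\<Sum>w\<in>W. single w 1)"

lemma lookup_smon: "finite W \<Longrightarrow> lookup (smon W) v = (if v \<in> W then 1 else 0)"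
  by (simp add: smon_def lookup_sum lookup_single when_def)

lemma keys_smon: "finite W \<Longrightarrow> keys (smon W) = W"
  by (rule Set.set_eqI) (simp add: in_keys_iff lookup_smon)

lemma prod_var_eq: "finite W \<Longrightarrow> (\<Prod>w\<in>W. var w) = single (smon W) 1"
  by (induction W rule: finite_induct) (auto simp: smon_def var_def mult_single)

lemma smon_le: "finite W \<Longrightarrow> W \<subseteq> keys t \<Longrightarrow> lookup (smon W) v \<le> lookup t v"
  by (cases "v \<in> W") (auto simp: lookup_smon in_keys_iff Suc_le_eq dest!: subsetD)

lemma ideal_sum:
  assumes "ideal I (poly_ring K V)" "\<And>i. i \<in> A \<Longrightarrow> f i \<in> I"
  shows "sum f A \<in> I"
proof -
  interpret ideal I "poly_ring K V" by fact
  have "0 \<in> I" using additive_subgroup.zero_closed[OF additive_subgroup_axioms] by simp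
  moreover have "p + q \<in> I" if "p \<in> I" "q \<in> I" for p q
    using additive_subgroup.a_closed[OF additive_subgroup_axioms that] by simp
  ultimately show ?thesis using assms(2)
    by (induction A rule: infinite_finite_induct) auto
qed

text \<open>A monomial is divisible by a squarefree one exactly when its support contains that of
  the divisor. Membership thus becomes a condition on \<open>keys t\<close> for each term, the only
  form in which edge ideals and cover ideals are used later on.\<close>

lemma squarefree_monomial_ideal:
  fixes K :: "'k::field itself" and V :: "'v set"
  assumes \<W>: "\<And>W. W \<in> \<W> \<Longrightarrow> finite W \<and> W \<subseteq> V"
  shows "Idl\<^bsub>poly_ring K V\<^esub> {\<Prod>w\<in>W. var w | W. W \<in> \<W>}
    = {p \<in> polys V. \<forall>t\<in>keys p. \<exists>W\<in>\<W>. W \<subseteq> keys t}" (is "Idl\<^bsub>?R\<^esub> ?G = ?I")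
proof
  interpret cring ?R by (rule poly_ring_cring)
  have G: "?G \<subseteq> carrier ?R"
  proof
    fix p assume "p \<in> ?G"
    then obtain W where "W \<in> \<W>" "p = (\<Prod>w\<in>W. var w)" by auto
    then show "p \<in> carrier ?R" using \<W>[of W] by (simp add: prod_var_eq keys_smon polys_single)
  qed
  have "ideal ?I ?R"
  proof (rule idealI[OF ring_axioms])
    show "subgroup ?I (add_monoid ?R)"
    proof (rule add.subgroupI)
      show "?I \<noteq> {}" by (auto intro!: exI[of _ 0])
      fix p assume p: "p \<in> ?I"
      have "\<ominus>\<^bsub>?R\<^esub> p = - p"
        by (rule minus_equality) (use p in \<open>auto intro: polys_intros\<close>)
      then show "\<ominus>\<^bsub>?R\<^esub> p \<in> ?I" using p by (auto intro: polys_intros)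
      fix q assume q: "q \<in> ?I"
      show "p \<oplus>\<^bsub>?R\<^esub> q \<in> ?I" using p q keys_add[of p q] by (auto intro: polys_intros)
    qed auto
    have *: "p * q \<in> ?I" if "p \<in> ?I" "q \<in> polys V" for p q
    proof -
      have "\<exists>W\<in>\<W>. W \<subseteq> keys t" if t: "t \<in> keys (p * q)" for t
      proof -
        obtain a b where "a \<in> keys p" "t = a + b" using t keys_mult[of p q] by blast
        moreover obtain W where "W \<in> \<W>" "W \<subseteq> keys a"
          using \<open>p \<in> ?I\<close> \<open>a \<in> keys p\<close> by auto
        ultimately show ?thesis by (auto simp: keys_plus_nat)
      qed
      then show ?thesis using that by (auto intro: polys_intros)
    qed
    show "q \<otimes>\<^bsub>?R\<^esub> p \<in> ?I" "p \<otimes>\<^bsub>?R\<^esub> q \<in> ?I" if "p \<in> ?I" "q \<in> carrier ?R" for p q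
      using *[of p q] that by (auto simp: mult.commute[of q])
  qed
  moreover have "?G \<subseteq> ?I"
  proof
    fix p assume p: "p \<in> ?G"
    then obtain W where "W \<in> \<W>" "p = (\<Prod>w\<in>W. var w)" by auto
    then show "p \<in> ?I" using \<W>[of W] G p by (auto simp: prod_var_eq keys_smon)
  qed
  ultimately show "Idl\<^bsub>?R\<^esub> ?G \<subseteq> ?I" by (rule genideal_minimal)
  have I: "ideal (Idl\<^bsub>?R\<^esub> ?G) ?R" by (rule genideal_ideal[OF G])
  show "?I \<subseteq> Idl\<^bsub>?R\<^esub> ?G"
  proof
    fix p assume p: "p \<in> ?I"
    have "single t (lookup p t) \<in> Idl\<^bsub>?R\<^esub> ?G" if t: "t \<in> keys p" for t
    proof -
      obtain W where W: "W \<in> \<W>" "W \<subseteq> keys t" using p t by auto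
      have fin: "finite W" using W \<W> by auto
      have kt: "keys t \<subseteq> V" using p t by (auto simp: polys_def)
      have "single (smon W) 1 \<in> ?G" using W(1) prod_var_eq[OF fin] by (metis (mono_tags, lifting) mem_Collect_eq)
      then have "single (smon W) 1 \<in> Idl\<^bsub>?R\<^esub> ?G" by (rule subsetD[OF genideal_self[OF G]])
      moreover have "single (t - smon W) (lookup p t) \<in> polys V"
        using keys_minus_nat[of t "smon W"] kt by (intro polys_single) auto
      ultimately have "single (t - smon W) (lookup p t) * single (smon W) 1 \<in> Idl\<^bsub>?R\<^esub> ?G"
        using ideal.I_l_closed[OF I, of "single (smon W) 1"] by simp
      moreover have "t - smon W + smon W = t"
        using add_diff_monomial[of "smon W" t] smon_le[OF fin W(2)] by (simp add: add.commute)
      ultimately show ?thesis by (simp add: mult_single)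
    qed
    then show "p \<in> Idl\<^bsub>?R\<^esub> ?G"
      by (subst poly_eq_sum_single) (rule ideal_sum[OF I])
  qed
qed

lemma minimal_vertex_cover_below:
  assumes "finite (verts G)" "vertex_cover G C"
  shows "\<exists>W\<subseteq>C. minimal_vertex_cover G W"
proof -
  have "finite C" using assms finite_subset by (auto simp: vertex_cover_def)
  then show ?thesis using assms(2)
  proof (induction C rule: finite_psubset_induct)
    case (psubset C)
    show ?case
    proof (cases "minimal_vertex_cover G C")
      case False
      then obtain C' where "C' \<subset> C" "vertex_cover G C'"
        using psubset.prems by (auto simp: minimal_vertex_cover_def)
      then show ?thesis using psubset.IH[of C'] by blast
    qed auto
  qed
qed

lemma cover_ideal_eq:
  fixes K :: "'k::field itself"
  assumes "simple_graph G" "verts G \<subseteq> V"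
  shows "cover_ideal K V G = {p \<in> polys V. \<forall>t\<in>keys p. \<forall>e\<in>edges G. e \<inter> keys t \<noteq> {}}"
proof -
  have fin: "finite (verts G)" and e: "\<And>e. e \<in> edges G \<Longrightarrow> e \<subseteq> verts G"
    using assms by (auto simp: simple_graph_def)
  have "(\<exists>W\<in>{W. minimal_vertex_cover G W}. W \<subseteq> keys t) \<longleftrightarrow> (\<forall>e\<in>edges G. e \<inter> keys t \<noteq> {})"
    for t :: "'a \<Rightarrow>\<^sub>0 nat"
  proof
    assume "\<forall>e\<in>edges G. e \<inter> keys t \<noteq> {}"
    \<comment> \<open>The ambient variable set may be larger than \<open>verts G\<close>, so the
      support is cut down to the graph before a minimal cover is chosen inside it.\<close>
    then have "vertex_cover G (keys t \<inter> verts G)" using e by (fastforce simp: vertex_cover_def)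
    from minimal_vertex_cover_below[OF fin this] obtain W where
      "W \<subseteq> keys t \<inter> verts G" "minimal_vertex_cover G W" by (elim exE conjE)
    then show "\<exists>W\<in>{W. minimal_vertex_cover G W}. W \<subseteq> keys t" by auto
  next
    assume "\<exists>W\<in>{W. minimal_vertex_cover G W}. W \<subseteq> keys t"
    then show "\<forall>e\<in>edges G. e \<inter> keys t \<noteq> {}"
      unfolding minimal_vertex_cover_def vertex_cover_def by fast
  qed
  moreover have "finite W \<and> W \<subseteq> V" if "W \<in> {W. minimal_vertex_cover G W}" for W
    using that assms fin finite_subset by (auto simp: minimal_vertex_cover_def vertex_cover_def)
  ultimately show ?thesis
    unfolding cover_ideal_def using squarefree_monomial_ideal[of "{W. minimal_vertex_cover G W}" V K] by simp
qed

lemma edge_ideal_eq: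
  fixes K :: "'k::field itself"
  assumes "simple_graph G"
  shows "edge_ideal K G = {p \<in> polys (verts G). \<forall>t\<in>keys p. \<exists>e\<in>edges G. e \<subseteq> keys t}"
proof -
  have e: "finite e \<and> e \<subseteq> verts G \<and> card e = 2" if "e \<in> edges G" for e
    using assms that finite_subset by (auto simp: simple_graph_def)
  have "{var u * var v :: ('a, 'k) mpoly | u v. {u, v} \<in> edges G} = {(\<Prod>w\<in>e. var w :: ('a, 'k) mpoly) | e. e \<in> edges G}"
  proof (intro Set.set_eqI iffI)
    fix p :: "('a, 'k) mpoly" assume "p \<in> {var u * var v | u v. {u, v} \<in> edges G}"
    then obtain u v where uv: "{u, v} \<in> edges G" "p = var u * var v" by auto
    then have "u \<noteq> v" using e[OF uv(1)] by auto
    then have "p = (\<Prod>w\<in>{u, v}. var w)" using uv by simp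
    then show "p \<in> {(\<Prod>w\<in>e. var w) | e. e \<in> edges G}" using uv by blast
  next
    fix p :: "('a, 'k) mpoly" assume "p \<in> {(\<Prod>w\<in>e. var w) | e. e \<in> edges G}"
    then obtain E where E: "E \<in> edges G" "p = (\<Prod>w\<in>E. var w)" by auto
    then obtain u v where "E = {u, v}" "u \<noteq> v" using e[OF E(1)] by (metis card_2_iff)
    then show "p \<in> {var u * var v | u v. {u, v} \<in> edges G}" using E by auto
  qed
  then show ?thesis
    unfolding edge_ideal_def using squarefree_monomial_ideal[of "edges G" "verts G" K] e by simp
qed

section \<open>Deleting closed neighborhoods preserves Cohen-Macaulayness\<close>

text \<open>The \<open>k\<close>-linear extension of a map \<open>g\<close> on monomials; the factor
  \<open>single 0 _\<close> is the coefficient as a constant polynomial. If \<open>g\<close> is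
  multiplicative, so is the extension.\<close>

definition substitute :: "(('v \<Rightarrow>\<^sub>0 nat) \<Rightarrow> ('v, 'k::field) mpoly) \<Rightarrow> ('v, 'k) mpoly \<Rightarrow> ('v, 'k) mpoly" where
  "substitute g p = (\<Sum>t\<in>keys p. single 0 (lookup p t) * g t)"

lemma substitute_zero [simp]: "substitute g 0 = 0"
  by (simp add: substitute_def)

lemma substitute_single [simp]: "substitute g (single t c) = single 0 c * g t"
  by (simp add: substitute_def)

lemma substitute_add: "substitute g (p + q) = substitute g p + substitute g q"
  unfolding substitute_def
  by (rule setsum_keys_plus_distrib) (auto simp: single_add distrib_right)

lemma substitute_diff: "substitute g (p - q) = substitute g p - substitute g q"
  using substitute_add[of g "p - q" q] by simp

lemma substitute_mult:
  assumes "\<And>s t. g (s + t) = g s * g t"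
  shows "substitute g (p * q) = substitute g p * substitute g q"
proof (induction p rule: poly_mapping_single_induct)
  case (single s c)
  show ?case
  proof (induction q rule: poly_mapping_single_induct)
    case (single t d)
    have "single 0 (c * d) = (single 0 c * single 0 d :: ('a, 'b) mpoly)" by (simp add: mult_single)
    then show ?case by (simp add: mult_single assms mult_ac)
  qed (simp_all add: distrib_left substitute_add)
qed (simp_all add: distrib_right substitute_add)

lemma sum_closed:
  assumes "0 \<in> D" "\<And>p q. p \<in> D \<Longrightarrow> q \<in> D \<Longrightarrow> p + q \<in> D" "\<And>i. i \<in> A \<Longrightarrow> f i \<in> D"
  shows "sum f A \<in> D"
  using assms(3) by (induction A rule: infinite_finite_induct) (auto intro: assms)

text \<open>Multiplication by \<open>z\<close> raises the \<open>z\<close>-degree, so a term of \<open>p\<close> of minimal \<open>z\<close>-degree outside the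
  monomial ideal survives in \<open>(z - 1) p\<close>.\<close>

lemma var_minus_one_regular:
  fixes p :: "('v, 'k::field) mpoly"
  assumes "p \<in> polys V" and up: "\<And>s t. T t \<Longrightarrow> T (s + t)"
    and *: "\<forall>t\<in>keys ((var z - 1) * p). T t"
  shows "\<forall>t\<in>keys p. T t"
proof (rule ccontr)
  assume "\<not> ?thesis"
  then have "{t \<in> keys p. \<not> T t} \<noteq> {}" by auto
  then obtain t where t: "t \<in> keys p" "\<not> T t"
    and min: "\<And>s. s \<in> keys p \<Longrightarrow> \<not> T s \<Longrightarrow> lookup t z \<le> lookup s z"
    using ex_min_if_finite[of "(\<lambda>t. lookup t z) ` {t \<in> keys p. \<not> T t}"]
      arg_min_if_finite[of "{t \<in> keys p. \<not> T t}" "\<lambda>t. lookup t z"]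
    by (metis (no_types, lifting) finite_Collect_conjI finite_keys linorder_not_less mem_Collect_eq finite_subset subsetI)
  have "lookup (var z * p) t = 0"
  proof (rule ccontr)
    assume "lookup (var z * p) t \<noteq> 0"
    then have "t \<in> keys (var z * p)" by (simp add: in_keys_iff)
    then obtain s where s: "s \<in> keys p" "t = single z 1 + s"
      by (auto simp: var_def keys_single_one_mult)
    then have "\<not> T s" using t up by auto
    then have "lookup t z \<le> lookup s z" using min s by blast
    then show False using s by (simp add: lookup_add)
  qed
  then have "lookup ((var z - 1) * p) t = - lookup p t"
    by (simp add: left_diff_distrib lookup_minus)
  then have "t \<in> keys ((var z - 1) * p)" using t by (simp add: in_keys_iff)
  then show False using * t by auto
qed

lemma FactRing_carrierE:
  assumes "X \<in> carrier (R Quot I)"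
  obtains f where "f \<in> carrier R" "X = I +>\<^bsub>R\<^esub> f"
  using assms by (auto simp: FactRing_def A_RCOSETS_def')

lemma simple_graph_delete_verts: "simple_graph G \<Longrightarrow> simple_graph (delete_verts G S)"
  by (fastforce simp: simple_graph_def delete_verts_def)

lemma delete_verts_delete_verts: "delete_verts (delete_verts G S) T = delete_verts G (S \<union> T)"
  by (auto simp: delete_verts_def)

section \<open>The substitution that sets a vertex to 1 and its neighbors to 0\<close>

locale vertex_in_graph =
  fixes K :: "'k::field itself" and G :: "'v graph" and z :: 'v
  assumes G: "simple_graph G" and z: "z \<in> verts G"
begin

definition "N = neighbors G z"
definition "H = delete_verts G (insert z N)"
definition del_z :: "('v \<Rightarrow>\<^sub>0 nat) \<Rightarrow> 'v \<Rightarrow>\<^sub>0 nat" where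
  "del_z t = t - single z (lookup t z)"
text \<open>The value of a monomial when \<open>z\<close> is replaced by 1 and every neighbor of
  \<open>z\<close> by 0; \<open>\<phi>\<^sub>0\<close> extends it to polynomials.\<close>

definition g :: "('v \<Rightarrow>\<^sub>0 nat) \<Rightarrow> ('v, 'k) mpoly" where "g t = (if keys t \<inter> N = {} then single (del_z t) 1 else 0)"
definition \<phi>\<^sub>0 :: "('v, 'k) mpoly \<Rightarrow> ('v, 'k) mpoly" where "\<phi>\<^sub>0 = substitute g"

abbreviation "R \<equiv> poly_ring K (verts G)"
abbreviation "R' \<equiv> poly_ring K (verts H)"
abbreviation "I \<equiv> edge_ideal K G"
abbreviation "I' \<equiv> edge_ideal K H"

lemma H: "simple_graph H"
  unfolding H_def by (rule simple_graph_delete_verts[OF G])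

lemma verts_H: "verts H = verts G - insert z N"
  and edges_H: "edges H = {e \<in> edges G. e \<inter> insert z N = {}}"
  by (simp_all add: H_def delete_verts_def)

lemma z_notin_N: "z \<notin> N"
  using G by (auto simp: N_def neighbors_def simple_graph_def)

lemma edge_z: "e \<in> edges G \<Longrightarrow> z \<in> e \<Longrightarrow> e \<inter> N \<noteq> {}"
proof -
  assume e: "e \<in> edges G" "z \<in> e"
  then have "card e = 2" "e \<subseteq> verts G" using G by (auto simp: simple_graph_def)
  then obtain v where "e = {z, v}" using e by (metis card_2_iff insert_iff insert_commute empty_iff)
  then show ?thesis using e \<open>e \<subseteq> verts G\<close> by (auto simp: N_def neighbors_def)
qed

lemma lookup_del_z: "lookup (del_z t) v = (if v = z then 0 else lookup t v)"
  by (simp add: del_z_def lookup_minus lookup_single when_def)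

lemma keys_del_z: "keys (del_z t) = keys t - {z}"
  by (rule Set.set_eqI) (simp add: in_keys_iff lookup_del_z)

lemma del_z_add: "del_z (s + t) = del_z s + del_z t"
  by (rule poly_mapping_eqI) (simp add: lookup_del_z lookup_add)

lemma del_z_split: "t = single z (lookup t z) + del_z t"
  by (rule poly_mapping_eqI) (simp add: lookup_del_z lookup_add lookup_single when_def)

lemma g_add: "g (s + t) = g s * g t"
  by (auto simp: g_def keys_plus_nat del_z_add mult_single)

lemma \<phi>\<^sub>0_mult: "\<phi>\<^sub>0 (p * q) = \<phi>\<^sub>0 p * \<phi>\<^sub>0 q"
  unfolding \<phi>\<^sub>0_def by (rule substitute_mult[OF g_add])

lemma \<phi>\<^sub>0_add: "\<phi>\<^sub>0 (p + q) = \<phi>\<^sub>0 p + \<phi>\<^sub>0 q" and \<phi>\<^sub>0_diff: "\<phi>\<^sub>0 (p - q) = \<phi>\<^sub>0 p - \<phi>\<^sub>0 q"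
  by (simp_all add: \<phi>\<^sub>0_def substitute_add substitute_diff)

lemma del_z_zero: "del_z 0 = 0"
  by (rule poly_mapping_eqI) (simp add: lookup_del_z)

lemma \<phi>\<^sub>0_one: "\<phi>\<^sub>0 1 = 1"
  unfolding \<phi>\<^sub>0_def single_one[symmetric] substitute_single by (simp add: g_def del_z_zero)

lemma \<phi>\<^sub>0_z: "\<phi>\<^sub>0 (var z) = 1"
proof -
  have "del_z (single z 1) = 0" by (rule poly_mapping_eqI) (simp add: lookup_del_z lookup_single when_def)
  then show ?thesis using z_notin_N by (simp add: \<phi>\<^sub>0_def var_def g_def)
qed

lemma \<phi>\<^sub>0_closed: "p \<in> polys (verts G) \<Longrightarrow> \<phi>\<^sub>0 p \<in> polys (verts H)"
  unfolding \<phi>\<^sub>0_def substitute_def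
proof (rule polys_sum)
  fix t assume "p \<in> polys (verts G)" "t \<in> keys p"
  then have "keys t \<subseteq> verts G" by (auto simp: polys_def)
  then have "g t \<in> polys (verts H)"
    by (auto simp: g_def verts_H keys_del_z intro!: polys_single)
  then show "single 0 (lookup p t) * g t \<in> polys (verts H)" by (intro polys_mult polys_single) auto
qed

lemma \<phi>\<^sub>0_id:
  assumes "p \<in> polys (verts H)"
  shows "\<phi>\<^sub>0 p = p"
proof -
  have "single 0 (lookup p t) * g t = single t (lookup p t)" if "t \<in> keys p" for t
  proof -
    have "keys t \<subseteq> verts H" using assms that by (auto simp: polys_def)
    then have "keys t \<inter> N = {}" "z \<notin> keys t" by (auto simp: verts_H)
    then have "del_z t = t" by (intro poly_mapping_eqI) (auto simp: lookup_del_z in_keys_iff)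
    then show ?thesis using \<open>keys t \<inter> N = {}\<close> by (simp add: g_def mult_single)
  qed
  then show ?thesis
    unfolding \<phi>\<^sub>0_def substitute_def by (simp flip: poly_eq_sum_single)
qed

lemma polys_H: "p \<in> polys (verts H) \<Longrightarrow> p \<in> polys (verts G)"
  by (auto simp: polys_def verts_H)

lemma ideals: "ideal I R" "ideal I' R'"
proof -
  have gen: "{var u * var v | u v. {u, v} \<in> edges F} \<subseteq> carrier (poly_ring K (verts F))"
    if "simple_graph F" for F :: "'v graph"
  proof
    fix p :: "('v, 'k) mpoly" assume "p \<in> {var u * var v | u v. {u, v} \<in> edges F}"
    then obtain u v where uv: "{u, v} \<in> edges F" "p = var u * var v" by auto
    then have "{u, v} \<subseteq> verts F" using that unfolding simple_graph_def by blast
    then show "p \<in> carrier (poly_ring K (verts F))" using uv by (auto intro!: polys_mult polys_var)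
  qed
  show "ideal I R" "ideal I' R'"
    unfolding edge_ideal_def
    by (rule ring.genideal_ideal[OF cring.axioms(1)[OF poly_ring_cring] gen] G H)+
qed

text \<open>A term surviving the substitution contains no neighbor of \<open>z\<close>. The edge in
  its support then cannot contain \<open>z\<close> either, since its other end would be such a
  neighbor, and so it is an edge of \<open>H\<close>.\<close>

lemma \<phi>\<^sub>0_I:
  assumes "p \<in> I"
  shows "\<phi>\<^sub>0 p \<in> I'"
proof -
  have p: "p \<in> polys (verts G)" "\<And>t. t \<in> keys p \<Longrightarrow> \<exists>e\<in>edges G. e \<subseteq> keys t"
    using assms by (auto simp: edge_ideal_eq[OF G])
  show ?thesis
    unfolding \<phi>\<^sub>0_def substitute_def
  proof (rule ideal_sum[OF ideals(2)])
    fix t assume t: "t \<in> keys p"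
    obtain e where e: "e \<in> edges G" "e \<subseteq> keys t" using p(2)[OF t] by blast
    have kt: "keys t \<subseteq> verts G" using p(1) t by (auto simp: polys_def)
    show "single 0 (lookup p t) * g t \<in> I'"
    proof (cases "keys t \<inter> N = {}")
      case True
      then have "e \<inter> N = {}" "z \<notin> e" using e edge_z[OF e(1)] by auto
      then have "e \<in> edges H" "e \<subseteq> keys (del_z t)" using e by (auto simp: edges_H keys_del_z)
      moreover have "keys (del_z t) \<subseteq> verts H" using kt True by (auto simp: keys_del_z verts_H)
      ultimately show ?thesis
        using True by (auto simp: edge_ideal_eq[OF H] g_def mult_single intro!: polys_single)
    next
      case False
      then show ?thesis by (simp add: g_def edge_ideal_eq[OF H])
    qed
  qed
qed

lemma I'_subset: "I' \<subseteq> I"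
  using polys_H unfolding edge_ideal_eq[OF G] edge_ideal_eq[OF H] edges_H by blast

lemma I_add: "p \<in> I \<Longrightarrow> q \<in> I \<Longrightarrow> p + q \<in> I"
  using additive_subgroup.a_closed[OF ideal.axioms(1)[OF ideals(1)], of p q] by simp

lemma I_mult: "p \<in> I \<Longrightarrow> q \<in> polys (verts G) \<Longrightarrow> q * p \<in> I"
  using ideal.I_l_closed[OF ideals(1), of p q] by simp

text \<open>This gives the kernel condition for \<open>z - 1\<close>. A term with a neighbor of
  \<open>z\<close> is mapped to 0, and only after multiplication by \<open>z\<close> does it fall
  into \<open>I\<close>; this is why the factor \<open>var z\<close> is present. It is harmless, as
  \<open>var z\<close> is mapped to 1. For any other term \<open>p\<close> and its image differ by a
  power of \<open>z\<close>, which is 1 modulo \<open>z - 1\<close>.\<close>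

lemma var_z_mult_diff:
  assumes "p \<in> polys (verts G)"
  shows "\<exists>c\<in>polys (verts G). var z * p - var z * \<phi>\<^sub>0 p - (var z - 1) * c \<in> I"
proof -
  define D where "D = {p. \<exists>c\<in>polys (verts G). var z * p - var z * \<phi>\<^sub>0 p - (var z - 1) * c \<in> I}"
  have zI: "0 \<in> I" by (auto simp: edge_ideal_eq[OF G])
  have pz: "(var z :: ('v, 'k) mpoly) \<in> polys (verts G)" using z by (rule polys_var)
  have mono: "single t c \<in> D" if t: "keys t \<subseteq> verts G" for t and c :: 'k
  proof (cases "keys t \<inter> N = {}")
    case True
    define k where "k = lookup t z"
    have pow: "var z ^ k = (single (single z k) 1 :: ('v, 'k) mpoly)"
      by (induction k) (auto simp: var_def mult_single single_add[symmetric])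
    define q where "q = (single (del_z t) c :: ('v, 'k) mpoly)"
    have q: "q \<in> polys (verts G)" using t by (auto simp: q_def keys_del_z intro!: polys_single)
    have "single t c = var z ^ k * q"
      unfolding pow q_def mult_single by (simp add: k_def del_z_split[symmetric])
    moreover have "\<phi>\<^sub>0 (single t c) = q" using True by (simp add: \<phi>\<^sub>0_def g_def q_def mult_single)
    ultimately have "var z * single t c - var z * \<phi>\<^sub>0 (single t c) = var z * q * (var z ^ k - 1)"
      by (simp add: algebra_simps)
    \<comment> \<open>The geometric sum is the cofactor of \<open>z - 1\<close> in
      \<open>z ^ k - 1\<close>.\<close>
    also have "\<dots> = (var z - 1) * (var z * q * (\<Sum>i<k. var z ^ i))"
      by (simp add: power_diff_1_eq mult_ac)
    finally show ?thesis
      unfolding D_def using q pz zI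
      by (auto intro!: bexI[of _ "var z * q * (\<Sum>i<k. var z ^ i)"] polys_intros)
  next
    case False
    then obtain v where v: "v \<in> keys t" "v \<in> N" by auto
    have "{z, v} \<in> edges G" using v by (auto simp: N_def neighbors_def)
    moreover have "var z * single t c \<in> polys (verts G)"
      using t pz by (intro polys_mult polys_single)
    ultimately have "var z * single t c \<in> I"
      using v by (auto simp: edge_ideal_eq[OF G] var_def mult_single keys_plus_nat intro!: bexI[of _ "{z, v}"])
    moreover have "\<phi>\<^sub>0 (single t c) = 0" using False by (simp add: \<phi>\<^sub>0_def g_def)
    ultimately show ?thesis unfolding D_def by (auto intro!: bexI[of _ 0] polys_zero)
  qed
  have "(\<Sum>t\<in>keys p. single t (lookup p t)) \<in> D"
  proof (rule sum_closed)
    show "0 \<in> D" unfolding D_def using zI by (auto intro!: bexI[of _ 0] polys_zero simp: \<phi>\<^sub>0_def)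
    show "single t (lookup p t) \<in> D" if "t \<in> keys p" for t
      using that assms by (intro mono) (auto simp: polys_def)
    fix p q assume "p \<in> D" "q \<in> D"
    then obtain c d where c: "c \<in> polys (verts G)" "var z * p - var z * \<phi>\<^sub>0 p - (var z - 1) * c \<in> I"
      and d: "d \<in> polys (verts G)" "var z * q - var z * \<phi>\<^sub>0 q - (var z - 1) * d \<in> I"
      by (auto simp: D_def)
    have "var z * (p + q) - var z * \<phi>\<^sub>0 (p + q) - (var z - 1) * (c + d) \<in> I"
      using I_add[OF c(2) d(2)] by (simp add: \<phi>\<^sub>0_add algebra_simps)
    then show "p + q \<in> D" unfolding D_def using polys_add[OF c(1) d(1)] by auto
  qed
  then show ?thesis unfolding D_def by (simp flip: poly_eq_sum_single)
qed

abbreviation "A \<equiv> R Quot I"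
abbreviation "B \<equiv> R' Quot I'"
abbreviation "cl f \<equiv> I +>\<^bsub>R\<^esub> f"
abbreviation "cl' f \<equiv> I' +>\<^bsub>R'\<^esub> f"

definition "\<phi> X = cl' (\<phi>\<^sub>0 (SOME f. f \<in> polys (verts G) \<and> X = cl f))"

lemma cl_eq_iff:
  "p \<in> polys (verts G) \<Longrightarrow> q \<in> polys (verts G) \<Longrightarrow> cl p = cl q \<longleftrightarrow> p - q \<in> I"
  using ring.quotient_eq_iff_same_a_r_cos[OF cring.axioms(1)[OF poly_ring_cring] ideals(1), of p q]
  by (simp add: poly_ring_minus)

lemma cl'_eq_iff:
  "p \<in> polys (verts H) \<Longrightarrow> q \<in> polys (verts H) \<Longrightarrow> cl' p = cl' q \<longleftrightarrow> p - q \<in> I'"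
  using ring.quotient_eq_iff_same_a_r_cos[OF cring.axioms(1)[OF poly_ring_cring] ideals(2), of p q]
  by (simp add: poly_ring_minus)

lemma \<phi>_cl:
  assumes p: "p \<in> polys (verts G)"
  shows "\<phi> (cl p) = cl' (\<phi>\<^sub>0 p)"
proof -
  define f where "f = (SOME f. f \<in> polys (verts G) \<and> cl p = cl f)"
  have f: "f \<in> polys (verts G)" "cl p = cl f"
    using someI_ex[of "\<lambda>f. f \<in> polys (verts G) \<and> cl p = cl f"] p by (auto simp: f_def)
  then have "\<phi>\<^sub>0 (f - p) \<in> I'" using p cl_eq_iff[of f p] by (intro \<phi>\<^sub>0_I) simp
  then have "cl' (\<phi>\<^sub>0 f) = cl' (\<phi>\<^sub>0 p)"
    using cl'_eq_iff f p by (simp add: \<phi>\<^sub>0_closed \<phi>\<^sub>0_diff)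
  then show ?thesis by (simp add: \<phi>_def f_def)
qed

lemma cl_hom: "ring_hom_ring R A cl" and cl'_hom: "ring_hom_ring R' B cl'"
  by (rule ideal.rcos_ring_hom_ring, rule ideals)+

lemma cl_simps:
  assumes "p \<in> polys (verts G)" "q \<in> polys (verts G)"
  shows "cl p \<in> carrier A" "cl p \<otimes>\<^bsub>A\<^esub> cl q = cl (p * q)" "cl p \<oplus>\<^bsub>A\<^esub> cl q = cl (p + q)"
  using ring_hom_memE[OF ring_hom_ring.homh[OF cl_hom]] assms by simp_all

lemma cl'_simps:
  assumes "p \<in> polys (verts H)" "q \<in> polys (verts H)"
  shows "cl' p \<in> carrier B" "cl' p \<otimes>\<^bsub>B\<^esub> cl' q = cl' (p * q)" "cl' p \<oplus>\<^bsub>B\<^esub> cl' q = cl' (p + q)"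
  using ring_hom_memE[OF ring_hom_ring.homh[OF cl'_hom]] assms by simp_all

lemma cl_one: "\<one>\<^bsub>A\<^esub> = cl 1" and cl'_one: "\<one>\<^bsub>B\<^esub> = cl' 1"
  by (simp_all add: FactRing_def)

lemma cl_zero: "\<zero>\<^bsub>A\<^esub> = cl 0" and cl'_zero: "\<zero>\<^bsub>B\<^esub> = cl' 0"
  using ring.a_rcos_zero[OF cring.axioms(1)[OF poly_ring_cring] ideals(1)]
    ring.a_rcos_zero[OF cring.axioms(1)[OF poly_ring_cring] ideals(2)]
  by (simp_all add: FactRing_def edge_ideal_eq[OF G] edge_ideal_eq[OF H])

text \<open>The regular element is the class of \<open>z - 1\<close>, and the class of
  \<open>z\<close> serves as the multiplier \<open>u\<close> in the kernel condition: it is mapped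
  to 1, and \<open>var_z_mult_diff\<close> provides the multiple of \<open>z - 1\<close>.\<close>

lemma hypersurface_section:
  assumes "noetherian_ring A"
  shows "hypersurface_section A B \<phi> (cl (var z - 1))"
proof -
  have cA: "cring A" and cB: "cring B"
    using ideal.quotient_is_cring ideals poly_ring_cring by auto
  have ring_hom: "ring_hom_ring A B \<phi>"
  proof (rule ring_hom_ringI)
    show "ring A" "ring B" using cA cB by (auto simp: cring_def)
    fix X assume "X \<in> carrier A"
    then obtain p where p: "p \<in> polys (verts G)" "X = cl p" by (rule FactRing_carrierE) simp
    then show "\<phi> X \<in> carrier B" using cl'_simps(1)[OF \<phi>\<^sub>0_closed \<phi>\<^sub>0_closed] by (simp add: \<phi>_cl)
    fix Y assume "Y \<in> carrier A"
    then obtain q where q: "q \<in> polys (verts G)" "Y = cl q" by (rule FactRing_carrierE) simp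
    show "\<phi> (X \<otimes>\<^bsub>A\<^esub> Y) = \<phi> X \<otimes>\<^bsub>B\<^esub> \<phi> Y" "\<phi> (X \<oplus>\<^bsub>A\<^esub> Y) = \<phi> X \<oplus>\<^bsub>B\<^esub> \<phi> Y"
      using p q by (simp_all add: cl_simps cl'_simps \<phi>_cl polys_add polys_mult \<phi>\<^sub>0_closed \<phi>\<^sub>0_mult \<phi>\<^sub>0_add)
  next
    show "\<phi> \<one>\<^bsub>A\<^esub> = \<one>\<^bsub>B\<^esub>" by (simp add: cl_one cl'_one \<phi>_cl \<phi>\<^sub>0_one)
  qed
  have surj: "\<phi> ` carrier A = carrier B"
  proof
    show "\<phi> ` carrier A \<subseteq> carrier B"
      using ring_hom_closed[OF ring_hom_ring.homh[OF ring_hom]] by blast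
    show "carrier B \<subseteq> \<phi> ` carrier A"
    proof
      fix Y assume "Y \<in> carrier B"
      then obtain p where p: "p \<in> polys (verts H)" "Y = cl' p" by (rule FactRing_carrierE) simp
      then have "Y = \<phi> (cl p)" "cl p \<in> carrier A"
        using polys_H[OF p(1)] by (simp_all add: \<phi>_cl \<phi>\<^sub>0_id cl_simps)
      then show "Y \<in> \<phi> ` carrier A" by blast
    qed
  qed
  have pz: "(var z :: ('v, 'k) mpoly) \<in> polys (verts G)" "(var z - 1 :: ('v, 'k) mpoly) \<in> polys (verts G)"
    using z by (auto intro: polys_intros)
  have reg: "regular_mod A {\<zero>\<^bsub>A\<^esub>} (cl (var z - 1))"
    unfolding regular_mod_def
  proof (intro ballI impI)
    fix X assume "X \<in> carrier A" and X: "cl (var z - 1) \<otimes>\<^bsub>A\<^esub> X \<in> {\<zero>\<^bsub>A\<^esub>}"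
    then obtain p where p: "p \<in> polys (verts G)" "X = cl p" by (metis FactRing_carrierE poly_ring_simps(1))
    have "(var z - 1) * p \<in> I"
      using X p pz cl_eq_iff[of "(var z - 1) * p" 0] by (simp add: cl_simps cl_zero polys_mult)
    then have "\<forall>t\<in>keys ((var z - 1) * p). \<exists>e\<in>edges G. e \<subseteq> keys t"
      by (simp add: edge_ideal_eq[OF G])
    then have "\<forall>t\<in>keys p. \<exists>e\<in>edges G. e \<subseteq> keys t"
      by (intro var_minus_one_regular[OF p(1)]) (auto simp: keys_plus_nat)
    then have "p \<in> I" using p by (simp add: edge_ideal_eq[OF G])
    then show "X \<in> {\<zero>\<^bsub>A\<^esub>}" using p cl_eq_iff[of p 0] by (simp add: cl_zero)
  qed
  have ker: "\<exists>u\<in>carrier A. \<phi> u = \<one>\<^bsub>B\<^esub> \<and> (\<exists>c\<in>carrier A. u \<otimes>\<^bsub>A\<^esub> X = cl (var z - 1) \<otimes>\<^bsub>A\<^esub> c)"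
    if X: "X \<in> carrier A" "\<phi> X = \<zero>\<^bsub>B\<^esub>" for X
  proof -
    from X(1) obtain p where p: "p \<in> polys (verts G)" "X = cl p" by (rule FactRing_carrierE) simp
    have "\<phi>\<^sub>0 p \<in> I'"
      using X(2) p cl'_eq_iff[of "\<phi>\<^sub>0 p" 0] by (simp add: \<phi>_cl \<phi>\<^sub>0_closed cl'_zero)
    then have *: "var z * \<phi>\<^sub>0 p \<in> I" using I'_subset pz by (auto intro: I_mult)
    obtain c where c: "c \<in> polys (verts G)" "var z * p - var z * \<phi>\<^sub>0 p - (var z - 1) * c \<in> I"
      using var_z_mult_diff[OF p(1)] by blast
    have "var z * p - (var z - 1) * c \<in> I" using I_add[OF c(2) *] by simp
    then have "cl (var z * p) = cl ((var z - 1) * c)"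
      using cl_eq_iff p c pz by (simp add: polys_mult)
    then have "cl (var z) \<otimes>\<^bsub>A\<^esub> X = cl (var z - 1) \<otimes>\<^bsub>A\<^esub> cl c"
      using p c pz by (simp add: cl_simps)
    moreover have "\<phi> (cl (var z)) = \<one>\<^bsub>B\<^esub>" using pz by (simp add: \<phi>_cl \<phi>\<^sub>0_z cl'_one)
    ultimately show ?thesis using pz c cl_simps(1) by blast
  qed
  have "\<phi> (cl (var z - 1)) = \<zero>\<^bsub>B\<^esub>"
    using pz by (simp add: \<phi>_cl \<phi>\<^sub>0_diff \<phi>\<^sub>0_z \<phi>\<^sub>0_one cl'_zero)
  then show ?thesis
    using cA cB ring_hom surj reg ker assms pz cl_simps(1)
    by (intro hypersurface_section.intro surjective_hom.intro surjective_hom_axioms.intro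
        hypersurface_section_axioms.intro) auto
qed

end

text \<open>Inverting \<open>z\<close> kills the neighbors of \<open>z\<close> in \<open>R/I(G)\<close>, so setting \<open>z = 1\<close> yields \<open>R/I(G \<setminus> N[z])\<close>.\<close>

theorem cohen_macaulay_delete_closed_neighborhood:
  assumes "simple_graph G" "z \<in> verts G" "cohen_macaulay_graph K G"
  shows "cohen_macaulay_graph K (delete_verts G (insert z (neighbors G z)))"
proof -
  interpret vertex_in_graph K G z using assms by unfold_locales
  have "noetherian_ring A" using assms(3) by (simp add: cohen_macaulay_graph_def cohen_macaulay_def)
  then interpret S: hypersurface_section A B \<phi> "cl (var z - 1)" by (rule hypersurface_section)
  have "cohen_macaulay B"
    using assms(3) by (intro S.cohen_macaulay_descent) (simp add: cohen_macaulay_graph_def)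
  then show ?thesis by (simp add: cohen_macaulay_graph_def H_def N_def)
qed

section \<open>Resolutions by free modules\<close>

lemma keys_zero_iff_nat: "s + t = 0 \<longleftrightarrow> s = 0 \<and> t = (0 :: 'v \<Rightarrow>\<^sub>0 nat)"
proof
  assume "s + t = 0"
  then have "lookup s v + lookup t v = 0" for v by (metis lookup_add lookup_zero)
  then show "s = 0 \<and> t = 0" by (auto intro!: poly_mapping_eqI)
qed simp

lemma lookup_mult_zero: "lookup (p * q) 0 = lookup p 0 * lookup (q :: ('v, 'k::field) mpoly) 0"
proof (induction p rule: poly_mapping_single_induct)
  case (single s c)
  show ?case
    by (induction q rule: poly_mapping_single_induct)
      (auto simp: mult_single lookup_single when_def keys_zero_iff_nat distrib_left lookup_add)
qed (simp_all add: distrib_right lookup_add)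

definition smul :: "'a::times \<Rightarrow> (nat \<Rightarrow> 'a) \<Rightarrow> nat \<Rightarrow> 'a" where
  "smul r v = (\<lambda>i. r * v i)"

definition unit :: "nat \<Rightarrow> nat \<Rightarrow> 'a::zero_neq_one" where
  "unit i = (\<lambda>j. if j = i then 1 else 0)"

lemma smul_simps [simp]:
  "smul r 0 = 0" "smul 0 v = 0" "smul 1 v = v"
  "smul r (u + v) = smul r u + smul r v" "smul r (u - v) = smul r u - smul r v"
  "smul (- 1) v = - v" "smul r (- v) = - smul r v"
  for r :: "'a::comm_ring_1"
  by (auto simp: smul_def fun_eq_iff algebra_simps)

lemma smul_smul: "smul r (smul s v) = smul (r * s) v" for r :: "'a::comm_ring_1"
  by (auto simp: smul_def fun_eq_iff algebra_simps)

lemma sum_fun_apply: "(\<Sum>i\<in>A. f i) j = (\<Sum>i\<in>A. f i j)" for f :: "'i \<Rightarrow> 'j \<Rightarrow> 'a::comm_monoid_add"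
  by (induction A rule: infinite_finite_induct) auto

locale polynomial_modules =
  fixes K :: "'k::field itself" and V :: "'v set"
begin

abbreviation "R \<equiv> poly_ring K V"

definition fm :: "nat \<Rightarrow> (nat \<Rightarrow> ('v, 'k) mpoly) set" where
  "fm n = {v. (\<forall>i. v i \<in> polys V) \<and> (\<forall>i\<ge>n. v i = 0)}"

text \<open>The free module multiplied by the ideal of all variables, that is, the vectors without
  constant terms. A resolution is minimal when its differentials take values here.\<close>

definition mm :: "nat \<Rightarrow> (nat \<Rightarrow> ('v, 'k) mpoly) set" where
  "mm n = {v \<in> fm n. \<forall>i. lookup (v i) 0 = 0}"

definition submod :: "(nat \<Rightarrow> ('v, 'k) mpoly) set \<Rightarrow> bool" where
  "submod A \<longleftrightarrow> 0 \<in> A \<and> (\<forall>u\<in>A. \<forall>v\<in>A. u + v \<in> A) \<and> (\<forall>r\<in>polys V. \<forall>v\<in>A. smul r v \<in> A)"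

definition lin :: "(nat \<Rightarrow> ('v, 'k) mpoly) set \<Rightarrow> (nat \<Rightarrow> ('v, 'k) mpoly) set
    \<Rightarrow> ((nat \<Rightarrow> ('v, 'k) mpoly) \<Rightarrow> nat \<Rightarrow> ('v, 'k) mpoly) \<Rightarrow> bool" where
  "lin A B f \<longleftrightarrow> (\<forall>v\<in>A. f v \<in> B) \<and> (\<forall>u\<in>A. \<forall>v\<in>A. f (u + v) = f u + f v) \<and>
     (\<forall>r\<in>polys V. \<forall>v\<in>A. f (smul r v) = smul r (f v))"

lemma linD:
  assumes "lin A B f"
  shows "v \<in> A \<Longrightarrow> f v \<in> B" "u \<in> A \<Longrightarrow> v \<in> A \<Longrightarrow> f (u + v) = f u + f v"
    "r \<in> polys V \<Longrightarrow> v \<in> A \<Longrightarrow> f (smul r v) = smul r (f v)"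
  using assms by (auto simp: lin_def)

lemma submodD:
  assumes "submod A"
  shows "0 \<in> A" "u \<in> A \<Longrightarrow> v \<in> A \<Longrightarrow> u + v \<in> A" "r \<in> polys V \<Longrightarrow> v \<in> A \<Longrightarrow> smul r v \<in> A"
    "v \<in> A \<Longrightarrow> - v \<in> A" "u \<in> A \<Longrightarrow> v \<in> A \<Longrightarrow> u - v \<in> A"
proof -
  show 1: "0 \<in> A" "u \<in> A \<Longrightarrow> v \<in> A \<Longrightarrow> u + v \<in> A" "r \<in> polys V \<Longrightarrow> v \<in> A \<Longrightarrow> smul r v \<in> A" for u v r
    using assms by (auto simp: submod_def)
  have m1: "- 1 \<in> polys V" using polys_uminus[OF polys_one] .
  show 2: "v \<in> A \<Longrightarrow> - v \<in> A" for v using 1(3)[OF m1, of v] by simp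
  show "u \<in> A \<Longrightarrow> v \<in> A \<Longrightarrow> u - v \<in> A" using 1(2)[of u "- v"] 2[of v] by simp
qed

lemma submod_sum: "submod A \<Longrightarrow> (\<And>i. i \<in> S \<Longrightarrow> f i \<in> A) \<Longrightarrow> sum f S \<in> A"
  by (induction S rule: infinite_finite_induct) (auto simp: submod_def)

lemma lin_simps:
  assumes "lin A B f" "submod A"
  shows "f 0 = 0" "v \<in> A \<Longrightarrow> f (- v) = - f v" "u \<in> A \<Longrightarrow> v \<in> A \<Longrightarrow> f (u - v) = f u - f v"
proof -
  have m1: "- 1 \<in> polys V" using polys_uminus[OF polys_one] .
  show "f 0 = 0" using linD(3)[OF assms(1) polys_zero submodD(1)[OF assms(2)]] by simp
  show 2: "v \<in> A \<Longrightarrow> f (- v) = - f v" for v using linD(3)[OF assms(1) m1, of v] by simp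
  show "u \<in> A \<Longrightarrow> v \<in> A \<Longrightarrow> f (u - v) = f u - f v"
    using linD(2)[OF assms(1), of u "- v"] 2[of v] submodD(4)[OF assms(2), of v] by simp
qed

lemma lin_sum:
  assumes "lin A B f" "submod A" "\<And>i. i \<in> S \<Longrightarrow> g i \<in> A"
  shows "f (sum g S) = (\<Sum>i\<in>S. f (g i))"
  using assms(3)
  by (induction S rule: infinite_finite_induct)
    (simp_all add: lin_simps[OF assms(1,2)] linD(2)[OF assms(1)] submod_sum[OF assms(2)])

lemma lin_comp: "lin A B f \<Longrightarrow> lin B C g \<Longrightarrow> lin A C (\<lambda>v. g (f v))"
  by (simp add: lin_def)

lemma lin_id: "lin A A (\<lambda>v. v)"
  by (simp add: lin_def)

lemma lin_zero: "submod B \<Longrightarrow> lin A B (\<lambda>v. 0)"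
  by (simp add: lin_def submodD)

lemma lin_diff:
  assumes "lin A B f" "lin A B g" "submod B"
  shows "lin A B (\<lambda>v. f v - g v)"
  using assms by (simp add: lin_def submodD)

lemma submod_fm: "submod (fm n)"
  by (auto simp: submod_def fm_def smul_def intro: polys_intros)

lemma submod_mm: "submod (mm n)"
  using submodD[OF submod_fm] by (auto simp: submod_def mm_def smul_def lookup_add lookup_mult_zero)

lemma mm_fm: "v \<in> mm n \<Longrightarrow> v \<in> fm n"
  by (simp add: mm_def)

lemma unit_fm: "i < n \<Longrightarrow> unit i \<in> fm n"
  by (auto simp: unit_def fm_def)

lemma fm_expand: "v \<in> fm n \<Longrightarrow> v = (\<Sum>i<n. smul (v i) (unit i))"
  by (rule ext) (auto simp: sum_fun_apply smul_def unit_def fm_def if_distrib[of "\<lambda>x. _ * x"] cong: if_cong)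

lemma lin_expand:
  assumes "lin (fm n) B f" "v \<in> fm n"
  shows "f v = (\<Sum>i<n. smul (v i) (f (unit i)))"
proof -
  have c: "smul (v i) (unit i) \<in> fm n" "v i \<in> polys V" if "i < n" for i
    using assms(2) that submodD(3)[OF submod_fm _ unit_fm[OF that]] by (auto simp: fm_def)
  have "f v = f (\<Sum>i<n. smul (v i) (unit i))" using fm_expand[OF assms(2)] by simp
  also have "\<dots> = (\<Sum>i<n. f (smul (v i) (unit i)))"
    using c by (intro lin_sum[OF assms(1) submod_fm]) auto
  also have "\<dots> = (\<Sum>i<n. smul (v i) (f (unit i)))"
    using c unit_fm by (intro sum.cong) (auto intro: linD(3)[OF assms(1)])
  finally show ?thesis .
qed

lemma lin_mm:
  assumes "lin (fm n) (fm m) f" "v \<in> mm n"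
  shows "f v \<in> mm m"
proof -
  have "smul (v i) (f (unit i)) \<in> mm m" if "i < n" for i
  proof -
    have "f (unit i) \<in> fm m" "v i \<in> polys V"
      using linD(1)[OF assms(1) unit_fm[OF that]] mm_fm[OF assms(2)] by (auto simp: fm_def)
    then have "smul (v i) (f (unit i)) \<in> fm m" by (intro submodD(3)[OF submod_fm])
    then show ?thesis using assms(2) by (auto simp: mm_def smul_def lookup_mult_zero)
  qed
  then show ?thesis
    unfolding lin_expand[OF assms(1) mm_fm[OF assms(2)]] by (intro submod_sum[OF submod_mm]) auto
qed

text \<open>Projectivity of free modules: choose preimages of the images of the unit vectors and
  extend linearly.\<close>

lemma lin_lift:
  assumes g: "lin (fm n) B g" and h: "lin A B h" and A: "submod A"
    and sub: "\<And>v. v \<in> fm n \<Longrightarrow> g v \<in> h ` A"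
  shows "\<exists>f. lin (fm n) A f \<and> (\<forall>v\<in>fm n. h (f v) = g v)"
proof -
  have "\<forall>i\<in>{..<n}. \<exists>a. a \<in> A \<and> h a = g (unit i)" using sub[OF unit_fm] by force
  then obtain a where a: "\<And>i. i < n \<Longrightarrow> a i \<in> A" "\<And>i. i < n \<Longrightarrow> h (a i) = g (unit i)"
    by (metis bchoice lessThan_iff)
  define f where "f v = (\<Sum>i<n. smul (v i) (a i))" for v
  have aA: "smul (v i) (a i) \<in> A" "v i \<in> polys V" if "i < n" "v \<in> fm n" for v i
    using a(1)[OF that(1)] that(2) submodD(3)[OF A] by (auto simp: fm_def)
  have "lin (fm n) A f"
    unfolding lin_def
  proof (intro conjI ballI)
    show "f v \<in> A" if "v \<in> fm n" for v
      unfolding f_def using aA that by (intro submod_sum[OF A]) auto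
    show "f (u + v) = f u + f v" for u v
      by (rule ext) (simp add: f_def sum_fun_apply smul_def distrib_right sum.distrib)
    show "f (smul r v) = smul r (f v)" for r v
      by (rule ext) (simp add: f_def sum_fun_apply smul_def sum_distrib_left mult.assoc)
  qed
  moreover have "h (f v) = g v" if v: "v \<in> fm n" for v
  proof -
    have "h (f v) = (\<Sum>i<n. h (smul (v i) (a i)))"
      unfolding f_def using aA v by (intro lin_sum[OF h A]) auto
    also have "\<dots> = (\<Sum>i<n. smul (v i) (g (unit i)))"
      using aA v a by (intro sum.cong) (auto simp: linD(3)[OF h])
    finally show ?thesis using lin_expand[OF g v] by simp
  qed
  ultimately show ?thesis by blast
qed

text \<open>Augmented resolutions: \<open>C 0\<close> is the resolved module and \<open>D 0\<close> the augmentation.\<close>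

definition exact :: "(nat \<Rightarrow> (nat \<Rightarrow> ('v, 'k) mpoly) set) \<Rightarrow>
    (nat \<Rightarrow> (nat \<Rightarrow> ('v, 'k) mpoly) \<Rightarrow> nat \<Rightarrow> ('v, 'k) mpoly) \<Rightarrow> bool" where
  "exact C D \<longleftrightarrow> (\<forall>j. submod (C j)) \<and> (\<forall>j. lin (C (Suc j)) (C j) (D j)) \<and> D 0 ` C (Suc 0) = C 0 \<and>
     (\<forall>j. D (Suc j) ` C (Suc (Suc j)) = {v \<in> C (Suc j). D j v = 0})"

lemma exactD:
  assumes "exact C D"
  shows "submod (C j)" "lin (C (Suc j)) (C j) (D j)" "v \<in> C 0 \<Longrightarrow> v \<in> D 0 ` C (Suc 0)"
    "v \<in> C (Suc j) \<Longrightarrow> D j v = 0 \<Longrightarrow> v \<in> D (Suc j) ` C (Suc (Suc j))"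
    "w \<in> C (Suc (Suc j)) \<Longrightarrow> D j (D (Suc j) w) = 0"
  using assms unfolding exact_def by blast+

section \<open>Comparison of resolutions up to homotopy\<close>

definition chain_map where
  "chain_map C D C' D' f \<longleftrightarrow> (\<forall>j. lin (C j) (C' j) (f j)) \<and>
     (\<forall>j. \<forall>v\<in>C (Suc j). D' j (f (Suc j) v) = f j (D j v))"

text \<open>Lifting degree by degree: the composite of a differential with the map already built
  takes values in cycles of the target, which are boundaries by exactness, so it lifts through the
  next differential.\<close>

lemma comparison:
  assumes C: "exact C D" and free: "\<And>j. C (Suc j) = fm (rk j)" and C': "exact C' D'"
    and f0: "lin (C 0) (C' 0) f0"
  shows "\<exists>f. f 0 = f0 \<and> chain_map C D C' D' f"
proof -
  \<comment> \<open>The last conjunct, that cycles go to cycles, is the invariant that allows the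
    next lift; in degree 0 surjectivity of the augmentation takes its place.\<close>
  define P where "P j f \<longleftrightarrow> lin (C j) (C' j) f \<and> (j = 0 \<longrightarrow> f = f0) \<and>
    (\<forall>i v. j = Suc i \<and> v \<in> C j \<and> D i v = 0 \<longrightarrow> D' i (f v) = 0)" for j f
  define Q where "Q j f f' \<longleftrightarrow> (\<forall>v\<in>C (Suc j). D' j (f' v) = f (D j v))"
    for j and f f' :: "(nat \<Rightarrow> ('v, 'k) mpoly) \<Rightarrow> nat \<Rightarrow> ('v, 'k) mpoly"
  have "\<exists>f. \<forall>j. P j (f j) \<and> Q j (f j) (f (Suc j))"
  proof (rule dependent_nat_choice)
    show "\<exists>f. P 0 f" using f0 by (auto simp: P_def)
    fix f j assume P: "P j f"
    then have lf: "lin (C j) (C' j) f" by (simp add: P_def)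
    have "lin (fm (rk j)) (C' j) (\<lambda>v. f (D j v))"
      using lin_comp[OF exactD(2)[OF C] lf] free by simp
    moreover have "f (D j v) \<in> D' j ` C' (Suc j)" if "v \<in> fm (rk j)" for v
    proof -
      have v: "v \<in> C (Suc j)" using that free by simp
      then have Dv: "D j v \<in> C j" using linD(1)[OF exactD(2)[OF C]] by blast
      then have fv: "f (D j v) \<in> C' j" by (rule linD(1)[OF lf])
      show ?thesis
      proof (cases j)
        case 0
        then show ?thesis using exactD(3)[OF C'] fv by simp
      next
        case (Suc i)
        then have "D i (D j v) = 0" using exactD(5)[OF C] v by simp
        then have "D' i (f (D j v)) = 0" using P Dv Suc by (auto simp: P_def)
        then show ?thesis using exactD(4)[OF C'] fv Suc by simp
      qed
    qed
    ultimately obtain f' where f': "lin (fm (rk j)) (C' (Suc j)) f'" "\<forall>v\<in>fm (rk j). D' j (f' v) = f (D j v)"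
      using lin_lift[OF _ exactD(2)[OF C'] exactD(1)[OF C']] by blast
    then have "Q j f f'" "P (Suc j) f'"
      using free lin_simps(1)[OF lf exactD(1)[OF C]] by (auto simp: P_def Q_def)
    then show "\<exists>f'. P (Suc j) f' \<and> Q j f f'" by blast
  qed
  then show ?thesis by (auto simp: P_def Q_def chain_map_def)
qed

text \<open>With \<open>s j\<close> built, \<open>\<gamma> (Suc j) - s j \<circ> D j\<close> takes
  values in cycles and can be lifted. It is applied to a composite of comparison maps minus the
  identity.\<close>

lemma null_homotopy:
  assumes C: "exact C D" and free: "\<And>j. C (Suc j) = fm (rk j)"
    and \<gamma>: "chain_map C D C D \<gamma>" and \<gamma>0: "\<And>v. v \<in> C 0 \<Longrightarrow> \<gamma> 0 v = 0"
  shows "\<exists>s. (\<forall>j. lin (C j) (C (Suc j)) (s j)) \<and> s 0 = (\<lambda>v. 0) \<and>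
    (\<forall>j. \<forall>v\<in>C (Suc j). \<gamma> (Suc j) v = D (Suc j) (s (Suc j) v) + s j (D j v))"
proof -
  have l\<gamma>: "\<And>j. lin (C j) (C j) (\<gamma> j)" and c\<gamma>: "\<And>j v. v \<in> C (Suc j) \<Longrightarrow> D j (\<gamma> (Suc j) v) = \<gamma> j (D j v)"
    using \<gamma> by (auto simp: chain_map_def)
  define P where "P j s \<longleftrightarrow> lin (C j) (C (Suc j)) s \<and> (j = 0 \<longrightarrow> s = (\<lambda>v. 0)) \<and>
    (\<forall>v\<in>C j. (\<forall>i. j = Suc i \<longrightarrow> D i v = 0) \<longrightarrow> D j (s v) = \<gamma> j v)" for j s
  define Q where "Q j s s' \<longleftrightarrow> (\<forall>v\<in>C (Suc j). \<gamma> (Suc j) v = D (Suc j) (s' v) + s (D j v))"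
    for j and s s' :: "(nat \<Rightarrow> ('v, 'k) mpoly) \<Rightarrow> nat \<Rightarrow> ('v, 'k) mpoly"
  have "\<exists>s. \<forall>j. P j (s j) \<and> Q j (s j) (s (Suc j))"
  proof (rule dependent_nat_choice)
    show "\<exists>s. P 0 s"
      using lin_zero[OF exactD(1)[OF C]] lin_simps(1)[OF exactD(2,1)[OF C]] \<gamma>0
      by (auto simp: P_def)
    fix s j assume P: "P j s"
    then have ls: "lin (C j) (C (Suc j)) s" by (simp add: P_def)
    have lD: "lin (C (Suc j)) (C j) (D j)" by (rule exactD(2)[OF C])
    have "lin (C (Suc j)) (C (Suc j)) (\<lambda>v. \<gamma> (Suc j) v - s (D j v))"
      by (rule lin_diff[OF l\<gamma> lin_comp[OF lD ls] exactD(1)[OF C]])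
    then have "lin (fm (rk j)) (C (Suc j)) (\<lambda>v. \<gamma> (Suc j) v - s (D j v))" using free by simp
    moreover have "\<gamma> (Suc j) v - s (D j v) \<in> D (Suc j) ` C (Suc (Suc j))" if "v \<in> fm (rk j)" for v
    proof -
      have v: "v \<in> C (Suc j)" using that free by simp
      have Dv: "D j v \<in> C j" by (rule linD(1)[OF lD v])
      have c: "\<gamma> (Suc j) v \<in> C (Suc j)" "s (D j v) \<in> C (Suc j)"
        by (rule linD(1)[OF l\<gamma> v], rule linD(1)[OF ls Dv])
      have "D i (D j v) = 0" if "j = Suc i" for i using exactD(5)[OF C] v that by simp
      then have "D j (s (D j v)) = \<gamma> j (D j v)" using P Dv by (auto simp: P_def)
      then have "D j (\<gamma> (Suc j) v - s (D j v)) = 0"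
        using lin_simps(3)[OF lD exactD(1)[OF C] c] c\<gamma>[OF v] by simp
      then show ?thesis by (rule exactD(4)[OF C submodD(5)[OF exactD(1)[OF C] c]])
    qed
    ultimately obtain s' where s': "lin (fm (rk j)) (C (Suc (Suc j))) s'"
      "\<forall>v\<in>fm (rk j). D (Suc j) (s' v) = \<gamma> (Suc j) v - s (D j v)"
      using lin_lift[OF _ exactD(2)[OF C] exactD(1)[OF C]] by blast
    then have "Q j s s'" using free by (simp add: Q_def)
    moreover have "P (Suc j) s'"
      using s' free lin_simps(1)[OF ls exactD(1)[OF C]] by (auto simp: P_def)
    ultimately show "\<exists>s'. P (Suc j) s' \<and> Q j s s'" by blast
  qed
  then obtain s where "\<forall>j. P j (s j) \<and> Q j (s j) (s (Suc j))" by blast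
  then show ?thesis by (intro exI[of _ s]) (auto simp: P_def Q_def)
qed

lemma chain_map_comp:
  assumes f: "chain_map C D C' D' f" and g: "chain_map C' D' C'' D'' g"
  shows "chain_map C D C'' D'' (\<lambda>j v. g j (f j v))"
  unfolding chain_map_def
proof (intro conjI allI ballI)
  show "lin (C j) (C'' j) (\<lambda>v. g j (f j v))" for j
    using f g by (auto simp: chain_map_def intro: lin_comp)
  show "D'' j (g (Suc j) (f (Suc j) v)) = g j (f j (D j v))" if "v \<in> C (Suc j)" for j v
    using f g that linD(1)[of "C (Suc j)" "C' (Suc j)" "f (Suc j)"] by (simp add: chain_map_def)
qed

lemma chain_map_minus_id:
  assumes C: "exact C D" and f: "chain_map C D C D f"
  shows "chain_map C D C D (\<lambda>j v. f j v - v)"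
  unfolding chain_map_def
proof (intro conjI allI ballI)
  show "lin (C j) (C j) (\<lambda>v. f j v - v)" for j
    using f by (auto simp: chain_map_def intro: lin_diff lin_id exactD(1)[OF C])
  show "D j (f (Suc j) v - v) = f j (D j v) - D j v" if "v \<in> C (Suc j)" for j v
    using f that linD(1)[of "C (Suc j)" "C (Suc j)" "f (Suc j)"]
    by (subst lin_simps(3)[OF exactD(2)[OF C] exactD(1)[OF C]]) (auto simp: chain_map_def)
qed

text \<open>The chain maps \<open>\<alpha>\<close>, \<open>\<beta>\<close> between an arbitrary resolution and a minimal one are mutually inverse
  homotopy equivalences; modulo the maximal ideal this computes the homology of the former.\<close>

lemma minimal_comparison:
  assumes C: "exact C D" and free: "\<And>j. C (Suc j) = fm (rk j)"
    and C': "exact C' D'" and free': "\<And>j. C' (Suc j) = fm (rk' j)" and eq: "C 0 = C' 0"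
    and min: "\<And>j v. v \<in> fm (rk' (Suc j)) \<Longrightarrow> D' (Suc j) v \<in> mm (rk' j)"
  obtains \<alpha> \<beta> where "\<And>i. lin (fm (rk i)) (fm (rk' i)) (\<alpha> i)" "\<And>i. lin (fm (rk' i)) (fm (rk i)) (\<beta> i)"
    "\<And>i v. v \<in> fm (rk (Suc i)) \<Longrightarrow> \<alpha> i (D (Suc i) v) \<in> mm (rk' i)"
    "\<And>i u. u \<in> fm (rk' (Suc i)) \<Longrightarrow> D (Suc i) (\<beta> (Suc i) u) \<in> mm (rk i)"
    "\<And>i u. u \<in> fm (rk' i) \<Longrightarrow> \<alpha> i (\<beta> i u) - u \<in> mm (rk' i)"
    "\<And>i v. v \<in> fm (rk i) \<Longrightarrow> (\<And>j. i = Suc j \<Longrightarrow> D i v \<in> mm (rk j)) \<Longrightarrow>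
      \<exists>w\<in>fm (rk (Suc i)). \<beta> i (\<alpha> i v) - v - D (Suc i) w \<in> mm (rk i)"
proof -
  obtain \<alpha> where \<alpha>0: "\<alpha> 0 = (\<lambda>v. v)" and \<alpha>: "chain_map C D C' D' \<alpha>"
    using comparison[OF C free C', of "\<lambda>v. v"] lin_id[of "C 0"] eq by auto
  obtain \<beta> where \<beta>0: "\<beta> 0 = (\<lambda>v. v)" and \<beta>: "chain_map C' D' C D \<beta>"
    using comparison[OF C' free' C, of "\<lambda>v. v"] lin_id[of "C 0"] eq by auto
  obtain s where s: "\<And>j. lin (C j) (C (Suc j)) (s j)" "s 0 = (\<lambda>v. 0)"
    "\<And>j v. v \<in> C (Suc j) \<Longrightarrow> \<beta> (Suc j) (\<alpha> (Suc j) v) - v = D (Suc j) (s (Suc j) v) + s j (D j v)"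
    using null_homotopy[OF C free chain_map_minus_id[OF C chain_map_comp[OF \<alpha> \<beta>]]] \<alpha>0 \<beta>0 by auto
  obtain s' where s': "\<And>j. lin (C' j) (C' (Suc j)) (s' j)" "s' 0 = (\<lambda>v. 0)"
    "\<And>j v. v \<in> C' (Suc j) \<Longrightarrow> \<alpha> (Suc j) (\<beta> (Suc j) v) - v = D' (Suc j) (s' (Suc j) v) + s' j (D' j v)"
    using null_homotopy[OF C' free' chain_map_minus_id[OF C' chain_map_comp[OF \<beta> \<alpha>]]] \<alpha>0 \<beta>0 by auto
  have l\<alpha>: "lin (fm (rk i)) (fm (rk' i)) (\<alpha> (Suc i))" for i
    using \<alpha> free free' by (metis chain_map_def)
  have l\<beta>: "lin (fm (rk' i)) (fm (rk i)) (\<beta> (Suc i))" for i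
    using \<beta> free free' by (metis chain_map_def)
  have c\<alpha>: "D' j (\<alpha> (Suc j) v) = \<alpha> j (D j v)" if "v \<in> fm (rk j)" for j v
    using \<alpha> free that by (simp add: chain_map_def)
  have c\<beta>: "D j (\<beta> (Suc j) v) = \<beta> j (D' j v)" if "v \<in> fm (rk' j)" for j v
    using \<beta> free' that by (simp add: chain_map_def)
  show ?thesis
  \<comment> \<open>The shift by one arises because degree 0 of the augmented complex is the
    resolved module itself.\<close>
  proof (rule that[of "\<lambda>i. \<alpha> (Suc i)" "\<lambda>i. \<beta> (Suc i)"])
    show "\<alpha> (Suc i) (D (Suc i) v) \<in> mm (rk' i)" if "v \<in> fm (rk (Suc i))" for i v
      using min[OF linD(1)[OF l\<alpha> that]] c\<alpha>[OF that] by simp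
    show "D (Suc i) (\<beta> (Suc (Suc i)) u) \<in> mm (rk i)" if "u \<in> fm (rk' (Suc i))" for i u
      using lin_mm[OF l\<beta> min[OF that]] c\<beta>[OF that] by simp
    show "\<alpha> (Suc i) (\<beta> (Suc i) u) - u \<in> mm (rk' i)" if u: "u \<in> fm (rk' i)" for i u
    proof -
      have uC: "u \<in> C' (Suc i)" using u free' by simp
      have "s' (Suc i) u \<in> fm (rk' (Suc i))" using linD(1)[OF s'(1) uC] free' by simp
      then have 1: "D' (Suc i) (s' (Suc i) u) \<in> mm (rk' i)" by (rule min)
      \<comment> \<open>In positive degrees minimality puts \<open>D' i u\<close> into
        \<open>mm\<close>, and linear maps preserve \<open>mm\<close>. In degree 0 the differential
        is the augmentation, about which minimality says nothing; there the homotopy vanishes by its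
        normalization.\<close>
      have 2: "s' i (D' i u) \<in> mm (rk' i)"
      proof (cases i)
        case 0 then show ?thesis using s'(2) submodD(1)[OF submod_mm] by simp
      next
        case (Suc j)
        then have "D' i u \<in> mm (rk' j)" using min u by simp
        then show ?thesis using lin_mm[of "rk' j" "rk' i" "s' i"] s'(1)[of i] free' Suc by simp
      qed
      show ?thesis unfolding s'(3)[OF uC] using 1 2 by (rule submodD(2)[OF submod_mm])
    qed
    \<comment> \<open>On this side no minimality is available, so the boundary term of the homotopy
      survives as \<open>w\<close>; the other term is absorbed by the assumption that
      \<open>v\<close> is a cycle modulo \<open>mm\<close>.\<close>
    show "\<exists>w\<in>fm (rk (Suc i)). \<beta> (Suc i) (\<alpha> (Suc i) v) - v - D (Suc i) w \<in> mm (rk i)"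
      if v: "v \<in> fm (rk i)" and Dv: "\<And>j. i = Suc j \<Longrightarrow> D i v \<in> mm (rk j)" for i v
    proof
      have vC: "v \<in> C (Suc i)" using v free by simp
      show "s (Suc i) v \<in> fm (rk (Suc i))" using linD(1)[OF s(1) vC] free by simp
      have "s i (D i v) \<in> mm (rk i)"
      proof (cases i)
        case 0 then show ?thesis using s(2) submodD(1)[OF submod_mm] by simp
      next
        case (Suc j)
        then show ?thesis using lin_mm[of "rk j" "rk i" "s i"] s(1)[of i] free Dv[OF Suc] by simp
      qed
      then show "\<beta> (Suc i) (\<alpha> (Suc i) v) - v - D (Suc i) (s (Suc i) v) \<in> mm (rk i)"
        unfolding s(3)[OF vC] by simp
    qed
  qed (rule l\<alpha> l\<beta>)+
qed

text \<open>The resolved ideal is placed in degree 0 as a submodule of the free module of rank 1.\<close>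

definition level :: "('v, 'k) mpoly set \<Rightarrow> (nat \<Rightarrow> nat) \<Rightarrow> nat \<Rightarrow> (nat \<Rightarrow> ('v, 'k) mpoly) set" where
  "level L rk j = (case j of 0 \<Rightarrow> {v \<in> fm 1. v 0 \<in> L} | Suc i \<Rightarrow> fm (rk i))"

definition bdry :: "(nat \<Rightarrow> (nat \<Rightarrow> ('v, 'k) mpoly) \<Rightarrow> nat \<Rightarrow> ('v, 'k) mpoly) \<Rightarrow>
    ((nat \<Rightarrow> ('v, 'k) mpoly) \<Rightarrow> ('v, 'k) mpoly) \<Rightarrow> nat \<Rightarrow> (nat \<Rightarrow> ('v, 'k) mpoly) \<Rightarrow> nat \<Rightarrow> ('v, 'k) mpoly" where
  "bdry d e j = (case j of 0 \<Rightarrow> (\<lambda>v. smul (e v) (unit 0)) | Suc i \<Rightarrow> d i)"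

lemma level_Suc [simp]: "level L rk (Suc i) = fm (rk i)" and bdry_Suc [simp]: "bdry d e (Suc i) = d i"
  by (simp_all add: level_def bdry_def)

lemma carrier_free_module: "carrier (free_module R n) = fm n"
  by (auto simp: free_module_def fm_def) (metis not_le polys_zero)

lemma free_module_simps:
  "u \<oplus>\<^bsub>free_module R n\<^esub> v = u + v" "\<zero>\<^bsub>free_module R n\<^esub> = 0" "r \<odot>\<^bsub>free_module R n\<^esub> v = smul r v"
  by (auto simp: free_module_def smul_def fun_eq_iff)

lemma module_hom_free_iff: "f \<in> module_hom R (free_module R n) (free_module R m) \<longleftrightarrow> lin (fm n) (fm m) f"
  by (auto simp: module_hom_def lin_def carrier_free_module free_module_simps)

lemma ideal_polys: "ideal L R \<Longrightarrow> p \<in> L \<Longrightarrow> p \<in> polys V"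
  using ideal.Icarr[of L R p] by simp

lemma smul_unit_0: "smul p (unit 0) \<in> fm (Suc 0) \<longleftrightarrow> p \<in> polys V" "smul p (unit 0) 0 = p"
  by (auto simp: fm_def smul_def unit_def)

lemma level_0_iff: "ideal L R \<Longrightarrow> v \<in> level L rk 0 \<longleftrightarrow> (\<exists>p\<in>L. v = smul p (unit 0))"
proof
  assume "ideal L R" "v \<in> level L rk 0"
  then show "\<exists>p\<in>L. v = smul p (unit 0)"
    by (intro bexI[of _ "v 0"]) (auto simp: level_def fm_def smul_def unit_def fun_eq_iff)
qed (auto simp: level_def smul_unit_0 ideal_polys)

lemma module_hom_ideal_iff:
  assumes "ideal L R"
  shows "e \<in> module_hom R (free_module R n) (ideal_module R L) \<longleftrightarrow>
    lin (fm n) (level L rk 0) (\<lambda>v. smul (e v) (unit 0))"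
proof -
  have *: "smul p (unit 0) = smul q (unit 0) \<longleftrightarrow> p = q" for p q :: "('v, 'k) mpoly"
    by (metis smul_unit_0(2))
  have "smul p (unit 0) \<in> level L rk 0 \<longleftrightarrow> p \<in> L" for p
    using assms * by (auto simp: level_0_iff)
  moreover have "smul (p + q) (unit 0) = smul p (unit 0) + smul q (unit 0)" for p q :: "('v, 'k) mpoly"
    by (auto simp: smul_def fun_eq_iff distrib_right)
  ultimately show ?thesis
    by (simp add: module_hom_def lin_def carrier_free_module free_module_simps ideal_module_def
        Pi_iff * smul_smul flip: \<open>\<And>q p. smul (p + q) (unit 0) = smul p (unit 0) + smul q (unit 0)\<close>)
qed

lemma submod_level:
  assumes "ideal L R"
  shows "submod (level L rk j)"
proof (cases j)
  case 0
  interpret ideal L R by fact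
  have "0 \<in> L" "\<And>p q. p \<in> L \<Longrightarrow> q \<in> L \<Longrightarrow> p + q \<in> L" "\<And>r p. r \<in> polys V \<Longrightarrow> p \<in> L \<Longrightarrow> r * p \<in> L"
    using additive_subgroup.zero_closed[OF additive_subgroup_axioms]
      additive_subgroup.a_closed[OF additive_subgroup_axioms] I_l_closed by simp_all
  then show ?thesis
    unfolding 0 submod_def level_def using submodD[OF submod_fm] by (auto simp: smul_def)
qed (simp add: submod_fm)

text \<open>The injection of polynomials as multiples of \<open>unit 0\<close> turns the
  polynomial-valued augmentation into a map of vectors without changing its kernel, and identifies
  its image with degree 0. All degrees then have one type, as the comparison argument needs.\<close>

lemma free_resolution_iff_exact:
  assumes L: "ideal L R"
  shows "free_resolution R (ideal_module R L) rk d e \<longleftrightarrow> exact (level L rk) (bdry d e)"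
proof -
  have *: "smul p (unit 0) = smul q (unit 0) \<longleftrightarrow> p = q" for p q :: "('v, 'k) mpoly"
    by (metis smul_unit_0(2))
  have img: "e ` fm (rk 0) = L \<longleftrightarrow> bdry d e 0 ` fm (rk 0) = level L rk 0"
  proof -
    have "bdry d e 0 ` fm (rk 0) = (\<lambda>p. smul p (unit 0)) ` e ` fm (rk 0)"
      by (auto simp: bdry_def)
    moreover have "level L rk 0 = (\<lambda>p. smul p (unit 0)) ` L"
      using level_0_iff[OF L] by auto
    moreover have "inj (\<lambda>p :: ('v, 'k) mpoly. smul p (unit 0))" using * by (auto intro: injI)
    ultimately show ?thesis by (simp add: inj_image_eq_iff)
  qed
  have ker0: "a_kernel (free_module R (rk 0)) (ideal_module R L) e
      = {v \<in> fm (rk 0). bdry d e 0 v = 0}"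
    using *[of _ 0] by (auto simp: a_kernel_def kernel_def carrier_free_module ideal_module_def bdry_def)
  have kerS: "a_kernel (free_module R (rk (Suc j))) (free_module R (rk j)) (d j)
      = {v \<in> fm (rk (Suc j)). d j v = 0}" for j
    by (auto simp: a_kernel_def kernel_def carrier_free_module free_module_simps)
  have all_nat: "(\<forall>j. Z j) \<longleftrightarrow> Z 0 \<and> (\<forall>j. Z (Suc j))" for Z :: "nat \<Rightarrow> bool"
    by (metis not0_implies_Suc)
  have car: "carrier (ideal_module R L) = L" by (simp add: ideal_module_def)
  have b0: "bdry d e 0 = (\<lambda>v. smul (e v) (unit 0))" by (simp add: bdry_def)
  have lins: "(\<forall>j. lin (level L rk (Suc j)) (level L rk j) (bdry d e j)) \<longleftrightarrow>
      e \<in> module_hom R (free_module R (rk 0)) (ideal_module R L) \<and>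
      (\<forall>j. d j \<in> module_hom R (free_module R (rk (Suc j))) (free_module R (rk j)))"
    by (subst all_nat) (simp only: module_hom_ideal_iff[OF L, where rk = rk] module_hom_free_iff b0 level_Suc bdry_Suc)
  have kers: "(\<forall>j. bdry d e (Suc j) ` level L rk (Suc (Suc j)) = {v \<in> level L rk (Suc j). bdry d e j v = 0}) \<longleftrightarrow>
      d 0 ` fm (rk (Suc 0)) = {v \<in> fm (rk 0). bdry d e 0 v = 0} \<and>
      (\<forall>j. d (Suc j) ` fm (rk (Suc (Suc j))) = {v \<in> fm (rk (Suc j)). d j v = 0})"
    by (subst all_nat) (simp only: level_Suc bdry_Suc)
  show ?thesis
    unfolding free_resolution_def exact_def Let_def lins kers
    unfolding carrier_free_module car img ker0 kerS One_nat_def bdry_Suc level_Suc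
    by (intro iffI; elim conjE; intro conjI allI submod_level[OF L]; (assumption | erule spec))
qed

end

section \<open>Betti numbers from minimal resolutions\<close>

definition kn :: "nat \<Rightarrow> (nat \<Rightarrow> 'k::field) set" where
  "kn n = {a. \<forall>i\<ge>n. a i = 0}"

interpretation fun_vs: vector_space "smul :: 'k::field \<Rightarrow> (nat \<Rightarrow> 'k) \<Rightarrow> nat \<Rightarrow> 'k"
  by unfold_locales (auto simp: smul_def fun_eq_iff algebra_simps)

lemma kn_expand: "v \<in> kn n \<Longrightarrow> v = (\<Sum>i<n. smul (v i) (unit i))"
  by (rule ext) (auto simp: sum_fun_apply smul_def unit_def kn_def if_distrib[of "\<lambda>x. _ * x"] cong: if_cong)

text \<open>Unique coordinates make \<open>a\<close> an injective enumeration of a basis. As the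
  left-hand side does not mention \<open>m\<close>, any two systems with unique coordinates have the
  same length, which is what the description operator in \<open>vdim\<close> demands.\<close>

lemma dim_kn_of_coordinates:
  fixes a :: "nat \<Rightarrow> nat \<Rightarrow> 'k::field"
  assumes a: "\<And>i. i < m \<Longrightarrow> a i \<in> kn n"
    and uniq: "\<And>v. v \<in> kn n \<Longrightarrow> \<exists>!c. c \<in> {..<m} \<rightarrow>\<^sub>E (UNIV :: 'k set) \<and> v = (\<Sum>i<m. smul (c i) (a i))"
  shows "fun_vs.dim (kn n :: (nat \<Rightarrow> 'k) set) = m"
proof -
  have uniqD: "c i = d i"
    if "(\<Sum>i<m. smul (c i) (a i)) \<in> kn n" "(\<Sum>i<m. smul (c i) (a i)) = (\<Sum>i<m. smul (d i) (a i))" "i < m" for c d i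
  proof -
    \<comment> \<open>Uniqueness is assumed among extensional coefficient functions only, so both
      families are restricted to the index range first.\<close>
    have "(\<Sum>i<m. smul (c i) (a i)) = (\<Sum>i<m. smul (restrict c {..<m} i) (a i))"
      "(\<Sum>i<m. smul (c i) (a i)) = (\<Sum>i<m. smul (restrict d {..<m} i) (a i))"
      using that by simp_all
    moreover have "restrict c {..<m} \<in> {..<m} \<rightarrow>\<^sub>E UNIV" "restrict d {..<m} \<in> {..<m} \<rightarrow>\<^sub>E UNIV" by simp_all
    ultimately have "restrict c {..<m} = restrict d {..<m}" using uniq[OF that(1)] by blast
    then show ?thesis using that(3) by (metis lessThan_iff restrict_apply')
  qed
  \<comment> \<open>A vector listed twice would have two different coordinate expansions, each with
    a single coefficient 1.\<close>
  have inj: "inj_on a {..<m}"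
  proof (rule inj_onI)
    fix i j assume ij: "i \<in> {..<m}" "j \<in> {..<m}" "a i = a j"
    have 1: "(\<Sum>l<m. smul (if l = i then 1 else 0 :: 'k) (a l)) = a i" if "i < m" for i
      using that by (simp add: if_distrib[of "\<lambda>x. smul x _"] cong: if_cong)
    have "(if i = i then 1 else 0 :: 'k) = (if i = j then 1 else 0)"
      by (rule uniqD[of "\<lambda>l. if l = i then 1 else 0" "\<lambda>l. if l = j then 1 else 0"])
        (use ij 1[of i] 1[of j] a[of i] in auto)
    then show "i = j" by (auto split: if_splits)
  qed
  have sub: "fun_vs.subspace (kn n :: (nat \<Rightarrow> 'k) set)"
    by (auto simp: fun_vs.subspace_def kn_def smul_def)
  have "fun_vs.span (a ` {..<m}) = kn n"
  proof
    show "fun_vs.span (a ` {..<m}) \<subseteq> kn n" using a by (intro fun_vs.span_minimal sub) auto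
    show "kn n \<subseteq> fun_vs.span (a ` {..<m})"
    proof
      fix v :: "nat \<Rightarrow> 'k" assume "v \<in> kn n"
      then obtain c where "v = (\<Sum>i<m. smul (c i) (a i))" using uniq by blast
      then show "v \<in> fun_vs.span (a ` {..<m})"
        by (simp only:) (intro fun_vs.span_sum fun_vs.span_scale fun_vs.span_base imageI)
    qed
  qed
  moreover have "fun_vs.independent (a ` {..<m})"
  proof (rule fun_vs.independent_if_scalars_zero)
    fix f x assume f: "(\<Sum>x\<in>a ` {..<m}. smul (f x) x) = 0" "x \<in> a ` {..<m}"
    then obtain i where i: "i < m" "x = a i" by auto
    have "(\<Sum>i<m. smul (f (a i)) (a i)) = 0" using f(1) by (simp add: sum.reindex[OF inj])
    moreover have "(\<Sum>i<m. smul (0 :: 'k) (a i)) = 0" by simp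
    ultimately have "f (a i) = 0"
      using i(1) fun_vs.subspace_0[OF sub] by (intro uniqD[of "\<lambda>i. f (a i)" "\<lambda>i. 0"]) simp_all
    then show "f x = 0" using i by simp
  qed simp
  ultimately have "fun_vs.dim (kn n :: (nat \<Rightarrow> 'k) set) = card (a ` {..<m})"
    using fun_vs.span_eq_iff[THEN iffD2, OF sub] by (intro fun_vs.dim_eq_card) (simp_all only: not_False_eq_True)
  then show ?thesis by (simp add: card_image[OF inj])
qed

text \<open>Only the values of the operations of \<open>T\<close> along \<open>\<Phi>\<close> are
  known, so \<open>T\<close> is compared with \<open>kn n\<close>: a basis of \<open>T\<close> of
  any length \<open>m\<close> pulls back to one of \<open>kn n\<close>, and the unit vectors give
  one of length \<open>n\<close>.\<close>

lemma vdim_eqI: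
  fixes T :: "(('v, 'k::field) mpoly, 'b, 'p) module_scheme" and \<Phi> :: "(nat \<Rightarrow> 'k) \<Rightarrow> 'b"
  assumes bij: "bij_betw \<Phi> (kn n) (carrier T)"
    and add: "\<And>a b. a \<in> kn n \<Longrightarrow> b \<in> kn n \<Longrightarrow> \<Phi> a \<oplus>\<^bsub>T\<^esub> \<Phi> b = \<Phi> (a + b)"
    and zero: "\<zero>\<^bsub>T\<^esub> = \<Phi> 0"
    and smult: "\<And>a c. a \<in> kn n \<Longrightarrow> const c \<odot>\<^bsub>T\<^esub> \<Phi> a = \<Phi> (smul c a)"
  shows "vdim T = n"
proof -
  have kn: "(0 :: nat \<Rightarrow> 'k) \<in> kn n" "\<And>a b :: nat \<Rightarrow> 'k. a \<in> kn n \<Longrightarrow> b \<in> kn n \<Longrightarrow> a + b \<in> kn n"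
    "\<And>(a :: nat \<Rightarrow> 'k) c. a \<in> kn n \<Longrightarrow> smul c a \<in> kn n"
    by (auto simp: kn_def smul_def)
  have car: "carrier T = \<Phi> ` kn n" using bij by (simp add: bij_betw_def)
  \<comment> \<open>The monoid laws are transported along \<open>\<Phi>\<close>; finite sums in
    \<open>T\<close> cannot be manipulated without them.\<close>
  interpret T: abelian_monoid T
    by (rule abelian_monoidI) (auto simp: car zero add kn add_ac)
  have finsum: "(\<Oplus>\<^bsub>T\<^esub>i\<in>{..<m}. const (c i) \<odot>\<^bsub>T\<^esub> b i) = \<Phi> (\<Sum>i<m. smul (c i) (a i))
      \<and> (\<Sum>i<m. smul (c i) (a i)) \<in> kn n"
    if "\<And>i. i < m \<Longrightarrow> a i \<in> kn n \<and> b i = \<Phi> (a i)" for m :: nat and a b c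
    using that
  proof (induction m)
    case 0 then show ?case by (simp add: zero kn flip: zero_fun_def)
  next
    case (Suc m)
    have *: "const (c i) \<odot>\<^bsub>T\<^esub> b i \<in> carrier T" if "i < Suc m" for i
      using Suc.prems[OF that] by (auto simp: smult car intro!: imageI kn)
    have "(\<Oplus>\<^bsub>T\<^esub>i\<in>{..<Suc m}. const (c i) \<odot>\<^bsub>T\<^esub> b i)
        = const (c m) \<odot>\<^bsub>T\<^esub> b m \<oplus>\<^bsub>T\<^esub> (\<Oplus>\<^bsub>T\<^esub>i\<in>{..<m}. const (c i) \<odot>\<^bsub>T\<^esub> b i)"
      unfolding lessThan_Suc using * by (intro T.finsum_insert) auto
    also have "const (c m) \<odot>\<^bsub>T\<^esub> b m = \<Phi> (smul (c m) (a m))" using Suc.prems[of m] by (simp add: smult)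
    finally have eq: "(\<Oplus>\<^bsub>T\<^esub>i\<in>{..<Suc m}. const (c i) \<odot>\<^bsub>T\<^esub> b i)
        = \<Phi> (smul (c m) (a m)) \<oplus>\<^bsub>T\<^esub> (\<Oplus>\<^bsub>T\<^esub>i\<in>{..<m}. const (c i) \<odot>\<^bsub>T\<^esub> b i)" .
    have s: "(\<Sum>i<Suc m. smul (c i) (a i)) = smul (c m) (a m) + (\<Sum>i<m. smul (c i) (a i))"
      by (simp only: sum.lessThan_Suc add.commute)
    have IH: "(\<Oplus>\<^bsub>T\<^esub>i\<in>{..<m}. const (c i) \<odot>\<^bsub>T\<^esub> b i) = \<Phi> (\<Sum>i<m. smul (c i) (a i))"
      "(\<Sum>i<m. smul (c i) (a i)) \<in> kn n" using Suc.IH Suc.prems by auto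
    have am: "smul (c m) (a m) \<in> kn n" using Suc.prems[of m] kn(3) by simp
    show ?case unfolding eq s IH(1) using add[OF am IH(2)] kn(2)[OF am IH(2)] by (rule conjI)
  qed
  define P where "P m \<longleftrightarrow> (\<exists>b \<in> {..<m} \<rightarrow> carrier T. \<forall>v\<in>carrier T.
     \<exists>!c. c \<in> {..<m} \<rightarrow>\<^sub>E (UNIV :: 'k set) \<and>
          v = (\<Oplus>\<^bsub>T\<^esub>i\<in>{..<m}. const (c i) \<odot>\<^bsub>T\<^esub> b i))" for m :: nat
  have inj: "\<Phi> u = \<Phi> v \<longleftrightarrow> u = v" if "u \<in> kn n" "v \<in> kn n" for u v
    using bij that by (auto simp: bij_betw_def inj_on_def)
  have P_dim: "fun_vs.dim (kn n :: (nat \<Rightarrow> 'k) set) = m" if "P m" for m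
  proof -
    obtain b where b: "b \<in> {..<m} \<rightarrow> carrier T"
      "\<forall>v\<in>carrier T. \<exists>!c. c \<in> {..<m} \<rightarrow>\<^sub>E (UNIV :: 'k set) \<and>
          v = (\<Oplus>\<^bsub>T\<^esub>i\<in>{..<m}. const (c i) \<odot>\<^bsub>T\<^esub> b i)"
      using \<open>P m\<close> unfolding P_def by (elim bexE)
    have "\<forall>i\<in>{..<m}. \<exists>a. a \<in> kn n \<and> b i = \<Phi> a" using b(1) car by auto
    then obtain a where a: "\<And>i. i < m \<Longrightarrow> a i \<in> kn n \<and> b i = \<Phi> (a i)" by (metis bchoice lessThan_iff)
    have fs: "(\<Oplus>\<^bsub>T\<^esub>i\<in>{..<m}. const (c i) \<odot>\<^bsub>T\<^esub> b i) = \<Phi> (\<Sum>i<m. smul (c i) (a i))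
      \<and> (\<Sum>i<m. smul (c i) (a i)) \<in> kn n" for c
      by (rule finsum[OF a])
    show ?thesis
    proof (rule dim_kn_of_coordinates[of m a])
      fix v :: "nat \<Rightarrow> 'k" assume v: "v \<in> kn n"
      then have \<Phi>v: "\<Phi> v \<in> carrier T" using car by simp
      have eq: "\<Phi> v = (\<Oplus>\<^bsub>T\<^esub>i\<in>{..<m}. const (c i) \<odot>\<^bsub>T\<^esub> b i) \<longleftrightarrow> v = (\<Sum>i<m. smul (c i) (a i))" for c
        using inj[OF v fs[THEN conjunct2], of c] fs[THEN conjunct1, of c] by simp
      show "\<exists>!c. c \<in> {..<m} \<rightarrow>\<^sub>E (UNIV :: 'k set) \<and> v = (\<Sum>i<m. smul (c i) (a i))"
        using bspec[OF b(2) \<Phi>v] by (simp only: eq)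
    qed (use a in auto)
  qed
  have "P n"
    unfolding P_def
  proof (intro bexI[of _ "\<lambda>i. \<Phi> (unit i)"] ballI)
    have u: "unit i \<in> (kn n :: (nat \<Rightarrow> 'k) set)" if "i < n" for i
      using that by (auto simp: kn_def unit_def)
    then show "(\<lambda>i. \<Phi> (unit i)) \<in> {..<n} \<rightarrow> carrier T" using car by auto
    fix X assume "X \<in> carrier T"
    then obtain v where v: "v \<in> kn n" "X = \<Phi> v" using car by auto
    have fs: "X = (\<Oplus>\<^bsub>T\<^esub>i\<in>{..<n}. const (c i) \<odot>\<^bsub>T\<^esub> \<Phi> (unit i)) \<longleftrightarrow> v = (\<Sum>i<n. smul (c i) (unit i))" for c
      using finsum[of n unit "\<lambda>i. \<Phi> (unit i)" c] u inj v by simp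
    show "\<exists>!c. c \<in> {..<n} \<rightarrow>\<^sub>E (UNIV :: 'k set) \<and> X = (\<Oplus>\<^bsub>T\<^esub>i\<in>{..<n}. const (c i) \<odot>\<^bsub>T\<^esub> \<Phi> (unit i))"
      unfolding fs
    proof (rule ex1I[of _ "restrict v {..<n}"])
      show "restrict v {..<n} \<in> {..<n} \<rightarrow>\<^sub>E UNIV \<and> v = (\<Sum>i<n. smul (restrict v {..<n} i) (unit i))"
        using kn_expand[OF v(1)] by simp
      fix c assume c: "c \<in> {..<n} \<rightarrow>\<^sub>E UNIV \<and> v = (\<Sum>i<n. smul (c i) (unit i))"
      have "v i = c i" if "i < n" for i
      proof -
        have "v i = (\<Sum>j<n. smul (c j) (unit j)) i" using c by simp
        also have "\<dots> = c i"
          using that by (simp add: sum_fun_apply smul_def unit_def if_distrib[of "\<lambda>x. _ * x"] cong: if_cong)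
        finally show ?thesis .
      qed
      then show "c = restrict v {..<n}" using c by (auto simp: fun_eq_iff restrict_def PiE_def extensional_def)
    qed
  qed
  show ?thesis
    unfolding vdim_def P_def[symmetric]
    by (rule the_equality) (use \<open>P n\<close> P_dim in auto)
qed

subsection \<open>Tensoring a free module with the residue field\<close>

context polynomial_modules
begin

abbreviation "k \<equiv> residue_module K"

abbreviation "TR n \<equiv> tensor_relations R k (free_module R n)"
abbreviation "FA n \<equiv> free_Abelian_group ((UNIV :: 'k set) \<times> fm n)"

text \<open>The generators of the tensor relations for \<open>k \<otimes> F\<close> with
  \<open>F\<close> free: a polynomial acts on \<open>k\<close> through its constant
  coefficient.\<close>

definition Rel :: "nat \<Rightarrow> (('k \<times> (nat \<Rightarrow> ('v, 'k) mpoly)) \<Rightarrow>\<^sub>0 int) set" where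
  "Rel n = {frag_of (a + a', v) - frag_of (a, v) - frag_of (a', v) | a a' v. v \<in> fm n} \<union>
     {frag_of (a, v + v') - frag_of (a, v) - frag_of (a, v') | a v v'. v \<in> fm n \<and> v' \<in> fm n} \<union>
     {frag_of (lookup r 0 * a, v) - frag_of (a, smul r v) | r a v. r \<in> polys V \<and> v \<in> fm n}"

lemma TR_eq: "TR n = generate (FA n) (Rel n)"
  by (simp add: tensor_relations_def Rel_def carrier_free_module free_module_simps residue_module_def)

lemma RelI:
  "v \<in> fm n \<Longrightarrow> frag_of (a + a', v) - frag_of (a, v) - frag_of (a', v) \<in> Rel n"
  "v \<in> fm n \<Longrightarrow> v' \<in> fm n \<Longrightarrow> frag_of (a, v + v') - frag_of (a, v) - frag_of (a, v') \<in> Rel n"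
  "r \<in> polys V \<Longrightarrow> v \<in> fm n \<Longrightarrow> frag_of (lookup r 0 * a, v) - frag_of (a, smul r v) \<in> Rel n"
  unfolding Rel_def by blast+

lemma RelE:
  assumes "c \<in> Rel n"
  obtains a a' v where "v \<in> fm n" "c = frag_of (a + a', v) - frag_of (a, v) - frag_of (a', v)"
  | a v v' where "v \<in> fm n" "v' \<in> fm n" "c = frag_of (a, v + v') - frag_of (a, v) - frag_of (a, v')"
  | r a v where "r \<in> polys V" "v \<in> fm n" "c = frag_of (lookup r 0 * a, v) - frag_of (a, smul r v)"
  using assms unfolding Rel_def by blast

lemma keys_diff_subset: "keys a \<subseteq> S \<Longrightarrow> keys b \<subseteq> S \<Longrightarrow> keys (a - b) \<subseteq> S" for a b :: "'x \<Rightarrow>\<^sub>0 int"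
  using keys_diff[of a b] by blast

lemma Rel_keys: "c \<in> Rel n \<Longrightarrow> keys c \<subseteq> UNIV \<times> fm n"
  by (erule RelE; simp only:; intro keys_diff_subset) (auto simp: submodD[OF submod_fm])

lemma TR_Rel: "c \<in> Rel n \<Longrightarrow> c \<in> TR n"
  unfolding TR_eq by (rule generate.incl)

lemma TR_zero: "0 \<in> TR n"
  unfolding TR_eq using generate.one[of "FA n" "Rel n"] by simp

lemma TR_add: "a \<in> TR n \<Longrightarrow> b \<in> TR n \<Longrightarrow> a + b \<in> TR n"
  unfolding TR_eq using generate.eng[of a "FA n" "Rel n" b] by simp

lemma TR_induct [consumes 1, case_names zero rel uminus add]:
  assumes "c \<in> TR n" "P 0" "\<And>c. c \<in> Rel n \<Longrightarrow> P c" "\<And>c. c \<in> Rel n \<Longrightarrow> P (- c)"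
    "\<And>a b. a \<in> TR n \<Longrightarrow> b \<in> TR n \<Longrightarrow> P a \<Longrightarrow> P b \<Longrightarrow> P (a + b)"
  shows "P c"
  using assms(1) unfolding TR_eq
proof (induction rule: generate.induct)
  case (eng a b)
  then show ?case using assms(5) by (simp add: TR_eq)
qed (simp_all add: assms Rel_keys)

lemma TR_uminus: "c \<in> TR n \<Longrightarrow> - c \<in> TR n"
proof (induction rule: TR_induct)
  case (rel c)
  then show ?case unfolding TR_eq using generate.inv[of c "Rel n" "FA n"] Rel_keys[OF rel] by simp
next
  case (add a b)
  then show ?case using TR_add[of "- a" n "- b"] by simp
qed (simp_all add: TR_zero TR_Rel)

lemma TR_diff: "a \<in> TR n \<Longrightarrow> b \<in> TR n \<Longrightarrow> a - b \<in> TR n"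
  using TR_add[of a n "- b"] TR_uminus[of b n] by simp

lemma TR_map:
  assumes "\<And>c. c \<in> Rel n \<Longrightarrow> frag_extend g c \<in> TR m" "c \<in> TR n"
  shows "frag_extend g c \<in> TR m"
  using assms(2)
  by (induction rule: TR_induct) (simp_all add: TR_zero assms(1) frag_extend_minus TR_uminus frag_extend_add TR_add)

lemma frag_one_add:
  assumes "u \<in> fm n" "v \<in> fm n"
  shows "frag_of (a, u + v) - (frag_of (a, u) + frag_of (a, v)) \<in> TR n"
  using TR_Rel[OF RelI(2)[OF assms, of a]] by (simp add: diff_diff_add)

lemma frag_zero_right: "frag_of (a, 0) \<in> TR n"
  using TR_uminus[OF frag_one_add[of 0 n 0 a]] submodD(1)[OF submod_fm, of n] by simp

lemma frag_zero_left: "v \<in> fm n \<Longrightarrow> frag_of (0, v) \<in> TR n"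
  using TR_uminus[OF TR_Rel[OF RelI(1)[of v n 0 0]]] by simp

lemma frag_one_diff:
  assumes "u \<in> fm n" "v \<in> fm n"
  shows "frag_of (a, u) - frag_of (a, v) - frag_of (a, u - v) \<in> TR n"
  using frag_one_add[OF submodD(5)[OF submod_fm assms] assms(2), of a] by (simp add: algebra_simps)

text \<open>Since \<open>a \<otimes> v = 1 \<otimes> a v\<close> for a scalar \<open>a\<close>, and
  tensors with first factor 1 add up, each element is a single tensor
  \<open>1 \<otimes> v\<close>.\<close>

lemma frag_normal_form:
  assumes "keys c \<subseteq> UNIV \<times> fm n"
  shows "\<exists>v\<in>fm n. c - frag_of (1, v) \<in> TR n"
  using assms
proof (induction rule: frag_induction)
  case zero
  show ?case
    using TR_diff[OF TR_zero frag_zero_right] submodD(1)[OF submod_fm] by (rule bexI)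
next
  case (one x)
  obtain a v where x: "x = (a, v)" "v \<in> fm n" using one by (cases x) auto
  have "frag_of (a, v) - frag_of (1, smul (const a) v) \<in> TR n"
    using TR_Rel[OF RelI(3)[OF polys_const[of a] x(2), of 1]] by (simp add: const_def)
  moreover have "smul (const a) v \<in> fm n" using x by (intro submodD(3)[OF submod_fm]) auto
  ultimately show ?case using x by blast
next
  case (diff a b)
  then obtain u v where u: "u \<in> fm n" "a - frag_of (1, u) \<in> TR n" and v: "v \<in> fm n" "b - frag_of (1, v) \<in> TR n"
    by blast
  have "(a - frag_of (1, u)) - (b - frag_of (1, v)) + (frag_of (1, u) - frag_of (1, v) - frag_of (1, u - v)) \<in> TR n"
    by (rule TR_add[OF TR_diff[OF u(2) v(2)] frag_one_diff[OF u(1) v(1)]])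
  then show ?case using submodD(5)[OF submod_fm u(1) v(1)] by (auto intro!: bexI[of _ "u - v"] simp: algebra_simps)
qed

lemma frag_one_sum:
  assumes "\<And>i. i \<in> S \<Longrightarrow> f i \<in> fm n \<and> frag_of (1, f i) \<in> TR n"
  shows "frag_of (1, sum f S) \<in> TR n"
  using assms
proof (induction S rule: infinite_finite_induct)
  case (insert i S)
  have s: "sum f S \<in> fm n" using insert by (intro submod_sum[OF submod_fm]) auto
  have "frag_of (1, f i + sum f S) - (frag_of (1, f i) + frag_of (1, sum f S)) \<in> TR n"
    using insert s by (intro frag_one_add) auto
  moreover have "frag_of (1, f i) + frag_of (1, sum f S) \<in> TR n" using insert by (intro TR_add) auto
  ultimately have "frag_of (1, f i + sum f S) - (frag_of (1, f i) + frag_of (1, sum f S))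
      + (frag_of (1, f i) + frag_of (1, sum f S)) \<in> TR n" by (rule TR_add)
  then have "frag_of (1, f i + sum f S) \<in> TR n" by simp
  then show ?case unfolding sum.insert[OF insert.hyps(1,2)] .
next
  case (infinite S)
  then show ?case unfolding sum.infinite[OF infinite.hyps] using frag_zero_right by blast
next
  case empty
  show ?case unfolding sum.empty by (rule frag_zero_right)
qed

text \<open>A coordinate \<open>p\<close> without constant term gives
  \<open>1 \<otimes> p e = p(0) \<otimes> e = 0\<close> for every unit vector \<open>e\<close>; sum
  over the coordinates.\<close>

lemma frag_one_mm:
  assumes "v \<in> mm n"
  shows "frag_of (1, v) \<in> TR n"
proof -
  have v: "v \<in> fm n" by (rule mm_fm[OF assms])
  have "frag_of (1, \<Sum>i<n. smul (v i) (unit i)) \<in> TR n"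
  proof (rule frag_one_sum)
    fix i assume i: "i \<in> {..<n}"
    have p: "v i \<in> polys V" "lookup (v i) 0 = 0" using assms v by (auto simp: mm_def fm_def)
    have "frag_of (0, unit i) - (frag_of (0, unit i) - frag_of (1, smul (v i) (unit i))) \<in> TR n"
      using TR_diff[OF frag_zero_left[OF unit_fm, of i n] TR_Rel[OF RelI(3)[OF p(1) unit_fm, of i n 1]]] i p
      by simp
    then show "smul (v i) (unit i) \<in> fm n \<and> frag_of (1, smul (v i) (unit i)) \<in> TR n"
      using submodD(3)[OF submod_fm p(1) unit_fm] i by simp
  qed
  then show ?thesis using fm_expand[OF v] by simp
qed

text \<open>The additive map sending \<open>a \<otimes> v\<close> to \<open>a\<close> times the
  constant term of the \<open>i\<close>-th coordinate of \<open>v\<close>, written on the free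
  abelian group. It vanishes on the relations and so detects which tensors
  \<open>1 \<otimes> v\<close> are nonzero.\<close>

definition coord :: "nat \<Rightarrow> (('k \<times> (nat \<Rightarrow> ('v, 'k) mpoly)) \<Rightarrow>\<^sub>0 int) \<Rightarrow> 'k" where
  "coord i c = (\<Sum>x\<in>keys c. of_int (lookup c x) * (fst x * lookup (snd x i) 0))"

lemma coord_add: "coord i (a + b) = coord i a + coord i b"
  unfolding coord_def by (rule setsum_keys_plus_distrib) (auto simp: distrib_right)

lemma coord_zero: "coord i 0 = 0"
  by (simp add: coord_def)

lemma coord_uminus: "coord i (- a) = - coord i a"
  using coord_add[of i a "- a"] by (simp add: coord_zero eq_neg_iff_add_eq_0 add.commute)

lemma coord_diff: "coord i (a - b) = coord i a - coord i b"
  using coord_add[of i a "- b"] coord_uminus[of i b] by simp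

lemma coord_frag: "coord i (frag_of (a, v)) = a * lookup (v i) 0"
  by (simp add: coord_def)

lemma coord_Rel: "c \<in> Rel n \<Longrightarrow> coord i c = 0"
  by (erule RelE; simp only: coord_diff coord_frag)
    (simp_all add: smul_def lookup_mult_zero lookup_add distrib_left distrib_right mult_ac)

lemma coord_TR: "c \<in> TR n \<Longrightarrow> coord i c = 0"
proof (induction rule: TR_induct)
  case (rel c)
  then show ?case by (rule coord_Rel)
next
  case (uminus c)
  then show ?case using coord_Rel by (simp add: coord_uminus)
qed (simp_all add: coord_add coord_zero)

lemma frag_one_TR_iff: "v \<in> fm n \<Longrightarrow> frag_of (1, v) \<in> TR n \<longleftrightarrow> v \<in> mm n"
proof
  assume v: "v \<in> fm n" "frag_of (1, v) \<in> TR n"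
  then show "v \<in> mm n" using coord_TR[OF v(2)] by (auto simp: coord_frag mm_def)
qed (rule frag_one_mm)

definition coset :: "nat \<Rightarrow> (('k \<times> (nat \<Rightarrow> ('v, 'k) mpoly)) \<Rightarrow>\<^sub>0 int) \<Rightarrow>
    (('k \<times> (nat \<Rightarrow> ('v, 'k) mpoly)) \<Rightarrow>\<^sub>0 int) set" where
  "coset n c = (\<lambda>t. t + c) ` TR n"

lemma coset_eq_iff: "coset n c = coset n c' \<longleftrightarrow> c - c' \<in> TR n"
proof
  assume "coset n c = coset n c'"
  moreover have "c \<in> coset n c" using TR_zero by (auto simp: coset_def image_iff intro!: bexI[of _ 0])
  ultimately show "c - c' \<in> TR n" by (auto simp: coset_def)
next
  assume "c - c' \<in> TR n"
  then have "coset n x \<subseteq> coset n y" if "x - y \<in> TR n" for x y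
  proof -
    have "t + x = (t + (x - y)) + y" for t by simp
    then show ?thesis using TR_add[OF _ that] unfolding coset_def by blast
  qed
  moreover have "c' - c \<in> TR n" using TR_uminus[OF \<open>c - c' \<in> TR n\<close>] by simp
  ultimately show "coset n c = coset n c'" using \<open>c - c' \<in> TR n\<close> by blast
qed

lemma mem_coset: "x \<in> coset n c \<longleftrightarrow> x - c \<in> TR n"
  by (auto simp: coset_def image_iff intro!: bexI[of _ "x - c"])

abbreviation "T n \<equiv> tensor R k (free_module R n)"

text \<open>The class of \<open>1 \<otimes> v\<close>. By \<open>\<tau>_eq_iff\<close> it identifies
  \<open>k \<otimes> F\<close> with the free module modulo \<open>mm n\<close>, so that cosets of
  formal sums can be replaced by vectors.\<close>

definition \<tau> :: "nat \<Rightarrow> (nat \<Rightarrow> ('v, 'k) mpoly) \<Rightarrow> (('k \<times> (nat \<Rightarrow> ('v, 'k) mpoly)) \<Rightarrow>\<^sub>0 int) set" where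
  "\<tau> n v = coset n (frag_of (1, v))"

lemma pre_tensor_coset: "TR n +>\<^bsub>pre_tensor k (free_module R n)\<^esub> c = coset n c"
  by (auto simp: a_r_coset_def' pre_tensor_def coset_def)

lemma \<tau>_eq_iff:
  assumes "u \<in> fm n" "v \<in> fm n"
  shows "\<tau> n u = \<tau> n v \<longleftrightarrow> u - v \<in> mm n"
proof -
  have uv: "u - v \<in> fm n" by (rule submodD(5)[OF submod_fm assms])
  have "frag_of (1, u) - frag_of (1, v) \<in> TR n \<longleftrightarrow> frag_of (1, u - v) \<in> TR n"
    using TR_add[OF frag_one_diff[OF assms, of 1], of "frag_of (1, u - v)"]
      TR_diff[OF _ frag_one_diff[OF assms, of 1], of "frag_of (1, u) - frag_of (1, v)"] by auto
  then show ?thesis unfolding \<tau>_def coset_eq_iff using frag_one_TR_iff[OF uv] by simp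
qed

lemma T_carrier: "carrier (T n) = \<tau> n ` fm n"
proof -
  have "carrier (T n) = {coset n c | c. keys c \<subseteq> UNIV \<times> fm n}"
    unfolding tensor_def subquotient_def by (simp add: pre_tensor_coset)
      (simp add: pre_tensor_def carrier_free_module residue_module_def)
  also have "\<dots> = \<tau> n ` fm n"
  proof (intro subset_antisym subsetI)
    fix X assume "X \<in> {coset n c | c. keys c \<subseteq> UNIV \<times> fm n}"
    then obtain c where c: "keys c \<subseteq> UNIV \<times> fm n" "X = coset n c" by auto
    then obtain v where v: "v \<in> fm n" "c - frag_of (1, v) \<in> TR n" using frag_normal_form by blast
    have "X = \<tau> n v" unfolding c(2) \<tau>_def coset_eq_iff by (rule v(2))
    then show "X \<in> \<tau> n ` fm n" using v(1) by auto
  next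
    fix X assume "X \<in> \<tau> n ` fm n"
    then obtain v where "v \<in> fm n" "X = coset n (frag_of (1, v))" by (auto simp: \<tau>_def)
    then show "X \<in> {coset n c | c. keys c \<subseteq> UNIV \<times> fm n}" by (intro CollectI exI[of _ "frag_of (1, v)"]) auto
  qed
  finally show ?thesis .
qed

lemma T_zero: "\<zero>\<^bsub>T n\<^esub> = \<tau> n 0"
proof -
  have "\<zero>\<^bsub>T n\<^esub> = coset n 0" by (simp add: tensor_def subquotient_def coset_def)
  also have "\<dots> = \<tau> n 0" unfolding \<tau>_def coset_eq_iff using TR_uminus[OF frag_zero_right] by simp
  finally show ?thesis .
qed

lemma T_add:
  assumes "u \<in> fm n" "v \<in> fm n"
  shows "\<tau> n u \<oplus>\<^bsub>T n\<^esub> \<tau> n v = \<tau> n (u + v)"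
proof -
  have "\<tau> n u \<oplus>\<^bsub>T n\<^esub> \<tau> n v = {x + y | x y. x \<in> \<tau> n u \<and> y \<in> \<tau> n v}"
    by (auto simp: tensor_def subquotient_def set_add_def' pre_tensor_def)
  also have "\<dots> = coset n (frag_of (1, u) + frag_of (1, v))"
  proof (intro subset_antisym subsetI)
    fix z assume "z \<in> {x + y | x y. x \<in> \<tau> n u \<and> y \<in> \<tau> n v}"
    then obtain x y where z: "z = x + y" "x - frag_of (1, u) \<in> TR n" "y - frag_of (1, v) \<in> TR n"
      by (auto simp: \<tau>_def mem_coset)
    show "z \<in> coset n (frag_of (1, u) + frag_of (1, v))"
      using TR_add[OF z(2,3)] by (simp add: z(1) mem_coset algebra_simps)
  next
    fix z assume "z \<in> coset n (frag_of (1, u) + frag_of (1, v))"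
    then have "z - frag_of (1, v) \<in> \<tau> n u" "frag_of (1, v) \<in> \<tau> n v"
      by (simp_all add: \<tau>_def mem_coset TR_zero diff_diff_add add.commute)
    then show "z \<in> {x + y | x y. x \<in> \<tau> n u \<and> y \<in> \<tau> n v}"
      by (intro CollectI exI[of _ "z - frag_of (1, v)"] exI[of _ "frag_of (1, v)"]) auto
  qed
  also have "\<dots> = \<tau> n (u + v)"
    unfolding \<tau>_def coset_eq_iff using TR_uminus[OF frag_one_add[OF assms, of 1]] by simp
  finally show ?thesis .
qed

text \<open>Scaling the first factor maps relations to relations, so all representatives give the
  same coset and the union defining the operation collapses; the balancing relation then moves the
  scalar to \<open>v\<close>.\<close>

lemma T_smult:
  assumes r: "r \<in> polys V" and v: "v \<in> fm n"
  shows "r \<odot>\<^bsub>T n\<^esub> \<tau> n v = \<tau> n (smul r v)"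
proof -
  define g where "g = frag_extend (\<lambda>(a, v). frag_of (lookup r 0 * a, v) :: ('k \<times> (nat \<Rightarrow> ('v, 'k) mpoly)) \<Rightarrow>\<^sub>0 int)"
  have g_TR: "g c \<in> TR n" if "c \<in> TR n" for c
    unfolding g_def
  proof (rule TR_map[OF _ that])
    fix c assume "c \<in> Rel n"
    then have "frag_extend (\<lambda>(a, v). frag_of (lookup r 0 * a, v)) c \<in> Rel n"
    proof (cases rule: RelE)
      case (1 a a' v)
      then show ?thesis using RelI(1)[of v n "lookup r 0 * a" "lookup r 0 * a'"]
        by (simp add: frag_extend_diff distrib_left)
    next
      case (2 a v v')
      then show ?thesis using RelI(2)[of v n v' "lookup r 0 * a"] by (simp add: frag_extend_diff)
    next
      case (3 s a v)
      then show ?thesis using RelI(3)[of s v n "lookup r 0 * a"]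
        by (simp add: frag_extend_diff mult.left_commute)
    qed
    then show "frag_extend (\<lambda>(a, v). frag_of (lookup r 0 * a, v)) c \<in> TR n" by (rule TR_Rel)
  qed
  have eq: "coset n (g x) = \<tau> n (smul r v)" if "x \<in> \<tau> n v" for x
  proof -
    have "g (x - frag_of (1, v)) \<in> TR n" using that by (intro g_TR) (simp add: \<tau>_def mem_coset)
    then have "g x - g (frag_of (1, v)) \<in> TR n" by (simp add: g_def frag_extend_diff)
    moreover have "g (frag_of (1, v)) - frag_of (1, smul r v) \<in> TR n"
      using TR_Rel[OF RelI(3)[OF r v, of 1]] by (simp add: g_def)
    ultimately have "g x - g (frag_of (1, v)) + (g (frag_of (1, v)) - frag_of (1, smul r v)) \<in> TR n"
      by (rule TR_add)
    then show ?thesis unfolding \<tau>_def coset_eq_iff by simp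
  qed
  have "r \<odot>\<^bsub>T n\<^esub> \<tau> n v = (\<Union>x\<in>\<tau> n v. coset n (g x))"
    unfolding tensor_def subquotient_def
    by (simp add: pre_tensor_coset) (simp add: pre_tensor_def g_def residue_module_def)
  also have "\<dots> = \<tau> n (smul r v)"
  proof -
    have "frag_of (1, v) \<in> \<tau> n v" by (simp add: \<tau>_def mem_coset TR_zero)
    then show ?thesis using eq by auto
  qed
  finally show ?thesis .
qed

lemma tensor_map_\<tau>:
  assumes f: "lin (fm n) (fm m) f" and v: "v \<in> fm n"
  shows "tensor_map R k (free_module R m) f (\<tau> n v) = \<tau> m (f v)"
proof -
  define g where "g = frag_extend (\<lambda>(a, v). frag_of (a, f v) :: ('k \<times> (nat \<Rightarrow> ('v, 'k) mpoly)) \<Rightarrow>\<^sub>0 int)"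
  have g: "g c \<in> TR m" if "c \<in> TR n" for c
    unfolding g_def
  proof (rule TR_map[OF _ that])
    fix c assume "c \<in> Rel n"
    then have "frag_extend (\<lambda>(a, v). frag_of (a, f v)) c \<in> Rel m"
    proof (cases rule: RelE)
      case (1 a a' v)
      then show ?thesis using RelI(1)[of "f v" m a a'] linD(1)[OF f] by (simp add: frag_extend_diff)
    next
      case (2 a v v')
      then show ?thesis using RelI(2)[of "f v" m "f v'" a] linD(1,2)[OF f] by (simp add: frag_extend_diff)
    next
      case (3 s a v)
      then show ?thesis using RelI(3)[of s "f v" m a] linD(1,3)[OF f] by (simp add: frag_extend_diff)
    qed
    then show "frag_extend (\<lambda>(a, v). frag_of (a, f v)) c \<in> TR m" by (rule TR_Rel)
  qed
  have eq: "coset m (g x) = \<tau> m (f v)" if "x \<in> \<tau> n v" for x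
  proof -
    have "g (x - frag_of (1, v)) \<in> TR m" using that by (intro g) (simp add: \<tau>_def mem_coset)
    then show ?thesis by (simp add: g_def frag_extend_diff \<tau>_def coset_eq_iff)
  qed
  have "tensor_map R k (free_module R m) f (\<tau> n v) = (\<Union>x\<in>\<tau> n v. coset m (g x))"
    unfolding tensor_map_def pre_tensor_coset g_def ..
  also have "\<dots> = \<tau> m (f v)"
  proof -
    have "frag_of (1, v) \<in> \<tau> n v" by (simp add: \<tau>_def mem_coset TR_zero)
    then show ?thesis using eq by auto
  qed
  finally show ?thesis .
qed

end

section \<open>Homology of the tensored complex in terms of vectors\<close>

context polynomial_modules
begin

text \<open>The homology class of \<open>1 \<otimes> v\<close>, where \<open>B\<close> is the
  preimage of the boundaries in the free module. Such a \<open>B\<close> contains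
  \<open>mm n\<close>, and two vectors have the same class exactly when they differ by an element of
  \<open>B\<close>.\<close>

definition \<theta> where "\<theta> n B v = (\<tau> n ` B) +>\<^bsub>T n\<^esub> \<tau> n v"

context
  fixes n :: nat and B :: "(nat \<Rightarrow> ('v, 'k) mpoly) set"
  assumes B: "submod B" "B \<subseteq> fm n" "mm n \<subseteq> B"
begin

lemma B_fm: "b \<in> B \<Longrightarrow> b \<in> fm n"
  using B by auto

lemma \<theta>_eq: "v \<in> fm n \<Longrightarrow> \<theta> n B v = (\<lambda>b. \<tau> n (b + v)) ` B"
  using B_fm by (auto simp: \<theta>_def a_r_coset_def' T_add)

lemma \<theta>_eq_iff:
  assumes "u \<in> fm n" "v \<in> fm n"
  shows "\<theta> n B u = \<theta> n B v \<longleftrightarrow> u - v \<in> B"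
proof
  assume eq: "\<theta> n B u = \<theta> n B v"
  have "\<tau> n (0 + u) \<in> \<theta> n B u" unfolding \<theta>_eq[OF assms(1)] using submodD(1)[OF B(1)] by (rule imageI)
  then have "\<tau> n u \<in> \<theta> n B v" using eq by simp
  then obtain b where b: "b \<in> B" "\<tau> n u = \<tau> n (b + v)" unfolding \<theta>_eq[OF assms(2)] by auto
  have "u - (b + v) \<in> B"
    using \<tau>_eq_iff[OF assms(1) submodD(2)[OF submod_fm B_fm[OF b(1)] assms(2)]] b B(3) by auto
  then have "u - (b + v) + b \<in> B" using b(1) by (intro submodD(2)[OF B(1)])
  then show "u - v \<in> B" by simp
next
  have sub: "\<theta> n B x \<subseteq> \<theta> n B y" if "x \<in> fm n" "y \<in> fm n" "x - y \<in> B" for x y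
  proof
    fix X assume "X \<in> \<theta> n B x"
    then have "X \<in> (\<lambda>b. \<tau> n (b + x)) ` B" using \<theta>_eq[OF that(1)] by simp
    then obtain b where b: "b \<in> B" "X = \<tau> n (b + x)" by auto
    have "X = \<tau> n (b + (x - y) + y)" using b by simp
    moreover have "b + (x - y) \<in> B" by (rule submodD(2)[OF B(1) b(1) that(3)])
    ultimately show "X \<in> \<theta> n B y" unfolding \<theta>_eq[OF that(2)] by blast
  qed
  assume "u - v \<in> B"
  moreover from this have "v - u \<in> B" using submodD(4)[OF B(1), of "u - v"] by simp
  ultimately show "\<theta> n B u = \<theta> n B v" using sub assms by blast
qed

lemma \<theta>_add:
  assumes "u \<in> fm n" "v \<in> fm n"
  shows "\<theta> n B u <+>\<^bsub>T n\<^esub> \<theta> n B v = \<theta> n B (u + v)"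
proof -
  have uv: "u + v \<in> fm n" by (rule submodD(2)[OF submod_fm assms])
  have eq: "\<tau> n (b + u) \<oplus>\<^bsub>T n\<^esub> \<tau> n (b' + v) = \<tau> n ((b + b') + (u + v))" if "b \<in> B" "b' \<in> B" for b b'
    using that assms by (subst T_add) (auto intro: submodD(2)[OF submod_fm] B_fm simp: add_ac)
  show ?thesis
    unfolding set_add_def' \<theta>_eq[OF assms(1)] \<theta>_eq[OF assms(2)] \<theta>_eq[OF uv]
  proof (intro subset_antisym subsetI)
    fix X assume "X \<in> (\<Union>h\<in>(\<lambda>b. \<tau> n (b + u)) ` B. \<Union>k\<in>(\<lambda>b. \<tau> n (b + v)) ` B. {h \<oplus>\<^bsub>T n\<^esub> k})"
    then obtain b b' where "b \<in> B" "b' \<in> B" "X = \<tau> n ((b + b') + (u + v))" using eq by auto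
    moreover have "b + b' \<in> B" by (rule submodD(2)[OF B(1)]) fact+
    ultimately show "X \<in> (\<lambda>b. \<tau> n (b + (u + v))) ` B" by blast
  next
    fix X assume "X \<in> (\<lambda>b. \<tau> n (b + (u + v))) ` B"
    then obtain b where b: "b \<in> B" "X = \<tau> n (b + (u + v))" by auto
    have z: "0 \<in> B" by (rule submodD(1)[OF B(1)])
    have "X = \<tau> n (b + u) \<oplus>\<^bsub>T n\<^esub> \<tau> n (0 + v)" using eq[OF b(1) z] b by simp
    then show "X \<in> (\<Union>h\<in>(\<lambda>b. \<tau> n (b + u)) ` B. \<Union>k\<in>(\<lambda>b. \<tau> n (b + v)) ` B. {h \<oplus>\<^bsub>T n\<^esub> k})"
      using b z by blast
  qed
qed

lemma \<theta>_zero: "\<theta> n B 0 = \<tau> n ` B"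
  unfolding \<theta>_eq[OF submodD(1)[OF submod_fm]] by simp

lemma \<theta>_smult:
  assumes r: "r \<in> polys V" and v: "v \<in> fm n"
  shows "(\<Union>X\<in>\<theta> n B v. \<tau> n ` B +>\<^bsub>T n\<^esub> (r \<odot>\<^bsub>T n\<^esub> X)) = \<theta> n B (smul r v)"
proof -
  have "\<tau> n ` B +>\<^bsub>T n\<^esub> (r \<odot>\<^bsub>T n\<^esub> X) = \<theta> n B (smul r v)" if "X \<in> \<theta> n B v" for X
  proof -
    from that obtain b where b: "b \<in> B" "X = \<tau> n (b + v)" unfolding \<theta>_eq[OF v] by auto
    have bv: "b + v \<in> fm n" by (rule submodD(2)[OF submod_fm B_fm[OF b(1)] v])
    have "\<tau> n ` B +>\<^bsub>T n\<^esub> (r \<odot>\<^bsub>T n\<^esub> X) = \<theta> n B (smul r (b + v))"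
      unfolding b(2) T_smult[OF r bv] \<theta>_def ..
    also have "\<dots> = \<theta> n B (smul r v)"
      using submodD(3)[OF B(1) r b(1)] submodD(3)[OF submod_fm r bv] submodD(3)[OF submod_fm r v]
      by (subst \<theta>_eq_iff) simp_all
    finally show ?thesis .
  qed
  moreover have "\<theta> n B v \<noteq> {}" unfolding \<theta>_eq[OF v] using submodD(1)[OF B(1)] by blast
  ultimately show ?thesis by auto
qed

end

definition const_vec :: "(nat \<Rightarrow> 'k) \<Rightarrow> nat \<Rightarrow> ('v, 'k) mpoly" where
  "const_vec c = (\<lambda>i. const (c i))"

lemma const_vec_fm: "c \<in> kn n \<Longrightarrow> const_vec c \<in> fm n"
  by (auto simp: const_vec_def fm_def kn_def) (simp add: const_def)

lemma const_vec_add: "const_vec (a + b) = const_vec a + const_vec b"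
  and const_vec_diff: "const_vec (a - b) = const_vec a - const_vec b"
  and const_vec_smul: "const_vec (smul s a) = smul (const s) (const_vec a)"
  and const_vec_zero: "const_vec 0 = 0"
  by (auto simp: const_vec_def const_def single_add single_diff smul_def mult_single fun_eq_iff)

lemma const_vec_mm: "const_vec c \<in> mm n \<Longrightarrow> c = 0"
  by (auto simp: const_vec_def mm_def const_def fun_eq_iff)

text \<open>Sending a constant vector \<open>c\<close> to the class of \<open>\<beta> c\<close>
  identifies \<open>kn (rk' i)\<close> with \<open>Tor\<close>. It is injective because
  \<open>\<alpha>\<close> takes boundaries into \<open>mm\<close> and
  \<open>\<alpha> \<circ> \<beta>\<close> is the identity modulo \<open>mm\<close>; it is surjective
  because \<open>\<beta> \<circ> \<alpha>\<close> is the identity on cycles up to boundaries and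
  \<open>mm\<close>.\<close>

lemma betti_eq_rank_of_minimal_resolution:
  assumes L: "ideal L R" and res': "free_resolution R (ideal_module R L) rk' d' e'"
    and min: "\<And>j v. v \<in> fm (rk' (Suc j)) \<Longrightarrow> d' j v \<in> mm (rk' j)"
  shows "betti K V L i = rk' i"
proof -
  obtain rk d e where sel: "(SOME (rk, d, e). free_resolution R (ideal_module R L) rk d e) = (rk, d, e)"
    by (metis surj_pair)
  \<comment> \<open>The given minimal resolution ensures that the choice in \<open>Tor\<close> does
    return a resolution, though possibly another one.\<close>
  have "\<exists>x. (case x of (rk, d, e) \<Rightarrow> free_resolution R (ideal_module R L) rk d e)"
    using res' by (intro exI[of _ "(rk', d', e')"]) simp
  from someI_ex[OF this] have res: "free_resolution R (ideal_module R L) rk d e"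
    unfolding sel by simp
  have ex: "exact (level L rk) (bdry d e)" and ex': "exact (level L rk') (bdry d' e')"
    using res res' by (simp_all add: free_resolution_iff_exact[OF L])
  have lv0: "level L rk 0 = level L rk' 0" by (simp add: level_def)
  obtain \<alpha> \<beta> where
    l\<alpha>: "\<And>i. lin (fm (rk i)) (fm (rk' i)) (\<alpha> i)" and l\<beta>: "\<And>i. lin (fm (rk' i)) (fm (rk i)) (\<beta> i)"
    and \<alpha>d: "\<And>i v. v \<in> fm (rk (Suc i)) \<Longrightarrow> \<alpha> i (d i v) \<in> mm (rk' i)"
    and d\<beta>: "\<And>i u. u \<in> fm (rk' (Suc i)) \<Longrightarrow> d i (\<beta> (Suc i) u) \<in> mm (rk i)"
    and \<alpha>\<beta>: "\<And>i u. u \<in> fm (rk' i) \<Longrightarrow> \<alpha> i (\<beta> i u) - u \<in> mm (rk' i)"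
    and \<beta>\<alpha>: "\<And>i v. v \<in> fm (rk i) \<Longrightarrow> (\<And>j. i = Suc j \<Longrightarrow> d j v \<in> mm (rk j)) \<Longrightarrow>
      \<exists>w\<in>fm (rk (Suc i)). \<beta> i (\<alpha> i v) - v - d i w \<in> mm (rk i)"
  proof (rule minimal_comparison[OF ex _ ex' _ lv0, of rk rk'])
    fix \<alpha> \<beta>
    assume "\<And>i. lin (fm (rk i)) (fm (rk' i)) (\<alpha> i)" "\<And>i. lin (fm (rk' i)) (fm (rk i)) (\<beta> i)"
      "\<And>i v. v \<in> fm (rk (Suc i)) \<Longrightarrow> \<alpha> i (bdry d e (Suc i) v) \<in> mm (rk' i)"
      "\<And>i u. u \<in> fm (rk' (Suc i)) \<Longrightarrow> bdry d e (Suc i) (\<beta> (Suc i) u) \<in> mm (rk i)"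
      "\<And>i u. u \<in> fm (rk' i) \<Longrightarrow> \<alpha> i (\<beta> i u) - u \<in> mm (rk' i)"
      "\<And>i v. v \<in> fm (rk i) \<Longrightarrow> (\<And>j. i = Suc j \<Longrightarrow> bdry d e i v \<in> mm (rk j)) \<Longrightarrow>
        \<exists>w\<in>fm (rk (Suc i)). \<beta> i (\<alpha> i v) - v - bdry d e (Suc i) w \<in> mm (rk i)"
    then show thesis by (intro that[of \<alpha> \<beta>]) auto
  qed (simp_all add: min)
  have ld: "lin (fm (rk (Suc j))) (fm (rk j)) (d j)" for j
    using exactD(2)[OF ex, of "Suc j"] by simp
  \<comment> \<open>\<open>Z\<close> and \<open>B\<close> are the preimages, in the chosen free
    module, of the cycles and boundaries of the tensored complex; both conditions are therefore
    taken modulo \<open>mm\<close>.\<close>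
  define Z where "Z = {v \<in> fm (rk i). \<forall>j. i = Suc j \<longrightarrow> d j v \<in> mm (rk j)}"
  define B where "B = {d i w + m | w m. w \<in> fm (rk (Suc i)) \<and> m \<in> mm (rk i)}"
  define Tor_i where "Tor_i = Tor R k (ideal_module R L) i"
  have Tor_i: "Tor_i = subquotient (T (rk i)) (\<tau> (rk i) ` Z) (\<tau> (rk i) ` B)"
  proof -
    have "(case i of 0 \<Rightarrow> carrier (T (rk 0)) | Suc j \<Rightarrow>
        a_kernel (T (rk (Suc j))) (T (rk j)) (tensor_map R k (free_module R (rk j)) (d j))) = \<tau> (rk i) ` Z"
    proof (cases i)
      case 0 then show ?thesis by (simp add: T_carrier Z_def)
    next
      case (Suc j)
      have "a_kernel (T (rk (Suc j))) (T (rk j)) (tensor_map R k (free_module R (rk j)) (d j))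
          = {X \<in> \<tau> (rk (Suc j)) ` fm (rk (Suc j)). tensor_map R k (free_module R (rk j)) (d j) X = \<tau> (rk j) 0}"
        by (simp add: a_kernel_def' T_carrier T_zero)
      also have "\<dots> = \<tau> (rk (Suc j)) ` {v \<in> fm (rk (Suc j)). d j v \<in> mm (rk j)}"
      proof -
        have "tensor_map R k (free_module R (rk j)) (d j) (\<tau> (rk (Suc j)) v) = \<tau> (rk j) 0 \<longleftrightarrow> d j v \<in> mm (rk j)"
          if "v \<in> fm (rk (Suc j))" for v
          unfolding tensor_map_\<tau>[OF ld that]
          using \<tau>_eq_iff[OF linD(1)[OF ld that] submodD(1)[OF submod_fm]] by simp
        then show ?thesis by blast
      qed
      finally show ?thesis using Suc by (simp add: Z_def)
    qed
    moreover have "tensor_map R k (free_module R (rk i)) (d i) ` carrier (T (rk (Suc i))) = \<tau> (rk i) ` B"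
    proof -
      have "tensor_map R k (free_module R (rk i)) (d i) ` carrier (T (rk (Suc i))) = (\<lambda>w. \<tau> (rk i) (d i w)) ` fm (rk (Suc i))"
        unfolding T_carrier image_image by (intro image_cong refl tensor_map_\<tau>[OF ld])
      also have "\<dots> = \<tau> (rk i) ` B"
      proof -
        have "\<tau> (rk i) (d i w + m) = \<tau> (rk i) (d i w)" if "w \<in> fm (rk (Suc i))" "m \<in> mm (rk i)" for w m
          using linD(1)[OF ld that(1)] that(2) submodD(2)[OF submod_fm _ mm_fm[OF that(2)]]
          by (subst \<tau>_eq_iff) auto
        moreover have "d i w \<in> B" if "w \<in> fm (rk (Suc i))" for w
          unfolding B_def using that submodD(1)[OF submod_mm] by (intro CollectI exI[of _ w] exI[of _ 0]) simp
        ultimately show ?thesis by (auto simp: B_def)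
      qed
      finally show ?thesis .
    qed
    ultimately show ?thesis unfolding Tor_i_def Tor_def sel by (simp add: Let_def cong: nat.case_cong)
  qed
  have B_sub: "submod B" "B \<subseteq> fm (rk i)" "mm (rk i) \<subseteq> B"
  proof -
    show "B \<subseteq> fm (rk i)" using linD(1)[OF ld] mm_fm submodD(2)[OF submod_fm] by (auto simp: B_def)
    have d0: "d i 0 = 0" by (rule lin_simps(1)[OF ld submod_fm])
    show mB: "mm (rk i) \<subseteq> B"
    proof
      fix m assume "m \<in> mm (rk i)"
      then show "m \<in> B" unfolding B_def using d0 submodD(1)[OF submod_fm]
        by (intro CollectI exI[of _ 0] exI[of _ m]) simp
    qed
    show "submod B"
      unfolding submod_def
    proof (intro conjI ballI)
      show "0 \<in> B" using mB submodD(1)[OF submod_mm] by auto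
      fix u assume "u \<in> B"
      then obtain w m where u: "w \<in> fm (rk (Suc i))" "m \<in> mm (rk i)" "u = d i w + m" by (auto simp: B_def)
      show "u + v \<in> B" if "v \<in> B" for v
      proof -
        from that obtain w' m' where v: "w' \<in> fm (rk (Suc i))" "m' \<in> mm (rk i)" "v = d i w' + m'"
          by (auto simp: B_def)
        have "u + v = d i (w + w') + (m + m')" using linD(2)[OF ld u(1) v(1)] u v by (simp add: add_ac)
        then show ?thesis unfolding B_def
          using submodD(2)[OF submod_fm u(1) v(1)] submodD(2)[OF submod_mm u(2) v(2)] by blast
      qed
      show "smul r u \<in> B" if r: "r \<in> polys V" for r
      proof -
        have "smul r u = d i (smul r w) + smul r m" using linD(3)[OF ld r u(1)] u by simp
        then show ?thesis unfolding B_def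
          using submodD(3)[OF submod_fm r u(1)] submodD(3)[OF submod_mm r u(2)] by blast
      qed
    qed
  qed
  note \<theta>_rules = \<theta>_eq_iff[OF B_sub] \<theta>_add[OF B_sub] \<theta>_zero[OF B_sub] \<theta>_smult[OF B_sub]
  have T_car: "carrier Tor_i = \<theta> (rk i) B ` Z"
    unfolding Tor_i by (auto simp: subquotient_def \<theta>_def)
  have \<beta>Z: "\<beta> i u \<in> Z" if "u \<in> fm (rk' i)" for u
    using linD(1)[OF l\<beta> that] d\<beta> that by (auto simp: Z_def)
  define \<Phi> where "\<Phi> c = \<theta> (rk i) B (\<beta> i (const_vec c))" for c
  have \<beta>c: "\<beta> i (const_vec c) \<in> fm (rk i)" if "c \<in> kn (rk' i)" for c
    using linD(1)[OF l\<beta> const_vec_fm[OF that]] .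
  have "vdim Tor_i = rk' i"
  proof (rule vdim_eqI[of \<Phi>])
    show "bij_betw \<Phi> (kn (rk' i)) (carrier Tor_i)"
    proof (rule bij_betwI')
      fix a b :: "nat \<Rightarrow> 'k" assume ab: "a \<in> kn (rk' i)" "b \<in> kn (rk' i)"
      show "\<Phi> a = \<Phi> b \<longleftrightarrow> a = b"
      proof
        assume "\<Phi> a = \<Phi> b"
        then have "\<beta> i (const_vec a) - \<beta> i (const_vec b) \<in> B"
          unfolding \<Phi>_def using \<theta>_rules(1)[OF \<beta>c[OF ab(1)] \<beta>c[OF ab(2)]] by simp
        then have "\<beta> i (const_vec (a - b)) \<in> B"
          using lin_simps(3)[OF l\<beta> submod_fm const_vec_fm[OF ab(1)] const_vec_fm[OF ab(2)]]
          by (simp add: const_vec_diff)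
        then obtain w m where w: "w \<in> fm (rk (Suc i))" "m \<in> mm (rk i)" "\<beta> i (const_vec (a - b)) = d i w + m"
          by (auto simp: B_def)
        have "\<alpha> i (\<beta> i (const_vec (a - b))) = \<alpha> i (d i w) + \<alpha> i m"
          unfolding w(3) by (rule linD(2)[OF l\<alpha> linD(1)[OF ld w(1)] mm_fm[OF w(2)]])
        also have "\<dots> \<in> mm (rk' i)"
          by (rule submodD(2)[OF submod_mm \<alpha>d[OF w(1)] lin_mm[OF l\<alpha> w(2)]])
        finally have 1: "\<alpha> i (\<beta> i (const_vec (a - b))) \<in> mm (rk' i)" .
        have "a - b \<in> kn (rk' i)" using ab by (simp add: kn_def)
        then have "\<alpha> i (\<beta> i (const_vec (a - b))) - const_vec (a - b) \<in> mm (rk' i)"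
          by (intro \<alpha>\<beta> const_vec_fm)
        from submodD(5)[OF submod_mm 1 this] have "const_vec (a - b) \<in> mm (rk' i)" by simp
        then have "a - b = 0" by (rule const_vec_mm)
        then show "a = b" by simp
      qed simp
    next
      fix c :: "nat \<Rightarrow> 'k" assume "c \<in> kn (rk' i)"
      then show "\<Phi> c \<in> carrier Tor_i" unfolding T_car \<Phi>_def by (intro imageI \<beta>Z const_vec_fm)
    next
      fix X assume "X \<in> carrier Tor_i"
      then obtain v where v: "v \<in> Z" "X = \<theta> (rk i) B v" unfolding T_car by auto
      have vf: "v \<in> fm (rk i)" using v(1) by (simp add: Z_def)
      have \<alpha>v: "\<alpha> i v \<in> fm (rk' i)" by (rule linD(1)[OF l\<alpha> vf])
      \<comment> \<open>The preimage of the class of \<open>v\<close> is the vector of constant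
        terms of \<open>\<alpha> i v\<close>; what is dropped lies in \<open>mm\<close> and stays
        there under \<open>\<beta>\<close>.\<close>
      define c where "c = (\<lambda>j. lookup (\<alpha> i v j) 0)"
      have c: "c \<in> kn (rk' i)" using \<alpha>v by (auto simp: c_def kn_def fm_def)
      have cv: "const_vec c \<in> fm (rk' i)" by (rule const_vec_fm[OF c])
      have "const_vec c - \<alpha> i v \<in> mm (rk' i)"
        using submodD(5)[OF submod_fm cv \<alpha>v]
        by (auto simp: mm_def const_vec_def c_def const_def lookup_minus)
      from lin_mm[OF l\<beta> this] have 1: "\<beta> i (const_vec c) - \<beta> i (\<alpha> i v) \<in> mm (rk i)"
        using lin_simps(3)[OF l\<beta> submod_fm cv \<alpha>v] by simp
      obtain w where w: "w \<in> fm (rk (Suc i))" "\<beta> i (\<alpha> i v) - v - d i w \<in> mm (rk i)"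
        using \<beta>\<alpha>[OF vf] v(1) by (auto simp: Z_def)
      have "d i w + ((\<beta> i (const_vec c) - \<beta> i (\<alpha> i v)) + (\<beta> i (\<alpha> i v) - v - d i w)) \<in> B"
        unfolding B_def using w(1) submodD(2)[OF submod_mm 1 w(2)] by blast
      then have "\<beta> i (const_vec c) - v \<in> B" by simp
      then have "X = \<Phi> c" unfolding v(2) \<Phi>_def using \<theta>_rules(1)[OF \<beta>c[OF c] vf] by simp
      then show "\<exists>c\<in>kn (rk' i). X = \<Phi> c" using c by blast
    qed
    show "\<Phi> a \<oplus>\<^bsub>Tor_i\<^esub> \<Phi> b = \<Phi> (a + b)" if "a \<in> kn (rk' i)" "b \<in> kn (rk' i)" for a b
    proof -
      have "\<Phi> a \<oplus>\<^bsub>Tor_i\<^esub> \<Phi> b = \<Phi> a <+>\<^bsub>T (rk i)\<^esub> \<Phi> b" by (simp add: Tor_i subquotient_def)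
      then show ?thesis
        unfolding \<Phi>_def const_vec_add
        using \<theta>_rules(2)[OF \<beta>c[OF that(1)] \<beta>c[OF that(2)]]
          linD(2)[OF l\<beta> const_vec_fm[OF that(1)] const_vec_fm[OF that(2)]] by simp
    qed
    show "\<zero>\<^bsub>Tor_i\<^esub> = \<Phi> 0"
      unfolding \<Phi>_def const_vec_zero lin_simps(1)[OF l\<beta> submod_fm] \<theta>_rules(3)
      by (simp add: Tor_i subquotient_def)
    show "const s \<odot>\<^bsub>Tor_i\<^esub> \<Phi> a = \<Phi> (smul s a)" if "a \<in> kn (rk' i)" for a s
    proof -
      have "const s \<odot>\<^bsub>Tor_i\<^esub> \<Phi> a = (\<Union>X\<in>\<Phi> a. \<tau> (rk i) ` B +>\<^bsub>T (rk i)\<^esub> (const s \<odot>\<^bsub>T (rk i)\<^esub> X))"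
        by (simp add: Tor_i subquotient_def)
      then show ?thesis
        unfolding \<Phi>_def const_vec_smul
        using \<theta>_rules(4)[OF polys_const \<beta>c[OF that], of s]
          linD(3)[OF l\<beta> polys_const const_vec_fm[OF that], of s] by simp
    qed
  qed
  then show ?thesis by (simp add: betti_def Tor_i_def)
qed

end

section \<open>Mapping cones\<close>

text \<open>The direct sum of three free modules is encoded as one block vector, with blocks
  starting at 0, \<open>a\<close> and \<open>a + b\<close>. The third projection carries no upper
  bound, because vectors of a free module vanish beyond the rank anyway.\<close>

definition proj1 :: "nat \<Rightarrow> (nat \<Rightarrow> 'a::zero) \<Rightarrow> nat \<Rightarrow> 'a" where
  "proj1 a v = (\<lambda>i. if i < a then v i else 0)"

definition proj2 :: "nat \<Rightarrow> nat \<Rightarrow> (nat \<Rightarrow> 'a::zero) \<Rightarrow> nat \<Rightarrow> 'a" where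
  "proj2 a b v = (\<lambda>i. if i < b then v (a + i) else 0)"

definition proj3 :: "nat \<Rightarrow> nat \<Rightarrow> (nat \<Rightarrow> 'a::zero) \<Rightarrow> nat \<Rightarrow> 'a" where
  "proj3 a b v = (\<lambda>i. v (a + b + i))"

definition join :: "nat \<Rightarrow> nat \<Rightarrow> (nat \<Rightarrow> 'a) \<Rightarrow> (nat \<Rightarrow> 'a) \<Rightarrow> (nat \<Rightarrow> 'a) \<Rightarrow> nat \<Rightarrow> 'a" where
  "join a b u w t = (\<lambda>i. if i < a then u i else if i < a + b then w (i - a) else t (i - a - b))"

context polynomial_modules
begin

lemma proj_fm:
  assumes "v \<in> fm (a + b + c)"
  shows "proj1 a v \<in> fm a" "proj2 a b v \<in> fm b" "proj3 a b v \<in> fm c"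
  using assms by (auto simp: fm_def proj1_def proj2_def proj3_def)

lemma join_fm:
  assumes "u \<in> fm a" "w \<in> fm b" "t \<in> fm c"
  shows "join a b u w t \<in> fm (a + b + c)"
  using assms by (auto simp: fm_def join_def)

lemma join_mm:
  assumes "u \<in> mm a" "w \<in> mm b" "t \<in> mm c"
  shows "join a b u w t \<in> mm (a + b + c)"
  using assms join_fm[of u a w b t c] by (auto simp: mm_def) (auto simp: join_def)

lemma proj_join:
  assumes "u \<in> fm a" "w \<in> fm b" "t \<in> fm c"
  shows "proj1 a (join a b u w t) = u" "proj2 a b (join a b u w t) = w" "proj3 a b (join a b u w t) = t"
  using assms by (auto simp: fm_def join_def proj1_def proj2_def proj3_def fun_eq_iff)

lemma join_proj: "join a b (proj1 a v) (proj2 a b v) (proj3 a b v) = v"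
  by (auto simp: join_def proj1_def proj2_def proj3_def fun_eq_iff)

lemma proj_add:
  "proj1 a (u + v) = proj1 a u + proj1 a v" "proj2 a b (u + v) = proj2 a b u + proj2 a b v"
  "proj3 a b (u + v) = proj3 a b u + proj3 a b v" for u v :: "nat \<Rightarrow> ('v, 'k) mpoly"
  by (auto simp: proj1_def proj2_def proj3_def fun_eq_iff)

lemma proj_smul:
  "proj1 a (smul r v) = smul r (proj1 a v)" "proj2 a b (smul r v) = smul r (proj2 a b v)"
  "proj3 a b (smul r v) = smul r (proj3 a b v)" for v :: "nat \<Rightarrow> ('v, 'k) mpoly"
  by (auto simp: proj1_def proj2_def proj3_def fun_eq_iff smul_def)

lemma join_add: "join a b (u + u') (w + w') (t + t') = join a b u w t + join a b u' w' t'"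
  and join_smul: "join a b (smul r u) (smul r w) (smul r t) = smul r (join a b u w t)"
  for u w t :: "nat \<Rightarrow> ('v, 'k) mpoly"
  by (auto simp: join_def fun_eq_iff smul_def)

lemma join_eq_zero_iff:
  assumes "u \<in> fm a" "w \<in> fm b" "t \<in> fm c"
  shows "join a b u w t = 0 \<longleftrightarrow> u = 0 \<and> w = 0 \<and> t = 0"
proof
  assume 0: "join a b u w t = 0"
  have z: "proj1 a 0 = (0 :: nat \<Rightarrow> ('v, 'k) mpoly)" "proj2 a b 0 = (0 :: nat \<Rightarrow> ('v, 'k) mpoly)"
    "proj3 a b 0 = (0 :: nat \<Rightarrow> ('v, 'k) mpoly)"
    by (auto simp: proj1_def proj2_def proj3_def fun_eq_iff)
  show "u = 0 \<and> w = 0 \<and> t = 0" using proj_join[OF assms] unfolding 0 z by simp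
qed (auto simp: join_def fun_eq_iff)

text \<open>The conditions of a free resolution of \<open>L\<close> with the module records removed;
  the augmentation keeps its polynomial values, which suits the computations in the cone.\<close>

definition res :: "('v, 'k) mpoly set \<Rightarrow> (nat \<Rightarrow> nat) \<Rightarrow>
    (nat \<Rightarrow> (nat \<Rightarrow> ('v, 'k) mpoly) \<Rightarrow> nat \<Rightarrow> ('v, 'k) mpoly) \<Rightarrow> ((nat \<Rightarrow> ('v, 'k) mpoly) \<Rightarrow> ('v, 'k) mpoly) \<Rightarrow> bool" where
  "res L rk d e \<longleftrightarrow>
    (\<forall>u\<in>fm (rk 0). \<forall>v\<in>fm (rk 0). e (u + v) = e u + e v) \<and>
    (\<forall>r\<in>polys V. \<forall>v\<in>fm (rk 0). e (smul r v) = r * e v) \<and>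
    (\<forall>j. lin (fm (rk (Suc j))) (fm (rk j)) (d j)) \<and> e ` fm (rk 0) = L \<and>
    d 0 ` fm (rk (Suc 0)) = {v \<in> fm (rk 0). e v = 0} \<and>
    (\<forall>j. d (Suc j) ` fm (rk (Suc (Suc j))) = {v \<in> fm (rk (Suc j)). d j v = 0})"

lemma free_resolution_iff_res: "free_resolution R (ideal_module R L) rk d e \<longleftrightarrow> res L rk d e"
proof -
  have "a_kernel (free_module R (rk 0)) (ideal_module R L) e = {v \<in> fm (rk 0). e v = 0}"
    by (simp add: a_kernel_def' carrier_free_module ideal_module_def)
  moreover have "a_kernel (free_module R (rk (Suc j))) (free_module R (rk j)) (d j)
      = {v \<in> fm (rk (Suc j)). d j v = 0}" for j
    by (simp add: a_kernel_def' carrier_free_module free_module_simps)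
  moreover have "e \<in> module_hom R (free_module R (rk 0)) (ideal_module R L) \<longleftrightarrow>
    e ` fm (rk 0) \<subseteq> L \<and> (\<forall>u\<in>fm (rk 0). \<forall>v\<in>fm (rk 0). e (u + v) = e u + e v) \<and>
    (\<forall>r\<in>polys V. \<forall>v\<in>fm (rk 0). e (smul r v) = r * e v)"
    by (simp add: module_hom_def carrier_free_module free_module_simps ideal_module_def Pi_iff image_subset_iff)
  moreover have "carrier (ideal_module R L) = L" by (simp add: ideal_module_def)
  ultimately show ?thesis
    by (auto simp: free_resolution_def res_def Let_def carrier_free_module module_hom_free_iff)
qed

lemma resD:
  assumes "res L rk d e"
  shows "u \<in> fm (rk 0) \<Longrightarrow> v \<in> fm (rk 0) \<Longrightarrow> e (u + v) = e u + e v"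
    "r \<in> polys V \<Longrightarrow> v \<in> fm (rk 0) \<Longrightarrow> e (smul r v) = r * e v"
    "lin (fm (rk (Suc j))) (fm (rk j)) (d j)"
    "v \<in> fm (rk 0) \<Longrightarrow> e v \<in> L"
    "p \<in> L \<Longrightarrow> \<exists>v\<in>fm (rk 0). e v = p"
    "w \<in> fm (rk (Suc 0)) \<Longrightarrow> e (d 0 w) = 0"
    "v \<in> fm (rk 0) \<Longrightarrow> e v = 0 \<Longrightarrow> \<exists>w\<in>fm (rk (Suc 0)). d 0 w = v"
    "w \<in> fm (rk (Suc (Suc j))) \<Longrightarrow> d j (d (Suc j) w) = 0"
    "v \<in> fm (rk (Suc j)) \<Longrightarrow> d j v = 0 \<Longrightarrow> \<exists>w\<in>fm (rk (Suc (Suc j))). d (Suc j) w = v"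
    "u \<in> fm (rk 0) \<Longrightarrow> v \<in> fm (rk 0) \<Longrightarrow> e (u - v) = e u - e v"
proof -
  note a = assms[unfolded res_def]
  show add: "u \<in> fm (rk 0) \<Longrightarrow> v \<in> fm (rk 0) \<Longrightarrow> e (u + v) = e u + e v" for u v using a by simp
  show "r \<in> polys V \<Longrightarrow> v \<in> fm (rk 0) \<Longrightarrow> e (smul r v) = r * e v" using a by simp
  show "lin (fm (rk (Suc j))) (fm (rk j)) (d j)" using a by simp
  have L: "e ` fm (rk 0) = L" using a by simp
  show "v \<in> fm (rk 0) \<Longrightarrow> e v \<in> L" using L by blast
  show "p \<in> L \<Longrightarrow> \<exists>v\<in>fm (rk 0). e v = p" unfolding L[symmetric] by auto
  have 0: "d 0 ` fm (rk (Suc 0)) = {v \<in> fm (rk 0). e v = 0}" using a by simp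
  show "w \<in> fm (rk (Suc 0)) \<Longrightarrow> e (d 0 w) = 0" using 0 by blast
  show "v \<in> fm (rk 0) \<Longrightarrow> e v = 0 \<Longrightarrow> \<exists>w\<in>fm (rk (Suc 0)). d 0 w = v"
    using equalityD2[OF 0] by blast
  have S: "d (Suc j) ` fm (rk (Suc (Suc j))) = {v \<in> fm (rk (Suc j)). d j v = 0}" using a by simp
  show "w \<in> fm (rk (Suc (Suc j))) \<Longrightarrow> d j (d (Suc j) w) = 0" using S by blast
  show "v \<in> fm (rk (Suc j)) \<Longrightarrow> d j v = 0 \<Longrightarrow> \<exists>w\<in>fm (rk (Suc (Suc j))). d (Suc j) w = v"
    using equalityD2[OF S] by blast
  show "u \<in> fm (rk 0) \<Longrightarrow> v \<in> fm (rk 0) \<Longrightarrow> e (u - v) = e u - e v"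
    using add[of "u - v" v] submodD(5)[OF submod_fm] by simp
qed

definition minres where
  "minres L rk d e \<longleftrightarrow> res L rk d e \<and> (\<forall>j. \<forall>v\<in>fm (rk (Suc j)). d j v \<in> mm (rk j))"

lemma betti_minres: "ideal L R \<Longrightarrow> minres L rk d e \<Longrightarrow> betti K V L i = rk i"
  using betti_eq_rank_of_minimal_resolution[of L rk d e i]
  by (simp add: minres_def free_resolution_iff_res)

text \<open>The comparison theorem applied to multiplication by \<open>q\<close>, regarded as a map
  from \<open>L''\<close> to \<open>L'\<close> in degree 0.\<close>

lemma lift_multiplication:
  assumes L': "ideal L' R" and L'': "ideal L'' R" and r': "res L' r' d' e'" and r'': "res L'' r'' d'' e''"
    and q: "q \<in> polys V" "\<And>p. p \<in> L'' \<Longrightarrow> q * p \<in> L'"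
  obtains \<phi> where "\<And>j. lin (fm (r'' j)) (fm (r' j)) (\<phi> j)"
    "\<And>v. v \<in> fm (r'' 0) \<Longrightarrow> e' (\<phi> 0 v) = q * e'' v"
    "\<And>j v. v \<in> fm (r'' (Suc j)) \<Longrightarrow> d' j (\<phi> (Suc j) v) = \<phi> j (d'' j v)"
proof -
  have ex': "exact (level L' r') (bdry d' e')" and ex'': "exact (level L'' r'') (bdry d'' e'')"
    using r' r'' by (simp_all add: free_resolution_iff_res free_resolution_iff_exact[symmetric] L' L'')
  have "lin (level L'' r'' 0) (level L' r' 0) (smul q)"
    unfolding lin_def
  proof (intro conjI ballI)
    fix v assume v: "v \<in> level L'' r'' 0"
    then obtain p where "p \<in> L''" "v = smul p (unit 0)" using level_0_iff[OF L''] by blast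
    then show "smul q v \<in> level L' r' 0"
      unfolding level_0_iff[OF L'] using q(2) by (auto simp: smul_smul)
  qed (simp_all add: smul_smul mult.commute)
  then obtain f where f: "f 0 = smul q" "chain_map (level L'' r'') (bdry d'' e'') (level L' r') (bdry d' e') f"
    using comparison[OF ex'' _ ex', of r''] by auto
  show ?thesis
  proof (rule that[of "\<lambda>j. f (Suc j)"])
    show "lin (fm (r'' j)) (fm (r' j)) (f (Suc j))" for j
      using f(2) by (metis chain_map_def level_Suc)
    show "d' j (f (Suc (Suc j)) v) = f (Suc j) (d'' j v)" if "v \<in> fm (r'' (Suc j))" for j v
    proof -
      have "v \<in> level L'' r'' (Suc (Suc j))" using that by simp
      then have "bdry d' e' (Suc j) (f (Suc (Suc j)) v) = f (Suc j) (bdry d'' e'' (Suc j) v)"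
        using f(2) unfolding chain_map_def by blast
      then show ?thesis by simp
    qed
    show "e' (f (Suc 0) v) = q * e'' v" if "v \<in> fm (r'' 0)" for v
    proof -
      have "v \<in> level L'' r'' (Suc 0)" using that by simp
      then have "bdry d' e' 0 (f (Suc 0) v) = f 0 (bdry d'' e'' 0 v)"
        using f(2) unfolding chain_map_def by blast
      then have "smul (e' (f (Suc 0) v)) (unit 0) = smul (q * e'' v) (unit 0)"
        by (simp add: f(1) bdry_def smul_smul)
      then show ?thesis by (metis smul_unit_0(2))
    qed
  qed
qed

text \<open>The cone of \<open>(a \<phi>, b)\<close> for the short exact sequence
  \<open>0 \<rightarrow> L'' \<rightarrow> L' \<oplus> L'' \<rightarrow> b L' + a q L'' \<rightarrow> 0\<close>, in which \<open>g \<in> L''\<close> is mapped to \<open>(a q g, b g)\<close>;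
  it is minimal since \<open>a\<close> and \<open>b\<close> lie in the maximal ideal.\<close>

lemma mapping_cone:
  assumes L': "ideal L' R" and L'': "ideal L'' R"
    and m': "minres L' r' d' e'" and m'': "minres L'' r'' d'' e''"
    and a: "a \<in> polys V" "lookup a 0 = 0" and b: "b \<in> polys V" "lookup b 0 = 0"
    and q: "q \<in> polys V" "\<And>p. p \<in> L'' \<Longrightarrow> q * p \<in> L'"
    and L: "L = {b * p - a * q * p' | p p'. p \<in> L' \<and> p' \<in> L''}"
    and inter: "\<And>p p'. p \<in> L' \<Longrightarrow> p' \<in> L'' \<Longrightarrow> b * p = a * q * p' \<Longrightarrow> \<exists>g\<in>L''. p' = b * g \<and> p = a * q * g"
    and b_reg: "\<And>p. b * p = 0 \<Longrightarrow> p = 0"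
  shows "\<exists>d e. minres L (\<lambda>j. r' j + r'' j + (case j of 0 \<Rightarrow> 0 | Suc i \<Rightarrow> r'' i)) d e"
proof -
  have r': "res L' r' d' e'" and min': "\<And>j v. v \<in> fm (r' (Suc j)) \<Longrightarrow> d' j v \<in> mm (r' j)"
    using m' by (auto simp: minres_def)
  have r'': "res L'' r'' d'' e''" and min'': "\<And>j v. v \<in> fm (r'' (Suc j)) \<Longrightarrow> d'' j v \<in> mm (r'' j)"
    using m'' by (auto simp: minres_def)
  obtain \<phi> where \<phi>: "\<And>j. lin (fm (r'' j)) (fm (r' j)) (\<phi> j)"
    "\<And>v. v \<in> fm (r'' 0) \<Longrightarrow> e' (\<phi> 0 v) = q * e'' v"
    "\<And>j v. v \<in> fm (r'' (Suc j)) \<Longrightarrow> d' j (\<phi> (Suc j) v) = \<phi> j (d'' j v)"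
    using lift_multiplication[OF L' L'' r' r'' q] by blast
  \<comment> \<open>The third block of the cone in degree \<open>j\<close> is the resolution of
    \<open>L''\<close> in degree \<open>j - 1\<close>, hence absent for
    \<open>j = 0\<close>.\<close>
  define r3 where "r3 j = (case j of 0 \<Rightarrow> 0 | Suc i \<Rightarrow> r'' i)" for j
  define rk where "rk j = r' j + r'' j + r3 j" for j
  \<comment> \<open>The minus sign makes the mixed terms, \<open>a\<close> times
    \<open>\<phi>\<close> after \<open>d''\<close> and \<open>b\<close> times \<open>d''\<close>,
    cancel in the composite of two differentials.\<close>
  define \<delta> where "\<delta> j t = (case j of 0 \<Rightarrow> 0 | Suc i \<Rightarrow> - d'' i t)" for j and t :: "nat \<Rightarrow> ('v, 'k) mpoly"
  define J :: "nat \<Rightarrow> (nat \<Rightarrow> ('v, 'k) mpoly) \<Rightarrow> (nat \<Rightarrow> ('v, 'k) mpoly) \<Rightarrow> (nat \<Rightarrow> ('v, 'k) mpoly) \<Rightarrow> nat \<Rightarrow> ('v, 'k) mpoly" where "J j = join (r' j) (r'' j)" for j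
  define P1 :: "nat \<Rightarrow> (nat \<Rightarrow> ('v, 'k) mpoly) \<Rightarrow> nat \<Rightarrow> ('v, 'k) mpoly" where "P1 j = proj1 (r' j)" for j
  define P2 :: "nat \<Rightarrow> (nat \<Rightarrow> ('v, 'k) mpoly) \<Rightarrow> nat \<Rightarrow> ('v, 'k) mpoly" where "P2 j = proj2 (r' j) (r'' j)" for j
  define P3 :: "nat \<Rightarrow> (nat \<Rightarrow> ('v, 'k) mpoly) \<Rightarrow> nat \<Rightarrow> ('v, 'k) mpoly" where "P3 j = proj3 (r' j) (r'' j)" for j
  define d where "d j v = J j (d' j (P1 (Suc j) v) + smul a (\<phi> j (P3 (Suc j) v)))
    (d'' j (P2 (Suc j) v) + smul b (P3 (Suc j) v)) (\<delta> j (P3 (Suc j) v))" for j v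
  \<comment> \<open>The opposite signs make \<open>e\<close> vanish on the pairs coming from the
    third block: both terms become \<open>a b q\<close> times the same element of
    \<open>L''\<close>.\<close>
  define e where "e v = b * e' (P1 0 v) - a * q * e'' (P2 0 v)" for v
  have aq: "a * q \<in> polys V" using a q by (intro polys_mult)
  have P: "P1 j v \<in> fm (r' j)" "P2 j v \<in> fm (r'' j)" "P3 j v \<in> fm (r3 j)" if "v \<in> fm (rk j)" for j v
    using proj_fm that unfolding rk_def P1_def P2_def P3_def by blast+
  have P3: "P3 (Suc j) v \<in> fm (r'' j)" if "v \<in> fm (rk (Suc j))" for j v
    using P(3)[OF that] by (simp add: r3_def)
  have J: "J j u w t \<in> fm (rk j)" if "u \<in> fm (r' j)" "w \<in> fm (r'' j)" "t \<in> fm (r3 j)" for j u w t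
    using join_fm that unfolding rk_def J_def by blast
  have PJ: "P1 j (J j u w t) = u" "P2 j (J j u w t) = w" "P3 j (J j u w t) = t"
    if "u \<in> fm (r' j)" "w \<in> fm (r'' j)" "t \<in> fm (r3 j)" for j u w t
    using proj_join that unfolding P1_def P2_def P3_def J_def by blast+
  have JP: "J j (P1 j v) (P2 j v) (P3 j v) = v" for j v
    by (simp add: J_def P1_def P2_def P3_def join_proj)
  have J0: "J j u w t = 0 \<longleftrightarrow> u = 0 \<and> w = 0 \<and> t = 0"
    if "u \<in> fm (r' j)" "w \<in> fm (r'' j)" "t \<in> fm (r3 j)" for j u w t
    unfolding J_def by (rule join_eq_zero_iff[OF that])
  note ld' = resD(3)[OF r'] and ld'' = resD(3)[OF r'']
  note S = submodD[OF submod_fm]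
  have l\<delta>: "lin (fm (r'' j)) (fm (r3 j)) (\<delta> j)" for j
  proof (cases j)
    case 0 then show ?thesis by (simp add: \<delta>_def lin_def S)
  next
    case (Suc i)
    then show ?thesis using ld''[of i] by (auto simp: \<delta>_def r3_def lin_def intro: S)
  qed
  have c1: "d' j u + smul a (\<phi> j t) \<in> fm (r' j)" if "u \<in> fm (r' (Suc j))" "t \<in> fm (r'' j)" for j u t
    by (intro S(2,3) linD(1)[OF ld'] linD(1)[OF \<phi>(1)] that a)
  have c2: "d'' j w + smul b t \<in> fm (r'' j)" if "w \<in> fm (r'' (Suc j))" "t \<in> fm (r'' j)" for j w t
    by (intro S(2,3) linD(1)[OF ld''] that b)
  have c3: "\<delta> j t \<in> fm (r3 j)" if "t \<in> fm (r'' j)" for j t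
    by (rule linD(1)[OF l\<delta> that])
  have dJ: "d j (J (Suc j) u w t) = J j (d' j u + smul a (\<phi> j t)) (d'' j w + smul b t) (\<delta> j t)"
    if "u \<in> fm (r' (Suc j))" "w \<in> fm (r'' (Suc j))" "t \<in> fm (r'' j)" for j u w t
    using PJ[of u "Suc j" w t] that by (simp add: d_def r3_def)
  have P_add: "P1 j (u + v) = P1 j u + P1 j v" "P2 j (u + v) = P2 j u + P2 j v" "P3 j (u + v) = P3 j u + P3 j v"
    for j u v by (simp_all add: P1_def P2_def P3_def proj_add)
  have P_smul: "P1 j (smul r v) = smul r (P1 j v)" "P2 j (smul r v) = smul r (P2 j v)" "P3 j (smul r v) = smul r (P3 j v)"
    for j r v by (simp_all add: P1_def P2_def P3_def proj_smul)
  have ld: "lin (fm (rk (Suc j))) (fm (rk j)) (d j)" for j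
    unfolding lin_def
  proof (intro conjI ballI)
    fix v assume v: "v \<in> fm (rk (Suc j))"
    show "d j v \<in> fm (rk j)"
      unfolding d_def by (intro J c1 c2 c3 P(1,2)[OF v] P3[OF v])
    show "d j (u + v) = d j u + d j v" if u: "u \<in> fm (rk (Suc j))" for u
    proof -
      have "d j (u + v) = J j ((d' j (P1 (Suc j) u) + smul a (\<phi> j (P3 (Suc j) u))) + (d' j (P1 (Suc j) v) + smul a (\<phi> j (P3 (Suc j) v))))
        ((d'' j (P2 (Suc j) u) + smul b (P3 (Suc j) u)) + (d'' j (P2 (Suc j) v) + smul b (P3 (Suc j) v)))
        (\<delta> j (P3 (Suc j) u) + \<delta> j (P3 (Suc j) v))"
        unfolding d_def P_add linD(2)[OF ld' P(1)[OF u] P(1)[OF v]] linD(2)[OF ld'' P(2)[OF u] P(2)[OF v]]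
          linD(2)[OF \<phi>(1) P3[OF u] P3[OF v]] linD(2)[OF l\<delta> P3[OF u] P3[OF v]] by (simp add: add_ac)
      then show ?thesis unfolding d_def J_def join_add by simp
    qed
    show "d j (smul r v) = smul r (d j v)" if r: "r \<in> polys V" for r
      unfolding d_def P_smul linD(3)[OF ld' r P(1)[OF v]] linD(3)[OF ld'' r P(2)[OF v]]
        linD(3)[OF \<phi>(1) r P3[OF v]] linD(3)[OF l\<delta> r P3[OF v]] J_def join_smul[symmetric]
      by (simp add: smul_smul mult.commute)
  qed
  have e_add: "e (u + v) = e u + e v" if "u \<in> fm (rk 0)" "v \<in> fm (rk 0)" for u v
    using that P by (simp add: e_def P_add resD(1)[OF r'] resD(1)[OF r''] algebra_simps)
  have e_smul: "e (smul r v) = r * e v" if "r \<in> polys V" "v \<in> fm (rk 0)" for r v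
    using that P by (simp add: e_def P_smul resD(2)[OF r'] resD(2)[OF r''] algebra_simps)
  have zero3: "0 \<in> fm (r3 0)" by (rule S(1))
  have fm3: "t = 0" if "t \<in> fm (r3 0)" for t using that by (auto simp: r3_def fm_def fun_eq_iff)
  have e_image: "e ` fm (rk 0) = L"
  proof (intro subset_antisym subsetI)
    fix p assume "p \<in> e ` fm (rk 0)"
    then obtain x where x: "x \<in> fm (rk 0)" "p = e x" by auto
    have "e' (P1 0 x) \<in> L'" "e'' (P2 0 x) \<in> L''"
      using P[OF x(1)] resD(4)[OF r'] resD(4)[OF r''] by auto
    then show "p \<in> L" unfolding L x(2) e_def by blast
  next
    fix p assume "p \<in> L"
    then obtain p' p'' where p: "p' \<in> L'" "p'' \<in> L''" "p = b * p' - a * q * p''" by (auto simp: L)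
    obtain u w where uw: "u \<in> fm (r' 0)" "e' u = p'" "w \<in> fm (r'' 0)" "e'' w = p''"
      using resD(5)[OF r' p(1)] resD(5)[OF r'' p(2)] by blast
    have "p = e (J 0 u w 0)" using PJ[OF uw(1,3) zero3] uw p by (simp add: e_def)
    then show "p \<in> e ` fm (rk 0)" using J[OF uw(1,3) zero3] by blast
  qed
  \<comment> \<open>Exactness of the shifted resolution in the third block; the sign of
    \<open>\<delta>\<close> accounts for the minus.\<close>
  have lift3: "\<exists>t\<^sub>1\<in>fm (r'' (Suc j)). t = - d'' j t\<^sub>1" if "t \<in> fm (r'' j)"
    "j = 0 \<Longrightarrow> e'' t = 0" "\<And>i. j = Suc i \<Longrightarrow> d'' i t = 0" for j t
  proof -
    have "\<exists>w\<in>fm (r'' (Suc j)). d'' j w = - t"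
    proof (cases j)
      case 0
      have "e'' (- t) = 0" using resD(2)[OF r'' polys_uminus[OF polys_one], of t] that 0 by simp
      then show ?thesis using resD(7)[OF r'', of "- t"] S(4)[of t] that 0 by simp
    next
      case (Suc i)
      have "d'' i (- t) = 0" using lin_simps(2)[OF ld'' submod_fm, of t i] that Suc by simp
      then show ?thesis using resD(9)[OF r'', of "- t" i] S(4)[of t] that Suc by simp
    qed
    then show ?thesis by (metis minus_minus)
  qed
  have d0: "d 0 ` fm (rk (Suc 0)) = {v \<in> fm (rk 0). e v = 0}"
  proof (intro subset_antisym subsetI)
    fix v assume "v \<in> d 0 ` fm (rk (Suc 0))"
    then obtain x where x: "x \<in> fm (rk (Suc 0))" "v = d 0 x" by auto
    define u w t where "u = P1 (Suc 0) x" and "w = P2 (Suc 0) x" and "t = P3 (Suc 0) x"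
    have c: "u \<in> fm (r' (Suc 0))" "w \<in> fm (r'' (Suc 0))" "t \<in> fm (r'' 0)"
      using P(1,2)[OF x(1)] P3[OF x(1)] by (auto simp: u_def w_def t_def)
    have v: "v = J 0 (d' 0 u + smul a (\<phi> 0 t)) (d'' 0 w + smul b t) (\<delta> 0 t)"
      using x(2) by (simp add: d_def u_def w_def t_def)
    note ft = linD(1)[OF \<phi>(1) c(3)]
    have "e v = b * e' (d' 0 u + smul a (\<phi> 0 t)) - a * q * e'' (d'' 0 w + smul b t)"
      unfolding e_def v PJ[OF c1[OF c(1,3)] c2[OF c(2,3)] c3[OF c(3)]] ..
    also have "e' (d' 0 u + smul a (\<phi> 0 t)) = a * (q * e'' t)"
      unfolding resD(1)[OF r' linD(1)[OF ld' c(1)] S(3)[OF a(1) ft]] resD(2)[OF r' a(1) ft] \<phi>(2)[OF c(3)] resD(6)[OF r' c(1)]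
      by simp
    also have "e'' (d'' 0 w + smul b t) = b * e'' t"
      unfolding resD(1)[OF r'' linD(1)[OF ld'' c(2)] S(3)[OF b(1) c(3)]] resD(2)[OF r'' b(1) c(3)] resD(6)[OF r'' c(2)]
      by simp
    finally have "e v = 0" by (simp add: algebra_simps)
    then show "v \<in> {v \<in> fm (rk 0). e v = 0}" using linD(1)[OF ld x(1)] x(2) by simp
  next
    fix v assume "v \<in> {v \<in> fm (rk 0). e v = 0}"
    then have v: "v \<in> fm (rk 0)" "e v = 0" by auto
    define u w where "u = P1 0 v" and "w = P2 0 v"
    have c: "u \<in> fm (r' 0)" "w \<in> fm (r'' 0)" using P[OF v(1)] by (auto simp: u_def w_def)
    have "b * e' u = a * q * e'' w" using v(2) by (simp add: e_def u_def w_def)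
    \<comment> \<open>Exactness at \<open>L' \<oplus> L''\<close>: the pair of values is the image
      of \<open>g\<close>. Subtracting the contribution of a lift \<open>t\<close> of
      \<open>g\<close> leaves two vectors killed by the separate augmentations, which lift
      independently.\<close>
    then obtain g where g: "g \<in> L''" "e'' w = b * g" "e' u = a * q * g"
      using inter[OF resD(4)[OF r' c(1)] resD(4)[OF r'' c(2)]] by blast
    obtain t where t: "t \<in> fm (r'' 0)" "e'' t = g" using resD(5)[OF r'' g(1)] by blast
    note ft = linD(1)[OF \<phi>(1) t(1)]
    have "e' (u - smul a (\<phi> 0 t)) = 0"
      unfolding resD(10)[OF r' c(1) S(3)[OF a(1) ft]] resD(2)[OF r' a(1) ft] \<phi>(2)[OF t(1)] t(2) g(3)
      by (simp add: mult.assoc)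
    then obtain u1 where u1: "u1 \<in> fm (r' (Suc 0))" "d' 0 u1 = u - smul a (\<phi> 0 t)"
      using resD(7)[OF r' S(5)[OF c(1) S(3)[OF a(1) ft]]] by blast
    have "e'' (w - smul b t) = 0"
      unfolding resD(10)[OF r'' c(2) S(3)[OF b(1) t(1)]] resD(2)[OF r'' b(1) t(1)] t(2) g(2) by simp
    then obtain w1 where w1: "w1 \<in> fm (r'' (Suc 0))" "d'' 0 w1 = w - smul b t"
      using resD(7)[OF r'' S(5)[OF c(2) S(3)[OF b(1) t(1)]]] by blast
    have "d 0 (J (Suc 0) u1 w1 t) = J 0 u w (\<delta> 0 t)"
      unfolding dJ[OF u1(1) w1(1) t(1)] u1(2) w1(2) by simp
    also have "\<delta> 0 t = P3 0 v" using fm3[OF P(3)[OF v(1)]] by (simp add: \<delta>_def)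
    also have "J 0 u w (P3 0 v) = v" unfolding u_def w_def by (rule JP)
    finally show "v \<in> d 0 ` fm (rk (Suc 0))"
      using J[OF u1(1) w1(1), of t] t(1) by (metis (no_types, lifting) image_eqI nat.case(2) r3_def)
  qed
  have dS: "d (Suc j) ` fm (rk (Suc (Suc j))) = {v \<in> fm (rk (Suc j)). d j v = 0}" for j
  proof (intro subset_antisym subsetI)
    fix v assume "v \<in> d (Suc j) ` fm (rk (Suc (Suc j)))"
    then obtain x where x: "x \<in> fm (rk (Suc (Suc j)))" "v = d (Suc j) x" by auto
    define u w t where "u = P1 (Suc (Suc j)) x" and "w = P2 (Suc (Suc j)) x" and "t = P3 (Suc (Suc j)) x"
    have c: "u \<in> fm (r' (Suc (Suc j)))" "w \<in> fm (r'' (Suc (Suc j)))" "t \<in> fm (r'' (Suc j))"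
      using P(1,2)[OF x(1)] P3[OF x(1)] by (auto simp: u_def w_def t_def)
    have v: "v = J (Suc j) (d' (Suc j) u + smul a (\<phi> (Suc j) t)) (d'' (Suc j) w + smul b t) (\<delta> (Suc j) t)"
      using x(2) by (simp add: d_def u_def w_def t_def)
    have \<delta>t: "\<delta> (Suc j) t = - d'' j t" by (simp add: \<delta>_def)
    have dt: "d'' j t \<in> fm (r'' j)" by (rule linD(1)[OF ld'' c(3)])
    note ft = linD(1)[OF \<phi>(1) c(3)]
    have "d j v = J j (d' j (d' (Suc j) u + smul a (\<phi> (Suc j) t)) + smul a (\<phi> j (- d'' j t)))
        (d'' j (d'' (Suc j) w + smul b t) + smul b (- d'' j t)) (\<delta> j (- d'' j t))"
      unfolding v \<delta>t by (rule dJ[OF c1[OF c(1,3)] c2[OF c(2,3)] S(4)[OF dt]])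
    also have "d' j (d' (Suc j) u + smul a (\<phi> (Suc j) t)) = smul a (\<phi> j (d'' j t))"
      unfolding linD(2)[OF ld' linD(1)[OF ld' c(1)] S(3)[OF a(1) ft]] linD(3)[OF ld' a(1) ft] \<phi>(3)[OF c(3)] resD(8)[OF r' c(1)]
      by simp
    also have "\<phi> j (- d'' j t) = - \<phi> j (d'' j t)" by (rule lin_simps(2)[OF \<phi>(1) submod_fm dt])
    also have "d'' j (d'' (Suc j) w + smul b t) = smul b (d'' j t)"
      unfolding linD(2)[OF ld'' linD(1)[OF ld'' c(2)] S(3)[OF b(1) c(3)]] linD(3)[OF ld'' b(1) c(3)] resD(8)[OF r'' c(2)]
      by simp
    also have "\<delta> j (- d'' j t) = 0"
    proof (cases j)
      case 0 then show ?thesis by (simp add: \<delta>_def)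
    next
      case (Suc i)
      have "d'' i (- d'' j t) = 0"
        using lin_simps(2)[OF ld'' submod_fm, of "d'' j t" i] dt resD(8)[OF r'', of t i] c(3) Suc by simp
      then show ?thesis using Suc by (simp add: \<delta>_def)
    qed
    finally have dv: "d j v = J j (smul a (\<phi> j (d'' j t)) + smul a (- \<phi> j (d'' j t)))
      (smul b (d'' j t) + smul b (- d'' j t)) 0" .
    have z: "smul c f + smul c (- f) = 0" for c and f :: "nat \<Rightarrow> ('v, 'k) mpoly"
      unfolding smul_simps(7) by (rule right_minus)
    have "d j v = 0" unfolding dv z using J0[OF S(1) S(1) S(1)] by blast
    then show "v \<in> {v \<in> fm (rk (Suc j)). d j v = 0}" using linD(1)[OF ld x(1)] x(2) by simp
  next
    fix v assume "v \<in> {v \<in> fm (rk (Suc j)). d j v = 0}"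
    then have v: "v \<in> fm (rk (Suc j))" "d j v = 0" by auto
    define u w t where "u = P1 (Suc j) v" and "w = P2 (Suc j) v" and "t = P3 (Suc j) v"
    have c: "u \<in> fm (r' (Suc j))" "w \<in> fm (r'' (Suc j))" "t \<in> fm (r'' j)"
      using P(1,2)[OF v(1)] P3[OF v(1)] by (auto simp: u_def w_def t_def)
    have z: "d' j u + smul a (\<phi> j t) = 0" "d'' j w + smul b t = 0" "\<delta> j t = 0"
      using v(2) J0[OF c1[OF c(1,3)] c2[OF c(2,3)] c3[OF c(3)]] by (auto simp: d_def u_def w_def t_def)
    \<comment> \<open>In degree 0 the third component of the differential imposes no condition on
      \<open>t\<close>; there the second component gives \<open>b\<close> times \<open>e'' t\<close>
      equal to 0, and \<open>b\<close> cancels.\<close>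
    have "\<exists>t\<^sub>1\<in>fm (r'' (Suc j)). t = - d'' j t\<^sub>1"
    proof (rule lift3[OF c(3)])
      assume "j = 0"
      then have "e'' (d'' 0 w + smul b t) = b * e'' t"
        using resD(1)[OF r'' linD(1)[OF ld'', of w 0] S(3)[OF b(1)], of t] resD(2)[OF r'' b(1), of t]
          resD(6)[OF r'', of w] c by simp
      moreover have "e'' 0 = 0" using resD(2)[OF r'' polys_zero S(1)] by simp
      ultimately show "e'' t = 0" using z(2) b_reg \<open>j = 0\<close> by simp
    next
      fix i assume "j = Suc i"
      then show "d'' i t = 0" using z(3) by (simp add: \<delta>_def)
    qed
    then obtain t1 where t1: "t1 \<in> fm (r'' (Suc j))" "t = - d'' j t1" by blast
    note ft = linD(1)[OF \<phi>(1) t1(1)]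
    have dt: "d'' j t1 \<in> fm (r'' j)" by (rule linD(1)[OF ld'' t1(1)])
    have "\<phi> j t = - \<phi> j (d'' j t1)" unfolding t1(2) by (rule lin_simps(2)[OF \<phi>(1) submod_fm dt])
    then have "d' j (u - smul a (\<phi> (Suc j) t1)) = 0"
      using z(1) unfolding lin_simps(3)[OF ld' submod_fm c(1) S(3)[OF a(1) ft]] linD(3)[OF ld' a(1) ft] \<phi>(3)[OF t1(1)]
      by simp
    then obtain u1 where u1: "u1 \<in> fm (r' (Suc (Suc j)))" "d' (Suc j) u1 = u - smul a (\<phi> (Suc j) t1)"
      using resD(9)[OF r' S(5)[OF c(1) S(3)[OF a(1) ft]]] by blast
    have "d'' j (w - smul b t1) = 0"
      using z(2) unfolding lin_simps(3)[OF ld'' submod_fm c(2) S(3)[OF b(1) t1(1)]] linD(3)[OF ld'' b(1) t1(1)] t1(2)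
      by simp
    then obtain w1 where w1: "w1 \<in> fm (r'' (Suc (Suc j)))" "d'' (Suc j) w1 = w - smul b t1"
      using resD(9)[OF r'' S(5)[OF c(2) S(3)[OF b(1) t1(1)]]] by blast
    have "d (Suc j) (J (Suc (Suc j)) u1 w1 t1) = J (Suc j) u w t"
      unfolding dJ[OF u1(1) w1(1) t1(1)] u1(2) w1(2) using t1(2) by (simp add: \<delta>_def)
    also have "\<dots> = v" unfolding u_def w_def t_def by (rule JP)
    finally show "v \<in> d (Suc j) ` fm (rk (Suc (Suc j)))"
      using J[OF u1(1) w1(1), of t1] t1(1) by (metis (no_types, lifting) image_eqI nat.case(2) r3_def)
  qed
  have min: "d j v \<in> mm (rk j)" if v: "v \<in> fm (rk (Suc j))" for j v
  proof -
    have sm: "smul c x \<in> mm n" if "c \<in> polys V" "lookup c 0 = 0" "x \<in> fm n" for c x n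
      using S(3)[OF that(1,3)] that by (simp add: mm_def smul_def lookup_mult_zero)
    have "\<delta> j (P3 (Suc j) v) \<in> mm (r3 j)"
    proof (cases j)
      case 0 then show ?thesis using submodD(1)[OF submod_mm] by (simp add: \<delta>_def)
    next
      case (Suc i)
      then show ?thesis using submodD(4)[OF submod_mm min''[of "P3 (Suc j) v" i]] P3[OF v]
        by (simp add: \<delta>_def r3_def)
    qed
    moreover have "d' j (P1 (Suc j) v) + smul a (\<phi> j (P3 (Suc j) v)) \<in> mm (r' j)"
      by (intro submodD(2)[OF submod_mm] min' sm a linD(1)[OF \<phi>(1)] P(1)[OF v] P3[OF v])
    moreover have "d'' j (P2 (Suc j) v) + smul b (P3 (Suc j) v) \<in> mm (r'' j)"
      by (intro submodD(2)[OF submod_mm] min'' sm b P(2)[OF v] P3[OF v])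
    ultimately show ?thesis unfolding d_def rk_def J_def by (intro join_mm)
  qed
  have "res L rk d e"
    unfolding res_def using e_add e_smul ld e_image d0 dS by blast
  then have "minres L rk d e" using min by (simp add: minres_def)
  then show ?thesis unfolding rk_def[abs_def] r3_def by blast
qed

end

section \<open>Cover ideals of labeled bipartite graphs\<close>

definition keys_part :: "('a \<Rightarrow> bool) \<Rightarrow> ('a \<Rightarrow>\<^sub>0 'b::comm_monoid_add) \<Rightarrow> 'a \<Rightarrow>\<^sub>0 'b" where
  "keys_part P f = (\<Sum>t\<in>{t \<in> keys f. P t}. single t (lookup f t))"

lemma lookup_keys_part: "lookup (keys_part P f) t = (if P t then lookup f t else 0)"
  by (auto simp: keys_part_def lookup_sum lookup_single when_def in_keys_iff)

lemma keys_keys_part: "keys (keys_part P f) = {t \<in> keys f. P t}"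
  by (rule Set.set_eqI) (simp add: in_keys_iff lookup_keys_part)

lemma keys_part_split: "keys_part P f + keys_part (\<lambda>t. \<not> P t) f = f"
  by (rule poly_mapping_eqI) (simp add: lookup_add lookup_keys_part)

lemma polys_keys_part: "f \<in> polys V \<Longrightarrow> keys_part P f \<in> polys V"
  by (auto simp: polys_def keys_keys_part)

text \<open>The support is allowed to leave the vertex set, since cover ideals of subgraphs are
  taken in the polynomial ring of the larger graph.\<close>

definition covers :: "'v graph \<Rightarrow> ('v \<Rightarrow>\<^sub>0 nat) \<Rightarrow> bool" where
  "covers G t \<longleftrightarrow> (\<forall>e\<in>edges G. e \<inter> keys t \<noteq> {})"

text \<open>The labels range over an arbitrary finite set \<open>S\<close> of numbers rather than an
  initial segment, so that deleting pairs of vertices stays within the class without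
  relabeling.\<close>

locale labeled_bipartite =
  fixes G :: "'v graph" and x y :: "nat \<Rightarrow> 'v" and S :: "nat set"
  assumes finite_S: "finite S" and G: "simple_graph G"
    and inj_x: "inj_on x S" and inj_y: "inj_on y S"
    and bip: "bipartition G (x ` S) (y ` S)"
    and diag: "i \<in> S \<Longrightarrow> {x i, y i} \<in> edges G"
    and mono: "i \<in> S \<Longrightarrow> j \<in> S \<Longrightarrow> {x i, y j} \<in> edges G \<Longrightarrow> i \<le> j"
    and trans: "i \<in> S \<Longrightarrow> j \<in> S \<Longrightarrow> l \<in> S \<Longrightarrow> i < j \<Longrightarrow> j < l \<Longrightarrow> {x i, y j} \<in> edges G \<Longrightarrow>
      {x j, y l} \<in> edges G \<Longrightarrow> {x i, y l} \<in> edges G"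
begin

lemma verts_G: "verts G = x ` S \<union> y ` S"
  using bip by (auto simp: bipartition_def)

lemma x_neq_y: "i \<in> S \<Longrightarrow> j \<in> S \<Longrightarrow> x i \<noteq> y j"
  using bip by (auto simp: bipartition_def)

lemma x_eq: "i \<in> S \<Longrightarrow> j \<in> S \<Longrightarrow> x i = x j \<longleftrightarrow> i = j" and y_eq: "i \<in> S \<Longrightarrow> j \<in> S \<Longrightarrow> y i = y j \<longleftrightarrow> i = j"
  using inj_x inj_y by (auto simp: inj_on_def)

lemma edgeE:
  assumes "e \<in> edges G"
  obtains i j where "i \<in> S" "j \<in> S" "e = {x i, y j}"
proof -
  from bip assms obtain u v where "u \<in> x ` S" "v \<in> y ` S" "e = {u, v}"
    unfolding bipartition_def by metis
  then show thesis using that by auto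
qed

lemma labeled_delete:
  assumes "D \<subseteq> S"
  shows "labeled_bipartite (delete_verts G (x ` D \<union> y ` D)) x y (S - D)"
proof
  let ?H = "delete_verts G (x ` D \<union> y ` D)"
  have edge: "{x i, y j} \<in> edges ?H \<longleftrightarrow> {x i, y j} \<in> edges G" if "i \<in> S - D" "j \<in> S - D" for i j
  proof -
    have "x i \<notin> x ` D" "y j \<notin> y ` D" "x i \<notin> y ` D" "y j \<notin> x ` D"
      using that assms x_eq y_eq x_neq_y by (auto, metis subsetD)
    then show ?thesis by (auto simp: delete_verts_def)
  qed
  show "finite (S - D)" using finite_S by simp
  show "simple_graph ?H" by (rule simple_graph_delete_verts[OF G])
  show "inj_on x (S - D)" "inj_on y (S - D)" using inj_x inj_y by (auto intro: inj_on_subset)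
  show "bipartition ?H (x ` (S - D)) (y ` (S - D))"
    unfolding bipartition_def
  proof (intro conjI ballI)
    have "x ` (S - D) = x ` S - (x ` D \<union> y ` D)" "y ` (S - D) = y ` S - (x ` D \<union> y ` D)"
      using assms x_eq y_eq x_neq_y by (auto, (metis subsetD)+)
    then show "x ` (S - D) \<union> y ` (S - D) = verts ?H" by (auto simp: delete_verts_def verts_G)
    show "x ` (S - D) \<inter> y ` (S - D) = {}" using x_neq_y by auto
    fix e assume e: "e \<in> edges ?H"
    then have "e \<in> edges G" by (simp add: delete_verts_def)
    then obtain i j where ij: "i \<in> S" "j \<in> S" "e = {x i, y j}" by (rule edgeE)
    then have "i \<in> S - D" "j \<in> S - D" using e by (auto simp: delete_verts_def)
    then show "\<exists>a\<in>x ` (S - D). \<exists>b\<in>y ` (S - D). e = {a, b}" using ij by blast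
  qed
  show "{x i, y i} \<in> edges ?H" if "i \<in> S - D" for i using edge[of i i] that diag by simp
  show "i \<le> j" if "i \<in> S - D" "j \<in> S - D" "{x i, y j} \<in> edges ?H" for i j
    using edge[of i j] that mono by simp
  show "{x i, y l} \<in> edges ?H"
    if "i \<in> S - D" "j \<in> S - D" "l \<in> S - D" "i < j" "j < l" "{x i, y j} \<in> edges ?H" "{x j, y l} \<in> edges ?H" for i j l
    using edge that trans[of i j l] by simp
qed

end

text \<open>With \<open>n\<close> the largest label, \<open>mono\<close> leaves \<open>y n\<close>
  as the only possible neighbor of \<open>x n\<close>; the labels of the remaining neighbors of
  \<open>y n\<close> are collected in \<open>J\<close>.\<close>

locale labeled_bipartite_last = labeled_bipartite +
  fixes n :: nat and J :: "nat set"
  assumes n: "n \<in> S" "\<And>i. i \<in> S \<Longrightarrow> i \<le> n"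
    and J: "J \<subseteq> S - {n}" "\<And>i. i \<in> S \<Longrightarrow> {x i, y n} \<in> edges G \<longleftrightarrow> i \<in> J \<or> i = n"
begin

definition "G' = delete_verts G {x n, y n}"
definition "G'' = delete_verts G (x ` J \<union> y ` J \<union> {x n, y n})"

lemma labeled_G': "labeled_bipartite G' x y (S - {n})"
  using labeled_delete[of "{n}"] n by (simp add: G'_def insert_commute)

lemma labeled_G'': "labeled_bipartite G'' x y (S - insert n J)"
proof -
  have "x ` insert n J \<union> y ` insert n J = x ` J \<union> y ` J \<union> {x n, y n}" by auto
  moreover have "insert n J \<subseteq> S" using n(1) J(1) by auto
  ultimately show ?thesis using labeled_delete[of "insert n J"] by (simp only: G''_def)
qed

lemma simple_G': "simple_graph G'" and simple_G'': "simple_graph G''"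
  by (simp_all add: G'_def G''_def simple_graph_delete_verts[OF G])

lemma edge_G': "i \<in> S \<Longrightarrow> j \<in> S \<Longrightarrow> {x i, y j} \<in> edges G \<Longrightarrow> i \<noteq> n \<Longrightarrow> j \<noteq> n \<Longrightarrow> {x i, y j} \<in> edges G'"
  using x_eq y_eq x_neq_y n by (auto simp: G'_def delete_verts_def) (metis x_neq_y)

lemma edges_G'_subset: "e \<in> edges G' \<Longrightarrow> e \<in> edges G \<and> x n \<notin> e \<and> y n \<notin> e"
  by (auto simp: G'_def delete_verts_def)

lemma edges_G''_subset: "e \<in> edges G'' \<Longrightarrow> e \<in> edges G \<and> x n \<notin> e \<and> y n \<notin> e \<and> e \<inter> x ` J = {}"
  by (auto simp: G''_def delete_verts_def)

lemma finite_xJ: "finite (x ` J)"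
  using J finite_S finite_subset by blast

lemma covers_G'_of_G'':
  assumes "covers G'' t"
  shows "covers G' (smon (x ` J) + t)"
  unfolding covers_def
proof
  fix e assume e: "e \<in> edges G'"
  then obtain i l where il: "i \<in> S" "l \<in> S" "e = {x i, y l}" using edges_G'_subset edgeE by metis
  have eG: "{x i, y l} \<in> edges G" and ne: "i \<noteq> n" "l \<noteq> n" using e il edges_G'_subset by auto
  show "e \<inter> keys (smon (x ` J) + t) \<noteq> {}"
  proof (cases "i \<in> J")
    case True
    then show ?thesis using il by (auto simp: keys_plus_nat keys_smon[OF finite_xJ])
  next
    case False
    have "l \<notin> J"
    proof
      assume "l \<in> J"
      then have "{x l, y n} \<in> edges G" "i < l" "l < n"
        using J(2)[OF il(2)] mono[OF il(1,2) eG] False n(2)[OF il(2)] ne by (auto simp: le_less)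
      then have "{x i, y n} \<in> edges G" using trans[OF il(1,2) n(1)] eG by blast
      then show False using J(2)[OF il(1)] False ne by simp
    qed
    then have "{x i, y l} \<in> edges G''"
      using eG ne il False J n x_eq y_eq x_neq_y
      by (auto simp: G''_def delete_verts_def) (metis Diff_iff subsetD x_neq_y)+
    then show ?thesis using assms il by (auto simp: covers_def keys_plus_nat)
  qed
qed

text \<open>The inclusion of \<open>y n\<close> times \<open>L'\<close> in \<open>L\<close>, by
  exponents: an edge avoiding \<open>y n\<close> also avoids \<open>x n\<close> and so survives in
  \<open>G'\<close>.\<close>

lemma covers_G_of_G':
  assumes "covers G' t"
  shows "covers G (single (y n) 1 + t)"
  unfolding covers_def
proof
  fix e assume e: "e \<in> edges G"
  then obtain i l where il: "i \<in> S" "l \<in> S" "e = {x i, y l}" by (rule edgeE)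
  show "e \<inter> keys (single (y n) 1 + t) \<noteq> {}"
  proof (cases "l = n")
    case True then show ?thesis using il by (simp add: keys_plus_nat)
  next
    case False
    \<comment> \<open>\<open>i = n\<close> would give \<open>n \<le> l\<close> by
      \<open>mono\<close>, hence \<open>l = n\<close>, as \<open>n\<close> is the largest
      label.\<close>
    then have "i \<noteq> n" using mono[OF il(1,2)] e il n(2)[OF il(2)] by fastforce
    then have "e \<in> edges G'" using edge_G' il e False by simp
    then show ?thesis using assms by (auto simp: covers_def keys_plus_nat)
  qed
qed

lemma covers_G_of_G'':
  assumes "covers G'' t"
  shows "covers G (single (x n) 1 + smon (x ` J) + t)"
  unfolding covers_def
proof
  fix e assume e: "e \<in> edges G"
  then obtain i l where il: "i \<in> S" "l \<in> S" "e = {x i, y l}" by (rule edgeE)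
  show "e \<inter> keys (single (x n) 1 + smon (x ` J) + t) \<noteq> {}"
  proof (cases "i = n \<or> l = n")
    case True
    then have "i = n \<or> i \<in> J" using J(2)[OF il(1)] e il by auto
    then show ?thesis using il by (auto simp: keys_plus_nat keys_smon[OF finite_xJ])
  next
    case False
    then have "e \<in> edges G'" using edge_G' il e by simp
    then have "e \<inter> keys (smon (x ` J) + t) \<noteq> {}" using covers_G'_of_G''[OF assms] by (simp add: covers_def)
    then show ?thesis by (auto simp: keys_plus_nat)
  qed
qed

lemma covers_G'_cancel: "covers G (single (y n) 1 + t) \<Longrightarrow> covers G' t"
  using edges_G'_subset by (fastforce simp: covers_def keys_plus_nat)

lemma covers_G''_cancel_y: "covers G'' (single (y n) 1 + t) \<Longrightarrow> covers G'' t"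
  using edges_G''_subset by (fastforce simp: covers_def keys_plus_nat)

text \<open>The vertices in the added monomial are deleted in \<open>G''\<close> and cannot cover
  any of its edges, so the remaining factor does.\<close>

lemma covers_G''_cancel:
  assumes "covers G (single (x n) 1 + smon (x ` J) + t)"
  shows "covers G'' t"
  unfolding covers_def
proof
  fix e assume "e \<in> edges G''"
  then have e: "e \<in> edges G" "x n \<notin> e" "e \<inter> x ` J = {}" using edges_G''_subset by blast+
  then have "e \<inter> keys (single (x n) 1 + smon (x ` J) + t) \<noteq> {}" using assms by (simp add: covers_def)
  then show "e \<inter> keys t \<noteq> {}" using e by (auto simp: keys_plus_nat keys_smon[OF finite_xJ])
qed

lemma covers_without_y:
  assumes "covers G t" "y n \<notin> keys t"
  shows "x n \<in> keys t" "x ` J \<subseteq> keys t"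
proof -
  have *: "x i \<in> keys t" if "i \<in> S" "i \<in> J \<or> i = n" for i
    using assms J(2)[OF that(1)] that by (auto simp: covers_def)
  show "x n \<in> keys t" "x ` J \<subseteq> keys t" using * n J by auto
qed

lemma n_xJ: "x n \<notin> x ` J"
proof
  assume "x n \<in> x ` J"
  then obtain i where "i \<in> J" "x n = x i" by auto
  moreover from this have "i \<in> S" "i \<noteq> n" using J(1) by auto
  ultimately show False using x_eq[OF n(1)] by auto
qed

end

section \<open>The cover ideal as a sum of two multiples of smaller cover ideals\<close>

locale cover_ideal_cone = polynomial_modules K V + labeled_bipartite_last G x y S n J
  for K :: "'k::field itself" and V :: "'v set" and G :: "'v graph"
    and x y :: "nat \<Rightarrow> 'v" and S n J +
  assumes V: "verts G \<subseteq> V"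
begin

abbreviation "L \<equiv> cover_ideal K V G"
abbreviation "L' \<equiv> cover_ideal K V G'"
abbreviation "L'' \<equiv> cover_ideal K V G''"

lemma verts_V: "verts G' \<subseteq> V" "verts G'' \<subseteq> V" "x i \<in> V" "y i \<in> V" if "i \<in> S"
  using V that by (auto simp: G'_def G''_def delete_verts_def verts_G)

lemma mem_L: "p \<in> L \<longleftrightarrow> p \<in> polys V \<and> (\<forall>t\<in>keys p. covers G t)"
  and mem_L': "p \<in> L' \<longleftrightarrow> p \<in> polys V \<and> (\<forall>t\<in>keys p. covers G' t)"
  and mem_L'': "p \<in> L'' \<longleftrightarrow> p \<in> polys V \<and> (\<forall>t\<in>keys p. covers G'' t)"
  using cover_ideal_eq[OF G V, where K = K] cover_ideal_eq[OF simple_G' verts_V(1)[OF n(1)], where K = K]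
    cover_ideal_eq[OF simple_G'' verts_V(2)[OF n(1)], where K = K]
  by (auto simp: covers_def)

lemma cover_ideal_ideal:
  fixes H :: "'v graph"
  assumes "simple_graph H" "verts H \<subseteq> V"
  shows "ideal (cover_ideal K V H) R"
proof -
  interpret cring R by (rule poly_ring_cring)
  have fin: "finite (verts H)" using assms by (simp add: simple_graph_def)
  have "(\<Prod>w\<in>W. var w) \<in> polys V" if "minimal_vertex_cover H W" for W
  proof -
    have "W \<subseteq> verts H" using that by (simp add: minimal_vertex_cover_def vertex_cover_def)
    then have "finite W" "W \<subseteq> V" using assms fin finite_subset by auto
    then show ?thesis by (simp add: prod_var_eq polys_single keys_smon)
  qed
  then show ?thesis unfolding cover_ideal_def by (intro genideal_ideal) auto
qed

lemma ideals: "ideal L R" "ideal L' R" "ideal L'' R"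
  using cover_ideal_ideal G V simple_G' simple_G'' verts_V(1,2)[OF n(1)] by blast+

definition a :: "('v, 'k) mpoly" where "a = single (single (x n) 1) 1"
definition b :: "('v, 'k) mpoly" where "b = single (single (y n) 1) 1"
definition q :: "('v, 'k) mpoly" where "q = single (smon (x ` J)) 1"

lemma aq: "a * q = single (single (x n) 1 + smon (x ` J)) 1"
  by (simp add: a_def q_def mult_single)

lemma abq_polys: "a \<in> polys V" "b \<in> polys V" "q \<in> polys V"
proof -
  have "x ` J \<subseteq> V" using J verts_V(3) by auto
  then show "a \<in> polys V" "b \<in> polys V" "q \<in> polys V"
    using verts_V(3,4)[OF n(1)] by (auto simp: a_def b_def q_def keys_smon[OF finite_xJ] intro!: polys_single)
qed

lemma polys_of_monomial_mult:
  assumes "(single s 1 * p :: ('v, 'k) mpoly) \<in> polys V"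
  shows "p \<in> polys V"
  using assms by (auto simp: polys_def keys_single_one_mult keys_plus_nat)

lemma L_eq: "L = {b * p - a * q * p' | p p'. p \<in> L' \<and> p' \<in> L''}"
proof (intro subset_antisym subsetI)
  fix f assume f: "f \<in> L"
  define f1 where "f1 = keys_part (\<lambda>t. y n \<in> keys t) f"
  define f2 where "f2 = keys_part (\<lambda>t. \<not> y n \<in> keys t) f"
  have fp: "f \<in> polys V" and cov: "\<And>t. t \<in> keys f \<Longrightarrow> covers G t" using f by (auto simp: mem_L)
  have "lookup (single (y n) 1) v \<le> lookup t v" if "t \<in> keys f1" for t v
    using that by (auto simp: f1_def keys_keys_part lookup_single when_def in_keys_iff)
  then obtain p where p: "f1 = single (single (y n) 1) 1 * p" "keys f1 = (+) (single (y n) 1) ` keys p"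
    by (rule divide_by_monomial)
  have "p \<in> L'"
    unfolding mem_L'
  proof
    show "p \<in> polys V"
      by (rule polys_of_monomial_mult[of "single (y n) 1"])
        (unfold p(1)[symmetric] f1_def, rule polys_keys_part[OF fp])
    show "\<forall>t\<in>keys p. covers G' t"
    proof
      fix t assume "t \<in> keys p"
      then have "single (y n) 1 + t \<in> keys f1" using p(2) by auto
      then have "covers G (single (y n) 1 + t)" using cov by (auto simp: f1_def keys_keys_part)
      then show "covers G' t" by (rule covers_G'_cancel)
    qed
  qed
  have "lookup (single (x n) 1 + smon (x ` J)) v \<le> lookup t v" if "t \<in> keys f2" for t v
  proof -
    have "covers G t" "y n \<notin> keys t" using that cov by (auto simp: f2_def keys_keys_part)
    then have "x n \<in> keys t" "x ` J \<subseteq> keys t" by (rule covers_without_y)+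
    then show ?thesis
      using n_xJ smon_le[OF finite_xJ, of t v]
      by (auto simp: lookup_add lookup_single when_def lookup_smon[OF finite_xJ] in_keys_iff)
  qed
  then obtain p' where p': "f2 = single (single (x n) 1 + smon (x ` J)) 1 * p'"
    "keys f2 = (+) (single (x n) 1 + smon (x ` J)) ` keys p'"
    by (rule divide_by_monomial)
  \<comment> \<open>The cone is set up for a difference, so the second quotient enters with the
    opposite sign.\<close>
  have "- p' \<in> L''"
    unfolding mem_L''
  proof
    have "p' \<in> polys V"
      by (rule polys_of_monomial_mult[of "single (x n) 1 + smon (x ` J)"])
        (unfold p'(1)[symmetric] f2_def, rule polys_keys_part[OF fp])
    then show "- p' \<in> polys V" by (rule polys_uminus)
    show "\<forall>t\<in>keys (- p'). covers G'' t"
    proof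
      fix t assume "t \<in> keys (- p')"
      then have "t \<in> keys p'" by (simp add: in_keys_iff)
      then have "single (x n) 1 + smon (x ` J) + t \<in> keys f2" using p'(2) by auto
      then have "covers G (single (x n) 1 + smon (x ` J) + t)" using cov by (auto simp: f2_def keys_keys_part)
      then show "covers G'' t" by (rule covers_G''_cancel)
    qed
  qed
  moreover have "f = b * p - a * q * (- p')"
    using keys_part_split[of "\<lambda>t. y n \<in> keys t" f] p(1) p'(1) by (simp add: aq b_def f1_def f2_def)
  ultimately show "f \<in> {b * p - a * q * p' | p p'. p \<in> L' \<and> p' \<in> L''}" using \<open>p \<in> L'\<close> by blast
next
  fix f assume "f \<in> {b * p - a * q * p' | p p'. p \<in> L' \<and> p' \<in> L''}"
  then obtain p p' where p: "f = b * p - a * q * p'" "p \<in> L'" "p' \<in> L''" by blast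
  have bp: "b * p \<in> L"
    using p(2) covers_G_of_G' abq_polys
    by (auto simp: mem_L mem_L' b_def keys_single_one_mult intro!: polys_mult)
  have aqp: "- (a * q * p') \<in> L"
    unfolding mem_L
  proof
    have "p' \<in> polys V" using p(3) by (simp add: mem_L'')
    then show "- (a * q * p') \<in> polys V" by (intro polys_uminus polys_mult abq_polys)
    show "\<forall>t\<in>keys (- (a * q * p')). covers G t"
    proof
      fix t assume "t \<in> keys (- (a * q * p'))"
      then have "t \<in> keys (single (single (x n) 1 + smon (x ` J)) 1 * p')" by (simp add: in_keys_iff aq)
      then obtain s where "s \<in> keys p'" "t = single (x n) 1 + smon (x ` J) + s"
        by (auto simp: keys_single_one_mult)
      then show "covers G t" using covers_G_of_G'' p(3) by (simp add: mem_L'')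
    qed
  qed
  have "b * p + - (a * q * p') \<in> L"
    using additive_subgroup.a_closed[OF ideal.axioms(1)[OF ideals(1)] bp aqp] by simp
  then show "f \<in> L" using p(1) by simp
qed

lemma cone_ranks:
  assumes "minres L' r' d' e'" "minres L'' r'' d'' e''"
  shows "\<exists>d e. minres L (\<lambda>j. r' j + r'' j + (case j of 0 \<Rightarrow> 0 | Suc i \<Rightarrow> r'' i)) d e"
proof (rule mapping_cone[OF ideals(2,3) assms, of a b q])
  show "a \<in> polys V" "b \<in> polys V" "q \<in> polys V" by (rule abq_polys)+
  have "single v 1 \<noteq> (0 :: 'v \<Rightarrow>\<^sub>0 nat)" for v by (metis lookup_single_eq lookup_zero zero_neq_one)
  then show "lookup a 0 = 0" "lookup b 0 = 0" by (simp_all add: a_def b_def lookup_single when_def)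
  show "q * p \<in> L'" if "p \<in> L''" for p
    using that covers_G'_of_G'' abq_polys
    by (auto simp: mem_L' mem_L'' q_def keys_single_one_mult intro!: polys_mult)
  show "L = {b * p - a * q * p' | p p'. p \<in> L' \<and> p' \<in> L''}" by (rule L_eq)
  show "p = 0" if "b * p = 0" for p
    using single_one_mult_cancel[of "single (y n) 1" p 0] that by (simp add: b_def)
  fix p p' assume p: "p \<in> L'" "p' \<in> L''" and eq: "b * p = a * q * p'"
  \<comment> \<open>Every term of \<open>a * q * p'\<close> is divisible by \<open>y n\<close>, and
    \<open>y n\<close> is none of the variables in \<open>a * q\<close>, so it divides the terms of
    \<open>p'\<close>. The quotient is the element \<open>g\<close> that describes the intersection
    of the two summands.\<close>
  have "y n \<in> keys t" if "t \<in> keys p'" for t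
  proof -
    have "single (x n) 1 + smon (x ` J) + t \<in> keys (a * q * p')"
      using that by (simp add: aq keys_single_one_mult)
    then have "single (x n) 1 + smon (x ` J) + t \<in> keys (b * p)" using eq by simp
    then obtain s where "single (x n) 1 + smon (x ` J) + t = single (y n) 1 + s"
      by (auto simp: b_def keys_single_one_mult)
    then have "y n \<in> keys (single (x n) 1 + smon (x ` J) + t)" by (simp add: keys_plus_nat)
    moreover have "x i \<noteq> y n" if "i \<in> S" for i by (rule x_neq_y[OF that n(1)])
    then have "y n \<noteq> x n" "y n \<notin> x ` J" using n(1) J(1) by force+
    ultimately show ?thesis by (simp add: keys_plus_nat keys_smon[OF finite_xJ])
  qed
  then have "lookup (single (y n) 1) v \<le> lookup t v" if "t \<in> keys p'" for t v
    using that by (auto simp: lookup_single when_def in_keys_iff Suc_le_eq)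
  then obtain g where g: "p' = single (single (y n) 1) 1 * g" "keys p' = (+) (single (y n) 1) ` keys g"
    by (rule divide_by_monomial)
  have "g \<in> L''"
    unfolding mem_L''
  proof
    show "g \<in> polys V"
      by (rule polys_of_monomial_mult[of "single (y n) 1"]) (unfold g(1)[symmetric], use p(2) in \<open>simp add: mem_L''\<close>)
    show "\<forall>t\<in>keys g. covers G'' t"
      using p(2) g(2) covers_G''_cancel_y by (auto simp: mem_L'')
  qed
  moreover have "b * p = b * (a * q * g)" using eq g(1) by (simp add: b_def mult_ac)
  then have "p = a * q * g" unfolding b_def by (rule single_one_mult_cancel)
  ultimately show "\<exists>g\<in>L''. p' = b * g \<and> p = a * q * g" using g(1) by (auto simp: b_def)
qed

end

section \<open>Existence of minimal resolutions and the recursion for Betti numbers\<close>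

lemma (in polynomial_modules) minres_unit_ideal:
  "minres (polys V) (\<lambda>j. if j = 0 then 1 else 0) (\<lambda>j v. 0) (\<lambda>v. v 0)"
proof -
  have z: "v = 0" if "v \<in> fm 0" for v using that by (auto simp: fm_def fun_eq_iff)
  have one: "v = 0" if "v \<in> fm (Suc 0)" "v 0 = 0" for v
    using that by (auto simp: fm_def fun_eq_iff) (metis less_Suc0 not_less_eq not_less linorder_not_le Suc_leI neq0_conv)
  have "(\<lambda>v. v 0) ` fm (Suc 0) = polys V"
  proof (intro subset_antisym subsetI)
    fix p :: "('v, 'k) mpoly" assume "p \<in> polys V"
    then have "smul p (unit 0) \<in> fm (Suc 0)" "p = smul p (unit 0) 0" by (auto simp: smul_unit_0)
    then show "p \<in> (\<lambda>v. v 0) ` fm (Suc 0)" by blast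
  qed (auto simp: fm_def)
  moreover have "0 \<in> fm m" "0 \<in> mm m" for m using submodD(1)[OF submod_fm] submodD(1)[OF submod_mm] .
  moreover have "fm 0 = {0}" using z \<open>\<And>m. 0 \<in> fm m\<close> by auto
  ultimately show ?thesis
    using one unfolding minres_def res_def by (auto simp: lin_def smul_def)
qed

text \<open>Strong induction on the number of labels: both subgraphs are labeled by proper subsets
  of \<open>S\<close>, and the cone of their minimal resolutions is minimal. Without labels there
  are no edges, and the cover ideal is the whole ring. The ring itself stays fixed
  throughout.\<close>

lemma (in polynomial_modules) exists_minres:
  assumes "labeled_bipartite G x y S" "verts G \<subseteq> V"
  shows "\<exists>rk d e. minres (cover_ideal K V G) rk d e"
  using assms
proof (induction "card S" arbitrary: G S rule: less_induct)
  case less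
  interpret labeled_bipartite G x y S by fact
  show ?case
  proof (cases "S = {}")
    case True
    then have "edges G = {}" using edgeE by auto
    then have "cover_ideal K V G = polys V" using cover_ideal_eq[OF G less.prems(2), of K] by simp
    then show ?thesis using minres_unit_ideal by metis
  next
    case False
    define n where "n = Max S"
    define J where "J = {i \<in> S - {n}. {x i, y n} \<in> edges G}"
    have n: "n \<in> S" "\<And>i. i \<in> S \<Longrightarrow> i \<le> n" using False finite_S by (auto simp: n_def)
    interpret cover_ideal_cone K V G x y S n J
      using n diag[OF n(1)] less.prems(2) by unfold_locales (auto simp: J_def)
    have "S - {n} \<subset> S" "S - insert n J \<subset> S" using n(1) by blast+
    then have "card (S - {n}) < card S" "card (S - insert n J) < card S"
      using psubset_card_mono[OF finite_S] by blast+
    then obtain r' d' e' r'' d'' e'' where "minres L' r' d' e'" "minres L'' r'' d'' e''"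
      using less.hyps[OF _ labeled_G' verts_V(1)[OF n(1)]] less.hyps[OF _ labeled_G'' verts_V(2)[OF n(1)]] by metis
    then show ?thesis using cone_ranks by blast
  qed
qed

lemma (in cover_ideal_cone) betti_recursion:
  "betti K V L i = betti K V L' i + betti K V L'' i + (if i = 0 then 0 else betti K V L'' (i - 1))"
proof -
  obtain r' d' e' where m': "minres L' r' d' e'"
    using exists_minres[OF labeled_G' verts_V(1)[OF n(1)]] by blast
  obtain r'' d'' e'' where m'': "minres L'' r'' d'' e''"
    using exists_minres[OF labeled_G'' verts_V(2)[OF n(1)]] by blast
  obtain d e where "minres L (\<lambda>j. r' j + r'' j + (case j of 0 \<Rightarrow> 0 | Suc i \<Rightarrow> r'' i)) d e"
    using cone_ranks[OF m' m''] by blast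
  then show ?thesis
    using betti_minres[OF ideals(1), of _ d e i] betti_minres[OF ideals(2) m'] betti_minres[OF ideals(3) m'']
    by (auto split: nat.split)
qed

section \<open>Bipartiteness of subgraphs and assembly of the claims\<close>

lemma bipartite_delete_verts:
  assumes "bipartition G A B"
  shows "bipartite (delete_verts G S)"
  unfolding bipartite_def bipartition_def
proof (rule exI[of _ "A - S"], rule exI[of _ "B - S"], intro conjI ballI)
  show "A - S \<union> (B - S) = verts (delete_verts G S)" "(A - S) \<inter> (B - S) = {}"
    using assms by (auto simp: bipartition_def delete_verts_def)
  fix e assume e: "e \<in> edges (delete_verts G S)"
  then obtain a b where "a \<in> A" "b \<in> B" "e = {a, b}"
    using assms by (auto simp: bipartition_def delete_verts_def)
  then show "\<exists>a\<in>A - S. \<exists>b\<in>B - S. e = {a, b}" using e by (auto simp: delete_verts_def)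
qed

theorem theorem3p8:
  fixes K :: "'k::field itself"
    and G :: "'v graph"
    and x y :: "nat \<Rightarrow> 'v"
    and n :: nat
    and J :: "nat set"
  assumes "n \<ge> 1"
    and "simple_graph G"
    and "inj_on x {1..n}" and "inj_on y {1..n}"
    and "bipartition G (x ` {1..n}) (y ` {1..n})"
    and "cohen_macaulay_graph K G"
    and "\<forall>i\<in>{1..n}. {x i, y i} \<in> edges G"
    and "\<forall>i\<in>{1..n}. \<forall>j\<in>{1..n}. {x i, y j} \<in> edges G \<longrightarrow> i \<le> j"
    and "\<forall>i\<in>{1..n}. \<forall>j\<in>{1..n}. \<forall>l\<in>{1..n}.
           i < j \<and> j < l \<and> {x i, y j} \<in> edges G \<and> {x j, y l} \<in> edges G \<longrightarrow> {x i, y l} \<in> edges G"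
    and "J \<subseteq> {1..<n}"
    and "neighbors G (y n) = x ` J \<union> {x n}"
  shows "let G' = delete_verts G {x n, y n};
             G'' = delete_verts G (x ` J \<union> y ` J \<union> {x n, y n});
             \<beta> = (\<lambda>i H. betti K (verts G) (cover_ideal K (verts G) H) i)
         in neighbors G (x n) = {y n} \<and>
            bipartite G' \<and> cohen_macaulay_graph K G' \<and>
            bipartite G'' \<and> cohen_macaulay_graph K G'' \<and>
            (\<forall>i. \<beta> i G = \<beta> i G' + \<beta> i G'' + (if i = 0 then 0 else \<beta> (i - 1) G''))"
proof -
  interpret labeled_bipartite G x y "{1..n}"
  proof
    show "{x i, y l} \<in> edges G"
      if "i \<in> {1..n}" "j \<in> {1..n}" "l \<in> {1..n}" "i < j" "j < l" "{x i, y j} \<in> edges G" "{x j, y l} \<in> edges G" for i j l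
      using assms(9) that by blast
    show "{x i, y i} \<in> edges G" if "i \<in> {1..n}" for i using assms(7) that by blast
    show "i \<le> j" if "i \<in> {1..n}" "j \<in> {1..n}" "{x i, y j} \<in> edges G" for i j
      using assms(8) that by blast
  qed (fact | simp)+
  have nS: "n \<in> {1..n}" using assms(1) by simp
  have JS: "J \<subseteq> {1..n} - {n}" using assms(10) by auto
  have edge_n: "{x i, y n} \<in> edges G \<longleftrightarrow> i \<in> J \<or> i = n" if i: "i \<in> {1..n}" for i
  proof -
    have "{x i, y n} \<in> edges G \<longleftrightarrow> x i \<in> neighbors G (y n)"
      using i by (auto simp: neighbors_def verts_G insert_commute)
    also have "\<dots> \<longleftrightarrow> i \<in> J \<or> i = n"
      using inj_on_image_mem_iff[OF inj_x i, of J] JS x_eq[OF i nS] unfolding assms(11) by blast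
    finally show ?thesis .
  qed
  interpret cover_ideal_cone K "verts G" G x y "{1..n}" n J
    using nS JS edge_n by unfold_locales auto
  have nb_x: "neighbors G (x n) = {y n}"
  proof (intro subset_antisym subsetI)
    fix v assume "v \<in> neighbors G (x n)"
    then have e: "{x n, v} \<in> edges G" by (simp add: neighbors_def)
    then obtain i j where ij: "i \<in> {1..n}" "j \<in> {1..n}" "{x n, v} = {x i, y j}" by (rule edgeE)
    have "x n \<noteq> y j" by (rule x_neq_y[OF nS ij(2)])
    then have "v = y j" using ij(3) by (auto simp: doubleton_eq_iff)
    have "{x n, y j} \<in> edges G" using e \<open>v = y j\<close> by simp
    then have "n \<le> j" by (rule mono[OF nS ij(2)])
    then show "v \<in> {y n}" using ij(2) \<open>v = y j\<close> by simp
  next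
    fix v assume "v \<in> {y n}"
    then show "v \<in> neighbors G (x n)" using diag[OF nS] nS by (simp add: neighbors_def verts_G)
  qed
  have CM': "cohen_macaulay_graph K (delete_verts G {x n, y n})"
    using cohen_macaulay_delete_closed_neighborhood[OF assms(2) _ assms(6), of "x n"] nS
    unfolding nb_x verts_G by blast
  have CM'': "cohen_macaulay_graph K (delete_verts G (x ` J \<union> y ` J \<union> {x n, y n}))"
  proof -
    let ?D = "insert (y n) (x ` J \<union> {x n})"
    have base: "cohen_macaulay_graph K (delete_verts G ?D)"
      using cohen_macaulay_delete_closed_neighborhood[OF assms(2) _ assms(6), of "y n"] nS
      unfolding assms(11) verts_G by blast
    have "finite J" using JS by (rule finite_subset) simp
    \<comment> \<open>The closed neighborhood of an isolated vertex is the vertex alone, so the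
      \<open>y j\<close> can be removed one at a time.\<close>
    have step: "F \<subseteq> J \<Longrightarrow> cohen_macaulay_graph K (delete_verts G (?D \<union> y ` F))" if "finite F" for F
      using that
    proof (induction F rule: finite_induct)
      case empty
      then show ?case using base by simp
    next
      case (insert j F)
      let ?H = "delete_verts G (?D \<union> y ` F)"
      have j: "j \<in> J" "j \<in> {1..n}" "j \<noteq> n" using insert JS by auto
      have F: "F \<subseteq> {1..n}" using insert JS by auto
      have "y j \<notin> y ` F" using inj_on_image_mem_iff[OF inj_y j(2) F] insert.hyps(2) by simp
      moreover have "y j \<noteq> y n" using y_eq[OF j(2) nS] j(3) by simp
      moreover have "x i \<noteq> y j" if "i \<in> {1..n}" for i by (rule x_neq_y[OF that j(2)])
      then have "y j \<notin> x ` J" "y j \<noteq> x n" using JS nS by force+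
      ultimately have "y j \<notin> ?D \<union> y ` F" by simp
      then have v: "y j \<in> verts ?H" using j by (auto simp: delete_verts_def verts_G)
      have "neighbors ?H (y j) = {}"
      proof (rule equals0I)
        fix v assume "v \<in> neighbors ?H (y j)"
        then have v: "{y j, v} \<in> edges G" "v \<notin> ?D" by (auto simp: neighbors_def delete_verts_def)
        from v(1) obtain i l where il: "i \<in> {1..n}" "l \<in> {1..n}" "{y j, v} = {x i, y l}" by (rule edgeE)
        have "y j \<noteq> x i" using x_neq_y j(2) il by metis
        then have vi: "v = x i" "y j = y l" using il(3) by (auto simp: doubleton_eq_iff)
        have e: "{x i, y j} \<in> edges G" using v(1) vi by (simp add: insert_commute)
        have "i \<le> j" by (rule mono[OF il(1) j(2) e])
        moreover have "{x j, y n} \<in> edges G" "j < n" using edge_n[OF j(2)] j by auto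
        \<comment> \<open>For \<open>i = j\<close> this is the edge from \<open>x j\<close> to
          \<open>y n\<close> itself, and for \<open>i < j\<close> it follows from
          \<open>trans\<close>; either way \<open>x i\<close> belongs to the set already
          deleted.\<close>
        ultimately have "{x i, y n} \<in> edges G"
          using trans[OF il(1) j(2) nS _ _ e] by (cases "i = j") auto
        then show False using edge_n[OF il(1)] v(2) vi by auto
      qed
      then have "cohen_macaulay_graph K (delete_verts ?H {y j})"
        using cohen_macaulay_delete_closed_neighborhood[OF simple_graph_delete_verts[OF assms(2)] v] insert by simp
      moreover have "delete_verts ?H {y j} = delete_verts G (?D \<union> y ` insert j F)"
        unfolding delete_verts_delete_verts by (rule arg_cong[of _ _ "delete_verts G"]) auto
      ultimately show ?case by simp
    qed
    from step[OF \<open>finite J\<close>] have "cohen_macaulay_graph K (delete_verts G (?D \<union> y ` J))" by simp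
    moreover have "?D \<union> y ` J = x ` J \<union> y ` J \<union> {x n, y n}" by auto
    ultimately show ?thesis by simp
  qed
  show ?thesis
    unfolding Let_def
    using nb_x CM' CM'' bipartite_delete_verts[OF assms(5)] betti_recursion
    by (simp add: G'_def G''_def)
qed

end
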